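(* Let $\lambda\in\mathbb{R}^+$ and consider the system $$dZ_t=\mu(Z_t,t)\,dt+\sigma(Z_t,t)\,dX_t,\quad Z_0=z_0,\qquad dX_t=\sqrt{2\lambda}\,\tanh\!\big(\sqrt{2\lambda}X_t\big)dt+dW_t,\quad X_0=0,$$ where the noise $X$ is represented as $dX_t=\mathcal{B}\,dt+dW_t$ (see context). Let $g(z,t)$ be a real-valued function of class $\mathcal{C}^{2,1}$ (twice continuously differentiable in $z\in\mathbb{R}$, once in $t$). Then $$dg(Z_t,t)=\left[\frac{\partial g}{\partial t}+\Big(\mu(Z_t,t)+\sigma(Z_t,t)\,\mathcal{B}\Big)\frac{\partial g}{\partial z}+\frac{\sigma(Z_t,t)^2}{2}\frac{\partial^2g}{\partial z^2}\right]dt+\sigma(Z_t,t)\frac{\partial g}{\partial z}\,dW_t,$$ where the partial derivatives of $g$ are evaluated at $(Z_t,t)$.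
   Context: $\mu(\cdot,\cdot)$ and $\sigma(\cdot,\cdot)$ are real-valued, bounded, measurable functions satisfying the standard conditions for existence and uniqueness of a (strong) solution: linear growth, $|\mu(z,t)|+|\sigma(z,t)|\le C(1+|z|)$, and Lipschitz continuity in $z$ uniformly in $t\in[0,T]$, $|\mu(z,t)-\mu(z',t)|+|\sigma(z,t)-\sigma(z',t)|\le D|z-z'|$. $\mathcal{B}$ is a Bernoulli random variable taking the values $\pm\sqrt{2\lambda}$ with probability $0.5$ each, independent of the Wiener process $W$ appearing in $dX_t=\mathcal{B}\,dt+dW_t$, and drawn at time $0$. This representation is equivalent in law to the equation $dX_t=\sqrt{2\lambda}\tanh(\sqrt{2\lambda}X_t)dt+dW_t$, $X_0=0$; in the formula, $W$ is the Wiener process of the representation. *)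

theory Defs
  imports "HOL-Probability.Probability"
begin

section \<open>Filtered probability spaces and the Wiener process\<close>

text \<open>Only the times \<open>t \<ge> 0\<close> of a filtration indexed by the reals are relevant.  Neither
  completeness nor right-continuity of the filtration is required.\<close>

locale filtered_prob_space = prob_space M + filtration "space M" F
  for M :: "'a measure" and F :: "real \<Rightarrow> 'a measure" +
  assumes subalgebra_F: "0 \<le> t \<Longrightarrow> subalgebra M (F t)"

definition progressive :: "(real \<Rightarrow> 'a measure) \<Rightarrow> real \<Rightarrow> (real \<Rightarrow> 'a \<Rightarrow> real) \<Rightarrow> bool" where
  "progressive F T H \<longleftrightarrow>
     (\<forall>t\<in>{0..T}. (\<lambda>(s, \<omega>). H s \<omega>) \<in> borel_measurable (restrict_space borel {0..t} \<Otimes>\<^sub>M F t))"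

definition wiener_process ::
    "'a measure \<Rightarrow> (real \<Rightarrow> 'a measure) \<Rightarrow> (real \<Rightarrow> 'a \<Rightarrow> real) \<Rightarrow> bool" where
  "wiener_process M F W \<longleftrightarrow>
     (\<forall>t\<ge>0. W t \<in> borel_measurable (F t)) \<and>
     (AE \<omega> in M. W 0 \<omega> = 0) \<and>
     (AE \<omega> in M. continuous_on {0..} (\<lambda>t. W t \<omega>)) \<and>
     (\<forall>s t. 0 \<le> s \<and> s < t \<longrightarrow>
        distributed M lborel (\<lambda>\<omega>. W t \<omega> - W s \<omega>) (\<lambda>x. ennreal (normal_density 0 (sqrt (t - s)) x)) \<and>
        prob_space.indep_set M (sets (F s))
          {(\<lambda>\<omega>. W t \<omega> - W s \<omega>) -` A \<inter> space M | A. A \<in> sets borel})"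


section \<open>Stochastic integral\<close>

text \<open>\<open>D k \<rightarrow> 0\<close> in probability, for nonnegative (extended) random variables \<open>D k\<close>.\<close>

definition null_in_prob :: "'a measure \<Rightarrow> (nat \<Rightarrow> 'a \<Rightarrow> ennreal) \<Rightarrow> bool" where
  "null_in_prob M D \<longleftrightarrow>
     (\<forall>k. D k \<in> borel_measurable M) \<and>
     (\<forall>\<epsilon>>0. (\<lambda>k. measure M {\<omega> \<in> space M. ennreal \<epsilon> < D k \<omega>}) \<longlonglongrightarrow> 0)"

text \<open>A simple integrand is given by \<open>n\<close> intervals \<open>{\<tau> i<..\<tau> (Suc i)}\<close>, on the \<open>i\<close>-th of which it
  has the bounded, \<open>F (\<tau> i)\<close>-measurable value \<open>\<xi> i\<close>.\<close>

definition simple_integrand ::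
    "'a measure \<Rightarrow> (real \<Rightarrow> 'a measure) \<Rightarrow> real \<Rightarrow> nat \<Rightarrow> (nat \<Rightarrow> real) \<Rightarrow> (nat \<Rightarrow> 'a \<Rightarrow> real) \<Rightarrow> bool" where
  "simple_integrand M F T n \<tau> \<xi> \<longleftrightarrow>
     (\<forall>i<n. 0 \<le> \<tau> i \<and> \<tau> i \<le> \<tau> (Suc i) \<and> \<tau> (Suc i) \<le> T \<and>
            \<xi> i \<in> borel_measurable (F (\<tau> i)) \<and> (\<exists>C. \<forall>\<omega>\<in>space M. \<bar>\<xi> i \<omega>\<bar> \<le> C))"

definition simple_process ::
    "nat \<Rightarrow> (nat \<Rightarrow> real) \<Rightarrow> (nat \<Rightarrow> 'a \<Rightarrow> real) \<Rightarrow> real \<Rightarrow> 'a \<Rightarrow> real" where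
  "simple_process n \<tau> \<xi> s \<omega> = (\<Sum>i<n. \<xi> i \<omega> * indicator {\<tau> i<..\<tau> (Suc i)} s)"

definition simple_integral ::
    "(real \<Rightarrow> 'a \<Rightarrow> real) \<Rightarrow> nat \<Rightarrow> (nat \<Rightarrow> real) \<Rightarrow> (nat \<Rightarrow> 'a \<Rightarrow> real) \<Rightarrow> real \<Rightarrow> 'a \<Rightarrow> real" where
  "simple_integral X n \<tau> \<xi> t \<omega> =
     (\<Sum>i<n. \<xi> i \<omega> * (X (min (\<tau> (Suc i)) t) \<omega> - X (min (\<tau> i) t) \<omega>))"

text \<open>\<open>stoch_integral M F T X H I\<close>: the process \<open>I\<close> is (a continuous version of)
  \<open>\<integral>\<^sub>0\<^sup>t H dX\<close>, \<open>0 \<le> t \<le> T\<close>.  The definition is meant for integrators \<open>X\<close> with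
  \<open>dX = b dt + dW\<close>, where \<open>W\<close> is a Wiener process and \<open>\<integral>\<^sub>0\<^sup>T b\<^sup>2 dt < \<infinity>\<close> almost surely; for these,
  \<open>L\<^sup>2(dt)\<close>-convergence in probability of the integrands implies convergence in probability of the
  integrals, so the limit \<open>I\<close> does not depend (up to indistinguishability) on the approximating
  sequence.  For \<open>X = W\<close> it is the Ito integral.  Since the filtration need not be complete, \<open>I t\<close>
  is only required to be measurable with respect to \<open>M\<close>; being an almost sure limit along a
  subsequence of the simple integrals, it is adapted to the completed filtration.\<close>

definition stoch_integral ::
    "'a measure \<Rightarrow> (real \<Rightarrow> 'a measure) \<Rightarrow> real \<Rightarrow> (real \<Rightarrow> 'a \<Rightarrow> real) \<Rightarrow>
     (real \<Rightarrow> 'a \<Rightarrow> real) \<Rightarrow> (real \<Rightarrow> 'a \<Rightarrow> real) \<Rightarrow> bool" where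
  "stoch_integral M F T X H I \<longleftrightarrow>
     progressive F T H \<and>
     (\<forall>t\<in>{0..T}. I t \<in> borel_measurable M) \<and>
     (AE \<omega> in M. continuous_on {0..T} (\<lambda>t. I t \<omega>)) \<and>
     (\<exists>n \<tau> \<xi>.
        (\<forall>k. simple_integrand M F T (n k) (\<tau> k) (\<xi> k)) \<and>
        null_in_prob M (\<lambda>k \<omega>. \<integral>\<^sup>+s\<in>{0..T}.
          ennreal ((simple_process (n k) (\<tau> k) (\<xi> k) s \<omega> - H s \<omega>)\<^sup>2) \<partial>lborel) \<and>
        (\<forall>t\<in>{0..T}. null_in_prob M (\<lambda>k \<omega>.
          ennreal \<bar>simple_integral X (n k) (\<tau> k) (\<xi> k) t \<omega> - I t \<omega>\<bar>)))"

text \<open>\<open>stoch_differential M F T X Y a H\<close>: \<open>dY\<^sub>t = a\<^sub>t dt + H\<^sub>t dX\<^sub>t\<close> on \<open>[0,T]\<close>.\<close>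

definition stoch_differential ::
    "'a measure \<Rightarrow> (real \<Rightarrow> 'a measure) \<Rightarrow> real \<Rightarrow> (real \<Rightarrow> 'a \<Rightarrow> real) \<Rightarrow>
     (real \<Rightarrow> 'a \<Rightarrow> real) \<Rightarrow> (real \<Rightarrow> 'a \<Rightarrow> real) \<Rightarrow> (real \<Rightarrow> 'a \<Rightarrow> real) \<Rightarrow> bool" where
  "stoch_differential M F T X Y a H \<longleftrightarrow>
     progressive F T a \<and>
     (\<exists>I. stoch_integral M F T X H I \<and>
       (AE \<omega> in M. set_integrable lborel {0..T} (\<lambda>s. a s \<omega>) \<and>
         (\<forall>t\<in>{0..T}. Y t \<omega> = Y 0 \<omega> + (LINT s:{0..t}|lborel. a s \<omega>) + I t \<omega>)))"


section \<open>The system\<close>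

definition standard_coefficients ::
    "real \<Rightarrow> (real \<Rightarrow> real \<Rightarrow> real) \<Rightarrow> (real \<Rightarrow> real \<Rightarrow> real) \<Rightarrow> bool" where
  "standard_coefficients T \<mu> \<sigma> \<longleftrightarrow>
     (\<lambda>(z, t). \<mu> z t) \<in> borel_measurable (restrict_space borel (UNIV \<times> {0..T})) \<and>
     (\<lambda>(z, t). \<sigma> z t) \<in> borel_measurable (restrict_space borel (UNIV \<times> {0..T})) \<and>
     (\<exists>K. \<forall>z. \<forall>t\<in>{0..T}. \<bar>\<mu> z t\<bar> \<le> K \<and> \<bar>\<sigma> z t\<bar> \<le> K) \<and>
     (\<exists>C. \<forall>z. \<forall>t\<in>{0..T}. \<bar>\<mu> z t\<bar> + \<bar>\<sigma> z t\<bar> \<le> C * (1 + \<bar>z\<bar>)) \<and>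
     (\<exists>D. \<forall>z z'. \<forall>t\<in>{0..T}. \<bar>\<mu> z t - \<mu> z' t\<bar> + \<bar>\<sigma> z t - \<sigma> z' t\<bar> \<le> D * \<bar>z - z'\<bar>)"

definition solves_sde ::
    "'a measure \<Rightarrow> (real \<Rightarrow> 'a measure) \<Rightarrow> real \<Rightarrow> (real \<Rightarrow> 'a \<Rightarrow> real) \<Rightarrow>
     (real \<Rightarrow> real \<Rightarrow> real) \<Rightarrow> (real \<Rightarrow> real \<Rightarrow> real) \<Rightarrow> real \<Rightarrow> (real \<Rightarrow> 'a \<Rightarrow> real) \<Rightarrow> bool" where
  "solves_sde M F T X \<mu> \<sigma> z0 Z \<longleftrightarrow>
     progressive F T Z \<and>
     (AE \<omega> in M. continuous_on {0..T} (\<lambda>t. Z t \<omega>)) \<and>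
     (AE \<omega> in M. Z 0 \<omega> = z0) \<and>
     stoch_differential M F T X Z (\<lambda>t \<omega>. \<mu> (Z t \<omega>) t) (\<lambda>t \<omega>. \<sigma> (Z t \<omega>) t)"

text \<open>The random drift: drawn at time 0, independent of the whole path of \<open>W\<close>, and with values
  \<open>\<plusminus>sqrt (2 * lam)\<close> of probability \<open>1/2\<close> each.\<close>

definition bernoulli_drift ::
    "'a measure \<Rightarrow> (real \<Rightarrow> 'a measure) \<Rightarrow> (real \<Rightarrow> 'a \<Rightarrow> real) \<Rightarrow> real \<Rightarrow> ('a \<Rightarrow> real) \<Rightarrow> bool" where
  "bernoulli_drift M F W lam B \<longleftrightarrow>
     B \<in> borel_measurable (F 0) \<and>
     measure M {\<omega> \<in> space M. B \<omega> = sqrt (2 * lam)} = 1 / 2 \<and>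
     measure M {\<omega> \<in> space M. B \<omega> = - sqrt (2 * lam)} = 1 / 2 \<and>
     prob_space.indep_set M
       (sets (vimage_algebra (space M) B borel))
       (sets (vimage_algebra (space M) (\<lambda>\<omega>. \<lambda>t\<in>{0..}. W t \<omega>) (Pi\<^sub>M {0..} (\<lambda>_. borel))))"

text \<open>The noise \<open>dX\<^sub>t = B dt + dW\<^sub>t\<close>, \<open>X\<^sub>0 = 0\<close>.  With \<open>B\<close> as above it has the law of the solution of
  \<open>dX\<^sub>t = sqrt (2 lam) tanh (sqrt (2 lam) X\<^sub>t) dt + dV\<^sub>t\<close>, \<open>X\<^sub>0 = 0\<close>, for a Wiener process \<open>V\<close> (different
  from \<open>W\<close>).\<close>

definition bernoulli_noise ::
    "('a \<Rightarrow> real) \<Rightarrow> (real \<Rightarrow> 'a \<Rightarrow> real) \<Rightarrow> real \<Rightarrow> 'a \<Rightarrow> real" where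
  "bernoulli_noise B W t \<omega> = B \<omega> * t + W t \<omega>"

text \<open>\<open>g\<close> is of class \<open>C\<^sup>2\<^sup>,\<^sup>1\<close> on \<open>\<real> \<times> [0,T]\<close> with \<open>\<partial>g/\<partial>t = gt\<close>, \<open>\<partial>g/\<partial>z = gz\<close>, \<open>\<partial>\<^sup>2g/\<partial>z\<^sup>2 = gzz\<close>;
  the time derivatives at \<open>0\<close> and \<open>T\<close> are one-sided.\<close>

definition class_C21 ::
    "real \<Rightarrow> (real \<Rightarrow> real \<Rightarrow> real) \<Rightarrow> (real \<Rightarrow> real \<Rightarrow> real) \<Rightarrow> (real \<Rightarrow> real \<Rightarrow> real) \<Rightarrow>
     (real \<Rightarrow> real \<Rightarrow> real) \<Rightarrow> bool" where
  "class_C21 T g gt gz gzz \<longleftrightarrow>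
     (\<forall>z. \<forall>t\<in>{0..T}.
        ((\<lambda>s. g z s) has_real_derivative gt z t) (at t within {0..T}) \<and>
        ((\<lambda>x. g x t) has_real_derivative gz z t) (at z) \<and>
        ((\<lambda>x. gz x t) has_real_derivative gzz z t) (at z)) \<and>
     continuous_on (UNIV \<times> {0..T}) (\<lambda>(z, t). g z t) \<and>
     continuous_on (UNIV \<times> {0..T}) (\<lambda>(z, t). gt z t) \<and>
     continuous_on (UNIV \<times> {0..T}) (\<lambda>(z, t). gz z t) \<and>
     continuous_on (UNIV \<times> {0..T}) (\<lambda>(z, t). gzz z t)"

end

theory Submission
  imports Defs
begin

text \<open>The formula itself determines its stochastic integral: with \<open>a\<close> the coefficient of \<open>dt\<close>, it has to be
  \<open>Y t = g (Z t) t - g (Z 0) 0 - \<integral>\<^sub>0\<^sup>t a ds\<close>.  This process is continuous, so what has to be found is a sequence of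
  simple integrands that tends to \<open>\<sigma> * gz\<close> in \<open>L\<^sup>2(dt)\<close>, in probability, and whose integrals with respect to \<open>W\<close>
  tend to \<open>Y t\<close> in probability for every \<open>t\<close>.

  The random drift is removed first.  Since \<open>B\<close> is known at time 0 and bounded almost surely,
  \<open>\<integral> \<sigma> dX = \<integral> \<sigma> * B dt + \<integral> \<sigma> dW\<close> (\<open>stoch_integral_drift_removal\<close>), so \<open>Z\<close> is an Ito process with bounded drift
  \<open>b = \<mu> + \<sigma> * B\<close> and bounded diffusion coefficient \<open>S = \<sigma>\<close>.

  The coefficient \<open>S\<close> is then replaced by a simple process with values \<open>v\<close> on an arbitrarily fine grid, such
  that the integrals with respect to \<open>W\<close> are close to the martingale part of \<open>Z\<close> uniformly in \<open>t\<close>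
  (\<open>bounded_integrand_approximation\<close>, a consequence of the Ito isometry and of clipping).  Let \<open>A\<close> be the
  process with drift \<open>b\<close> and diffusion coefficient \<open>v\<close>.  Over a grid interval it moves by a small drift part
  plus \<open>v\<close> times a Wiener increment, and a second-order Taylor expansion of \<open>g\<close> along the grid yields three sums:
  a simple integral with coefficients \<open>gz * v\<close>; a Riemann sum, which tends to the integral of the drift
  because \<open>A\<close> is close to \<open>Z\<close>; and a weighted sum of the squared Wiener increments minus the interval lengths,
  which is small because its terms are orthogonal (\<open>orthogonal_sum\<close>).  All errors are estimated in expectation
  with the second and fourth moments of the Wiener increments (\<open>tame_ito_approximation\<close>).

  These estimates presuppose that \<open>g\<close> and its derivatives are bounded and uniformly continuous.  In general
  \<open>g\<close> is composed with a \<open>C\<^sup>2\<close> cutoff in the space variable, which changes nothing as long as the path of \<open>Z\<close> stays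
  in \<open>{- R..R}\<close>; since the paths are continuous, the probability of this event tends to 1 as \<open>R\<close> grows
  (\<open>ito_formula\<close>).\<close>

section \<open>The truncated square\<close>

text \<open>Random variables tend to 0 in probability if and only if the expectations of their truncated squares
  tend to 0.  The truncated square is below the square, which the Ito isometry controls, and below the
  absolute value, which the pathwise estimates control.\<close>
definition tsq :: "real \<Rightarrow> real" where
  "tsq x = min 1 (x\<^sup>2)"

lemma tsq_nonneg [simp]: "0 \<le> tsq x"
  and tsq_le_1 [simp]: "tsq x \<le> 1"
  and tsq_le_square: "tsq x \<le> x\<^sup>2"
  and tsq_zero [simp]: "tsq 0 = 0"
  and tsq_minus [simp]: "tsq (- x) = tsq x"
  by (auto simp: tsq_def)

lemma tsq_le_abs: "tsq x \<le> \<bar>x\<bar>"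
proof (cases "\<bar>x\<bar> \<le> 1")
  case True
  then have "\<bar>x\<bar> * \<bar>x\<bar> \<le> \<bar>x\<bar> * 1" by (intro mult_left_mono) auto
  then show ?thesis by (simp add: tsq_def power2_eq_square flip: abs_mult)
qed (auto simp: tsq_def)

lemma tsq_add: "tsq (x + y) \<le> 2 * tsq x + 2 * tsq y"
proof (cases "x\<^sup>2 \<ge> 1 \<or> y\<^sup>2 \<ge> 1")
  case True
  have "tsq (x + y) \<le> 1" "0 \<le> tsq x" "0 \<le> tsq y" by simp_all
  moreover have "1 \<le> tsq x \<or> 1 \<le> tsq y" using True by (auto simp: tsq_def)
  ultimately show ?thesis by linarith
next
  case False
  have "tsq (x + y) \<le> (x + y)\<^sup>2" by (rule tsq_le_square)
  also have "\<dots> \<le> 2 * x\<^sup>2 + 2 * y\<^sup>2"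
    using sum_squares_bound[of x y] by (simp add: power2_sum)
  finally show ?thesis using False by (simp add: tsq_def)
qed

lemma tsq_mono: "\<bar>x\<bar> \<le> \<bar>y\<bar> \<Longrightarrow> tsq x \<le> tsq y"
  using abs_le_square_iff[of x y] by (auto simp: tsq_def)

lemma borel_measurable_tsq [measurable]: "tsq \<in> borel_measurable borel"
  unfolding tsq_def[abs_def] by measurable

section \<open>Bounded uniformly continuous functions and a smooth cutoff\<close>

text \<open>For a bounded function, uniform continuity in the form given here is equivalent to the usual one.
  It turns expected differences of values of \<open>f\<close> into expected truncated squares of differences of the
  arguments.\<close>
definition tame :: "real \<Rightarrow> (real \<Rightarrow> real \<Rightarrow> real) \<Rightarrow> bool" where
  "tame T f \<longleftrightarrow> continuous_on (UNIV \<times> {0..T}) (\<lambda>(z, t). f z t) \<and>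
     (\<exists>G. \<forall>z. \<forall>s\<in>{0..T}. \<bar>f z s\<bar> \<le> G) \<and>
     (\<forall>\<epsilon>>0. \<exists>C\<ge>0. \<forall>z z'. \<forall>s\<in>{0..T}. \<forall>s'\<in>{0..T}.
        \<bar>f z s - f z' s'\<bar> \<le> \<epsilon> + C * (tsq (z - z') + \<bar>s - s'\<bar>))"

lemma DERIV_glue:
  fixes f p q :: "real \<Rightarrow> real"
  assumes p: "(p has_real_derivative D) (at a)" and q: "(q has_real_derivative D) (at a)"
    and l: "\<forall>\<^sub>F x in at_left a. f x = p x" and r: "\<forall>\<^sub>F x in at_right a. f x = q x"
    and a: "f a = p a" "f a = q a"
  shows "(f has_real_derivative D) (at a)"
proof -
  have "((\<lambda>y. (p y - p a) / (y - a)) \<longlongrightarrow> D) (at_left a)"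
    using p by (simp add: has_field_derivative_iff filterlim_at_split)
  then have 1: "((\<lambda>y. (f y - f a) / (y - a)) \<longlongrightarrow> D) (at_left a)"
    by (rule Lim_transform_eventually) (use l in eventually_elim, simp add: a(1))
  have "((\<lambda>y. (q y - q a) / (y - a)) \<longlongrightarrow> D) (at_right a)"
    using q by (simp add: has_field_derivative_iff filterlim_at_split)
  then have "((\<lambda>y. (f y - f a) / (y - a)) \<longlongrightarrow> D) (at_right a)"
    by (rule Lim_transform_eventually) (use r in eventually_elim, simp add: a(2))
  with 1 show ?thesis by (simp add: has_field_derivative_iff filterlim_at_split)
qed

definition clamp_to :: "real \<Rightarrow> real \<Rightarrow> real" where
  "clamp_to R z = max (- R) (min R z)"

lemma abs_clamp_to: "0 \<le> R \<Longrightarrow> \<bar>clamp_to R z\<bar> \<le> R"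
  and clamp_to_ident: "\<bar>z\<bar> \<le> R \<Longrightarrow> clamp_to R z = z"
  and clamp_to_zero [simp]: "0 \<le> R \<Longrightarrow> clamp_to R 0 = 0"
  unfolding clamp_to_def by linarith+

lemma borel_measurable_clamp_to [measurable]: "clamp_to R \<in> borel_measurable borel"
  unfolding clamp_to_def[abs_def] by measurable

text \<open>The identity on \<open>{- R..R}\<close>, continued by the arctangent, which agrees with the identity to second
  order at 0.  The result is of class \<open>C\<^sup>2\<close> with bounded range and slope at most 1.\<close>
definition cutoff :: "real \<Rightarrow> real \<Rightarrow> real" where
  "cutoff R z = clamp_to R z + arctan (z - clamp_to R z)"

text \<open>The two derivatives of the cutoff at \<open>z\<close> can be written in terms of \<open>y = cutoff R z\<close>, namely through the
  angle \<open>excess R y\<close>.  Hence all derivatives of \<open>g (cutoff R z) t\<close> have the form \<open>f (cutoff R z) t\<close> with a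
  continuous \<open>f\<close>, to which \<open>tame_comp_cutoff\<close> applies.\<close>
definition excess :: "real \<Rightarrow> real \<Rightarrow> real" where
  "excess R y = y - clamp_to R y"

lemma clamp_to_piece:
  assumes "0 < R"
  shows "R < z \<Longrightarrow> clamp_to R z = R" "z < - R \<Longrightarrow> clamp_to R z = - R"
  using assms by (auto simp: clamp_to_def)

lemma excess_cutoff:
  assumes "0 < R"
  shows "excess R (cutoff R z) = arctan (z - clamp_to R z)"
proof -
  consider "z < - R" | "\<bar>z\<bar> \<le> R" | "R < z" by linarith
  then show ?thesis
  proof cases
    case 1
    then have "arctan (z + R) < 0" by simp
    then have "clamp_to R (arctan (z + R) - R) = - R" using assms by (intro clamp_to_piece) auto
    with 1 assms show ?thesis by (simp add: excess_def cutoff_def clamp_to_piece)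
  next
    case 2
    then show ?thesis by (simp add: excess_def cutoff_def clamp_to_ident)
  next
    case 3
    then have "arctan (z - R) > 0" by simp
    then have "clamp_to R (R + arctan (z - R)) = R" using assms by (intro clamp_to_piece) auto
    with 3 assms show ?thesis by (simp add: excess_def cutoff_def clamp_to_piece)
  qed
qed

lemma cutoff_ident: "\<bar>z\<bar> \<le> R \<Longrightarrow> cutoff R z = z"
  by (simp add: cutoff_def clamp_to_ident)

lemma excess_ident: "\<bar>z\<bar> \<le> R \<Longrightarrow> excess R z = 0"
  by (simp add: excess_def clamp_to_ident)

lemma abs_cutoff: "0 \<le> R \<Longrightarrow> \<bar>cutoff R z\<bar> \<le> R + 2"
proof -
  assume "0 \<le> R"
  have "\<bar>arctan x\<bar> \<le> 2" for x
    using arctan_lbound[of x] arctan_ubound[of x] pi_less_4 by (auto simp: abs_if)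
  then show ?thesis
    using abs_clamp_to[OF \<open>0 \<le> R\<close>, of z] unfolding cutoff_def
    by (smt (verit))
qed

text \<open>The branches are indexed by -1, 0 and 1 from left to right, and are glued at \<open>- R\<close> and \<open>R\<close>.\<close>
lemma DERIV_by_pieces:
  fixes f :: "real \<Rightarrow> real" and p :: "real \<Rightarrow> real \<Rightarrow> real"
  assumes R: "0 < R"
    and m: "\<And>x. \<bar>x\<bar> \<le> R \<Longrightarrow> f x = p 0 x"
    and u: "\<And>x. R \<le> x \<Longrightarrow> f x = p 1 x"
    and l: "\<And>x. x \<le> - R \<Longrightarrow> f x = p (- 1) x"
    and D: "\<And>x. \<bar>x\<bar> \<le> R \<Longrightarrow> (p 0 has_real_derivative D x) (at x)"
      "\<And>x. R \<le> x \<Longrightarrow> (p 1 has_real_derivative D x) (at x)"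
      "\<And>x. x \<le> - R \<Longrightarrow> (p (-1) has_real_derivative D x) (at x)"
  shows "(f has_real_derivative D x) (at x)"
proof -
  have L: "\<forall>\<^sub>F y in at_left x. f y = p i y" if "c < x" "\<And>y. c < y \<Longrightarrow> y < x \<Longrightarrow> f y = p i y" for c i
    using that unfolding eventually_at_left_field by auto
  have U: "\<forall>\<^sub>F y in at_right x. f y = p i y" if "x < c" "\<And>y. x < y \<Longrightarrow> y < c \<Longrightarrow> f y = p i y" for c i
    using that unfolding eventually_at_right_field by auto
  consider "x < - R" | "x = - R" | "- R < x" "x < R" | "x = R" | "R < x" by linarith
  then show ?thesis
  proof cases
    case 1
    show ?thesis
      by (rule DERIV_glue[OF D(3) D(3) L[of "x - 1"] U[of "- R"]]) (use 1 l in simp_all)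
  next
    case 2
    show ?thesis
      by (rule DERIV_glue[OF D(3) D(1) L[of "x - 1"] U[of R]]) (use 2 R l m l[of x] m[of x] in simp_all)
  next
    case 3
    show ?thesis
      by (rule DERIV_glue[OF D(1) D(1) L[of "- R"] U[of R]]) (use 3 m in simp_all)
  next
    case 4
    show ?thesis
      by (rule DERIV_glue[OF D(1) D(2) L[of "- R"] U[of "x + 1"]]) (use 4 R m u m[of x] u[of x] in simp_all)
  next
    case 5
    show ?thesis
      by (rule DERIV_glue[OF D(2) D(2) L[of R] U[of "x + 1"]]) (use 5 u in simp_all)
  qed
qed

lemma cos_sin_arctan_formulas:
  fixes x :: real
  shows "(cos (arctan x))\<^sup>2 = inverse (1 + x\<^sup>2)"
    and "- 2 * sin (arctan x) * (cos (arctan x))^3 = - (2 * x) / (1 + x\<^sup>2)\<^sup>2"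
proof -
  have p: "1 + x\<^sup>2 > 0" by (simp add: add_pos_nonneg)
  show "(cos (arctan x))\<^sup>2 = inverse (1 + x\<^sup>2)"
    using p by (simp add: cos_arctan power_divide field_simps)
  have "sin (arctan x) = x * cos (arctan x)"
    by (simp add: cos_arctan sin_arctan)
  then have "- 2 * sin (arctan x) * (cos (arctan x))^3 = - (2 * x) * ((cos (arctan x))\<^sup>2)\<^sup>2"
    by (simp add: power2_eq_square power3_eq_cube)
  also have "(cos (arctan x))\<^sup>2 = inverse (1 + x\<^sup>2)"
    using p by (simp add: cos_arctan power_divide field_simps)
  finally show "- 2 * sin (arctan x) * (cos (arctan x))^3 = - (2 * x) / (1 + x\<^sup>2)\<^sup>2"
    by (simp add: power_inverse divide_inverse)
qed

lemma DERIV_cutoff: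
  assumes R: "0 < R"
  shows "(cutoff R has_real_derivative (cos (excess R (cutoff R z)))\<^sup>2) (at z)"
proof -
  let ?p = "\<lambda>i x. if i = (0::real) then x else i * R + arctan (x - i * R)"
  let ?D = "\<lambda>x. inverse (1 + (x - clamp_to R x)\<^sup>2)"
  have "(cutoff R has_real_derivative ?D z) (at z)"
  proof (rule DERIV_by_pieces[OF R, of _ ?p])
    fix x assume "\<bar>x\<bar> \<le> R"
    then show "(?p 0 has_real_derivative ?D x) (at x)" by (simp add: clamp_to_ident)
  next
    fix x assume "R \<le> x"
    with R have "clamp_to R x = R" by (auto simp: clamp_to_def)
    then show "(?p 1 has_real_derivative ?D x) (at x)" by (auto intro!: derivative_eq_intros)
  next
    fix x assume "x \<le> - R"
    with R have "clamp_to R x = - R" by (auto simp: clamp_to_def)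
    then show "(?p (-1) has_real_derivative ?D x) (at x)" by (auto intro!: derivative_eq_intros)
  qed (use R in \<open>auto simp: cutoff_def clamp_to_def\<close>)
  then show ?thesis by (simp add: excess_cutoff[OF R] cos_sin_arctan_formulas)
qed

lemma DERIV_DERIV_cutoff:
  assumes R: "0 < R"
  shows "((\<lambda>z. (cos (excess R (cutoff R z)))\<^sup>2) has_real_derivative
     - 2 * sin (excess R (cutoff R z)) * (cos (excess R (cutoff R z)))^3) (at z)"
proof -
  let ?p = "\<lambda>i x. if i = (0::real) then 1 else inverse (1 + (x - i * R)\<^sup>2)"
  let ?D = "\<lambda>x. - (2 * (x - clamp_to R x)) / (1 + (x - clamp_to R x)\<^sup>2)\<^sup>2"
  have nz: "1 + (x - y)\<^sup>2 \<noteq> 0" for x y :: real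
    by (metis add_pos_nonneg less_irrefl zero_le_power2 zero_less_one)
  have "((\<lambda>z. inverse (1 + (z - clamp_to R z)\<^sup>2)) has_real_derivative ?D z) (at z)"
  proof (rule DERIV_by_pieces[OF R, of _ ?p])
    fix x assume "\<bar>x\<bar> \<le> R"
    then show "(?p 0 has_real_derivative ?D x) (at x)" by (simp add: clamp_to_ident)
  next
    fix x assume "R \<le> x"
    with R have "clamp_to R x = R" by (auto simp: clamp_to_def)
    then show "(?p 1 has_real_derivative ?D x) (at x)"
      using nz[of x R] by (auto intro!: derivative_eq_intros simp: power2_eq_square field_simps)
  next
    fix x assume "x \<le> - R"
    with R have "clamp_to R x = - R" by (auto simp: clamp_to_def)
    then show "(?p (-1) has_real_derivative ?D x) (at x)"
      using nz[of x "- R"] by (auto intro!: derivative_eq_intros simp: power2_eq_square field_simps)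
  qed (use R in \<open>auto simp: clamp_to_def\<close>)
  then show ?thesis
    by (simp only: excess_cutoff[OF R] cos_sin_arctan_formulas)
qed

lemma cutoff_Lipschitz:
  assumes R: "0 < R"
  shows "\<bar>cutoff R x - cutoff R y\<bar> \<le> \<bar>x - y\<bar>"
proof -
  have "norm (cutoff R x - cutoff R y) \<le> 1 * norm (x - y)"
  proof (rule field_differentiable_bound[where S = UNIV])
    show "(cutoff R has_real_derivative (cos (excess R (cutoff R z)))\<^sup>2) (at z within UNIV)" for z
      using DERIV_cutoff[OF R] by simp
    show "norm ((cos (excess R (cutoff R z)))\<^sup>2) \<le> 1" for z
      by (simp add: abs_square_le_1)
  qed auto
  then show ?thesis by simp
qed

lemma continuous_excess: "continuous_on A (excess R)"
  unfolding excess_def[abs_def] clamp_to_def[abs_def] by (intro continuous_intros)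

lemma continuous_cutoff: "continuous_on A (cutoff R)"
  unfolding cutoff_def[abs_def] clamp_to_def[abs_def] by (intro continuous_intros)

text \<open>Only the values of \<open>f\<close> on a compact set matter, because the cutoff has bounded range; on that set \<open>f\<close> is
  bounded and uniformly continuous.\<close>
lemma tame_comp_cutoff:
  assumes R: "0 < R" and f: "continuous_on (UNIV \<times> {0..T}) (\<lambda>(z, t). f z t)"
  shows "tame T (\<lambda>z t. f (cutoff R z) t)"
proof -
  let ?K = "{- (R + 2)..R + 2} \<times> {0..T}"
  have K: "compact ?K" by (intro compact_Times compact_Icc)
  have fK: "continuous_on ?K (\<lambda>(z, t). f z t)"
    by (rule continuous_on_subset[OF f]) auto
  have inK: "(cutoff R z, s) \<in> ?K" if "s \<in> {0..T}" for z s
    using abs_cutoff[of R z] R that by (auto simp: abs_le_iff)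
  obtain G where G: "\<And>x. x \<in> ?K \<Longrightarrow> \<bar>(\<lambda>(z, t). f z t) x\<bar> \<le> G"
    using compact_imp_bounded[OF compact_continuous_image[OF fK K]]
    unfolding bounded_iff by (auto simp: image_iff)
  have Gb: "\<bar>f (cutoff R z) s\<bar> \<le> G" if "s \<in> {0..T}" for z s
    using G[OF inK[OF that, of z]] by simp
  have "continuous_on (UNIV \<times> {0..T}) (\<lambda>x. (\<lambda>(z, t). f z t) (cutoff R (fst x), snd x))"
    by (rule continuous_on_compose2[OF f])
      (auto intro!: continuous_intros continuous_on_compose2[OF continuous_cutoff[of UNIV]])
  then have 1: "continuous_on (UNIV \<times> {0..T}) (\<lambda>(z, t). f (cutoff R z) t)"
    by (simp add: case_prod_unfold)
  have 2: "\<exists>C\<ge>0. \<forall>z z'. \<forall>s\<in>{0..T}. \<forall>s'\<in>{0..T}.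
        \<bar>f (cutoff R z) s - f (cutoff R z') s'\<bar> \<le> \<epsilon> + C * (tsq (z - z') + \<bar>s - s'\<bar>)" if "0 < \<epsilon>" for \<epsilon>
  proof -
    have "uniformly_continuous_on ?K (\<lambda>(z, t). f z t)"
      by (rule compact_uniformly_continuous[OF fK K])
    then obtain d where d: "d > 0" and
      dd: "\<And>x x'. x \<in> ?K \<Longrightarrow> x' \<in> ?K \<Longrightarrow> dist x' x < d \<Longrightarrow>
         dist ((\<lambda>(z, t). f z t) x') ((\<lambda>(z, t). f z t) x) < \<epsilon>"
      using \<open>0 < \<epsilon>\<close> unfolding uniformly_continuous_on_def by metis
    \<comment> \<open>Arguments that are too far apart for uniform continuity contribute at least \<open>m\<close> to the distance term,
      and \<open>C * m\<close> is twice the bound of \<open>f\<close>.\<close>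
    define m where "m = min 1 (min (d / 2) ((d / 2)\<^sup>2))"
    have m: "0 < m" using d by (auto simp: m_def)
    define C where "C = 2 * \<bar>G\<bar> / m"
    have C: "0 \<le> C" using m by (simp add: C_def)
    show ?thesis
    proof (intro exI[of _ C] conjI C allI ballI)
      fix z z' s s' assume s: "s \<in> {0..T}" "s' \<in> {0..T}"
      have nn: "0 \<le> C * (tsq (z - z') + \<bar>s - s'\<bar>)" using C by simp
      show "\<bar>f (cutoff R z) s - f (cutoff R z') s'\<bar> \<le> \<epsilon> + C * (tsq (z - z') + \<bar>s - s'\<bar>)"
      proof (cases "\<bar>z - z'\<bar> < d / 2 \<and> \<bar>s - s'\<bar> < d / 2")
        case True
        have "dist (cutoff R z, s) (cutoff R z', s') \<le> \<bar>cutoff R z - cutoff R z'\<bar> + \<bar>s - s'\<bar>"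
          unfolding dist_Pair_Pair dist_real_def using sqrt_sum_squares_le_sum_abs by fastforce
        also have "\<dots> < d" using cutoff_Lipschitz[OF R, of z z'] True by linarith
        finally have "dist (f (cutoff R z) s) (f (cutoff R z') s') < \<epsilon>"
          using dd[OF inK[OF s(2), of z'] inK[OF s(1), of z]] by simp
        then show ?thesis using nn by (simp add: dist_real_def)
      next
        case False
        have "m \<le> tsq (z - z') + \<bar>s - s'\<bar>"
        proof (cases "\<bar>s - s'\<bar> < d / 2")
          case True
          with False have "d / 2 \<le> \<bar>z - z'\<bar>" by simp
          then have "(d / 2)\<^sup>2 \<le> (z - z')\<^sup>2"
            using d abs_le_square_iff[of "d / 2" "z - z'"] by simp
          then show ?thesis by (auto simp: m_def tsq_def)
        next
          case False
          have "0 \<le> tsq (z - z')" by simp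
          then show ?thesis using False unfolding m_def by linarith
        qed
        then have "2 * \<bar>G\<bar> \<le> C * (tsq (z - z') + \<bar>s - s'\<bar>)"
          using m mult_left_mono[of m "tsq (z - z') + \<bar>s - s'\<bar>" "2 * \<bar>G\<bar> / m"] unfolding C_def by simp
        then show ?thesis using Gb[OF s(1), of z] Gb[OF s(2), of z'] \<open>0 < \<epsilon>\<close>
          by linarith
      qed
    qed
  qed
  show ?thesis unfolding tame_def using 1 2 Gb by blast
qed

text \<open>Localisation in space: composing with the cutoff leaves \<open>g\<close> unchanged on \<open>{- R..R}\<close> and makes it and its
  derivatives bounded and uniformly continuous.\<close>
lemma class_C21_comp_cutoff:
  assumes R: "0 < R" and g: "class_C21 T g gt gz gzz"
  shows "\<exists>g' gt' gz' gzz'. class_C21 T g' gt' gz' gzz' \<and>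
     tame T g' \<and> tame T gt' \<and> tame T gz' \<and> tame T gzz' \<and>
     (\<forall>z s. \<bar>z\<bar> \<le> R \<longrightarrow> g' z s = g z s \<and> gt' z s = gt z s \<and> gz' z s = gz z s \<and> gzz' z s = gzz z s)"
proof -
  let ?e = "excess R"
  define g' where "g' = (\<lambda>z s. g (cutoff R z) s)"
  define gt' where "gt' = (\<lambda>z s. gt (cutoff R z) s)"
  define hz where "hz = (\<lambda>y s. gz y s * (cos (?e y))\<^sup>2)"
  define gz' where "gz' = (\<lambda>z s. hz (cutoff R z) s)"
  define hzz where "hzz = (\<lambda>y s. gzz y s * (cos (?e y))\<^sup>2 * (cos (?e y))\<^sup>2 + gz y s * (- 2 * sin (?e y) * (cos (?e y))^3))"
  define gzz' where "gzz' = (\<lambda>z s. hzz (cutoff R z) s)"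
  note gD = g[unfolded class_C21_def]
  have ce: "continuous_on (UNIV \<times> {0..T}) (\<lambda>x. ?e (fst x))"
    by (intro continuous_on_compose2[OF continuous_excess[of UNIV]] continuous_intros) auto
  have c: "continuous_on (UNIV \<times> {0..T}) (\<lambda>x. gz (fst x) (snd x))"
    "continuous_on (UNIV \<times> {0..T}) (\<lambda>x. gzz (fst x) (snd x))"
    using gD by (simp_all add: case_prod_unfold)
  have chz: "continuous_on (UNIV \<times> {0..T}) (\<lambda>(z, t). hz z t)"
    unfolding hz_def case_prod_unfold by (intro continuous_intros c ce)
  have chzz: "continuous_on (UNIV \<times> {0..T}) (\<lambda>(z, t). hzz z t)"
    unfolding hzz_def case_prod_unfold by (intro continuous_intros c ce)
  have tame: "tame T g'" "tame T gt'" "tame T gz'" "tame T gzz'"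
    unfolding g'_def gt'_def gz'_def gzz'_def
    using gD chz chzz by (auto intro!: tame_comp_cutoff R)
  have "class_C21 T g' gt' gz' gzz'"
    unfolding class_C21_def
  proof (intro conjI allI ballI)
    fix z t assume t: "t \<in> {0..T}"
    show "((\<lambda>s. g' z s) has_real_derivative gt' z t) (at t within {0..T})"
      using gD t by (simp add: g'_def gt'_def)
    have "((\<lambda>x. g x t) has_real_derivative gz (cutoff R z) t) (at (cutoff R z))"
      using gD t by simp
    from DERIV_chain2[OF this DERIV_cutoff[OF R]]
    show "((\<lambda>x. g' x t) has_real_derivative gz' z t) (at z)"
      by (simp add: g'_def gz'_def hz_def)
    have "((\<lambda>x. gz x t) has_real_derivative gzz (cutoff R z) t) (at (cutoff R z))"
      using gD t by simp
    from DERIV_mult'[OF DERIV_chain2[OF this DERIV_cutoff[OF R]] DERIV_DERIV_cutoff[OF R]]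
    show "((\<lambda>x. gz' x t) has_real_derivative gzz' z t) (at z)"
      by (simp add: gz'_def gzz'_def hz_def hzz_def algebra_simps)
  qed (use tame in \<open>auto simp: tame_def\<close>)
  moreover have "\<forall>z s. \<bar>z\<bar> \<le> R \<longrightarrow> g' z s = g z s \<and> gt' z s = gt z s \<and> gz' z s = gz z s \<and> gzz' z s = gzz z s"
    by (simp add: g'_def gt'_def gz'_def gzz'_def hz_def hzz_def cutoff_ident excess_ident)
  ultimately show ?thesis using tame by blast
qed

section \<open>A Taylor step\<close>

text \<open>The increment is split at \<open>(z + h, s)\<close>.  The mean value theorem is used in time and the second-order
  Taylor formula in space; moving \<open>gt\<close> and \<open>gzz\<close> from the intermediate points back to \<open>(z, s)\<close> costs their
  moduli of continuity.\<close>
lemma taylor_step: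
  assumes g: "class_C21 T g gt gz gzz" and e: "0 < \<epsilon>" and C: "0 \<le> C"
    and t: "\<And>z z' s s'. s \<in> {0..T} \<Longrightarrow> s' \<in> {0..T} \<Longrightarrow> \<bar>gt z s - gt z' s'\<bar> \<le> \<epsilon> + C * (tsq (z - z') + \<bar>s - s'\<bar>)"
    and zz: "\<And>z z' s s'. s \<in> {0..T} \<Longrightarrow> s' \<in> {0..T} \<Longrightarrow> \<bar>gzz z s - gzz z' s'\<bar> \<le> \<epsilon> + C * (tsq (z - z') + \<bar>s - s'\<bar>)"
    and s: "0 \<le> s" "0 \<le> d" "s + d \<le> T"
  shows "\<bar>g (z + h) (s + d) - g z s - gt z s * d - gz z s * h - gzz z s * h\<^sup>2 / 2\<bar>
     \<le> (\<epsilon> + C * (h\<^sup>2 + d)) * (d + h\<^sup>2)"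
proof -
  note gD = g[unfolded class_C21_def]
  have sT: "s \<in> {0..T}" "s + d \<in> {0..T}" using s by auto
  have "\<exists>x\<in>{s..s + d}. g (z + h) (s + d) - g (z + h) s = gt (z + h) x * (s + d - s)"
  proof (rule mvt_very_simple)
    fix x assume "s \<le> x" "x \<le> s + d"
    then have "((\<lambda>s. g (z + h) s) has_real_derivative gt (z + h) x) (at x within {s..s + d})"
      using gD s by (intro DERIV_subset[where s = "{0..T}" and t = "{s..s + d}"]) auto
    then show "((\<lambda>s. g (z + h) s) has_derivative (*) (gt (z + h) x)) (at x within {s..s + d})"
      by (simp add: has_field_derivative_def)
  qed (use s in auto)
  then obtain x where x: "x \<in> {s..s + d}" and gx: "g (z + h) (s + d) - g (z + h) s = gt (z + h) x * d" by auto
  have "\<bar>gt (z + h) x - gt z s\<bar> \<le> \<epsilon> + C * (tsq (z + h - z) + \<bar>x - s\<bar>)"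
    using x s by (intro t) auto
  also have "\<dots> \<le> \<epsilon> + C * (h\<^sup>2 + d)"
    using x tsq_le_square[of h] by (intro add_left_mono mult_left_mono C add_mono) auto
  finally have 1: "\<bar>(gt (z + h) x - gt z s) * d\<bar> \<le> (\<epsilon> + C * (h\<^sup>2 + d)) * d"
    using s by (simp add: abs_mult mult_right_mono)
  have 2: "\<bar>g (z + h) s - g z s - gz z s * h - gzz z s * h\<^sup>2 / 2\<bar> \<le> (\<epsilon> + C * (h\<^sup>2 + d)) * h\<^sup>2"
  proof (cases "h = 0")
    case False
    let ?diff = "\<lambda>m::nat. if m = 0 then (\<lambda>x. g x s) else if m = 1 then (\<lambda>x. gz x s) else (\<lambda>x. gzz x s)"
    have "\<exists>y. (if z + h < z then z + h < y \<and> y < z else z < y \<and> y < z + h) \<and>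
        g (z + h) s = (\<Sum>m<2. (?diff m z / fact m) * (z + h - z)^m) + (?diff 2 y / fact 2) * (z + h - z)^2"
      using gD sT False
      by (intro Taylor[of 2 ?diff _ "min z (z + h)" "max z (z + h)"]) (auto simp: less_2_cases_iff)
    then obtain y where y: "(if z + h < z then z + h < y \<and> y < z else z < y \<and> y < z + h)"
      and gy: "g (z + h) s = g z s + gz z s * h + gzz y s / 2 * h\<^sup>2"
      by (auto simp: numeral_2_eq_2)
    from y have yz: "\<bar>y - z\<bar> \<le> \<bar>h\<bar>" by (auto split: if_splits)
    then have yh: "(y - z)\<^sup>2 \<le> h\<^sup>2" by (simp add: abs_le_square_iff)
    have "\<bar>gzz y s - gzz z s\<bar> \<le> \<epsilon> + C * (tsq (y - z) + \<bar>s - s\<bar>)"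
      using sT by (intro zz) auto
    also have "\<dots> \<le> \<epsilon> + C * (h\<^sup>2 + d)"
      using s tsq_le_square[of "y - z"] yh by (intro add_left_mono mult_left_mono C add_mono) auto
    finally have le: "\<bar>gzz y s - gzz z s\<bar> \<le> \<epsilon> + C * (h\<^sup>2 + d)" .
    have "\<bar>gzz y s - gzz z s\<bar> / 2 \<le> \<bar>gzz y s - gzz z s\<bar>" by simp
    from order_trans[OF this le] have "\<bar>gzz y s - gzz z s\<bar> / 2 \<le> \<epsilon> + C * (h\<^sup>2 + d)" .
    then have "\<bar>gzz y s - gzz z s\<bar> / 2 * h\<^sup>2 \<le> (\<epsilon> + C * (h\<^sup>2 + d)) * h\<^sup>2"
      by (intro mult_right_mono) auto
    moreover have "g (z + h) s - g z s - gz z s * h - gzz z s * h\<^sup>2 / 2 = (gzz y s - gzz z s) / 2 * h\<^sup>2"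
      unfolding gy by (simp add: field_simps)
    ultimately show ?thesis by (simp only: abs_mult abs_divide) simp
  qed simp
  have "g (z + h) (s + d) - g z s - gt z s * d - gz z s * h - gzz z s * h\<^sup>2 / 2
     = (gt (z + h) x - gt z s) * d + (g (z + h) s - g z s - gz z s * h - gzz z s * h\<^sup>2 / 2)"
    using gx by (simp add: algebra_simps)
  then show ?thesis using 1 2 by (simp add: algebra_simps)
qed

section \<open>Wiener increments\<close>

lemma Int_stable_preimages: "Int_stable {X -` A \<inter> S | A. A \<in> sets N}"
proof (rule Int_stableI)
  fix a b assume "a \<in> {X -` A \<inter> S | A. A \<in> sets N}" "b \<in> {X -` A \<inter> S | A. A \<in> sets N}"
  then obtain A B where "A \<in> sets N" "B \<in> sets N" "a = X -` A \<inter> S" "b = X -` B \<inter> S" by auto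
  then have "a \<inter> b = X -` (A \<inter> B) \<inter> S" "A \<inter> B \<in> sets N" by auto
  then show "a \<inter> b \<in> {X -` A \<inter> S | A. A \<in> sets N}" by blast
qed

lemma (in filtered_prob_space) measurable_F_mono:
  assumes "f \<in> measurable (F s) N" "s \<le> t"
  shows "f \<in> measurable (F t) N"
  by (rule measurable_from_subalg[OF _ assms(1)])
    (use sets_F_mono[OF assms(2)] in \<open>auto simp: subalgebra_def space_F\<close>)

lemma (in filtered_prob_space) measurable_F_M:
  assumes "f \<in> measurable (F s) N" "0 \<le> s"
  shows "f \<in> measurable M N"
  by (rule measurable_from_subalg[OF subalgebra_F assms(1)]) fact

locale wiener_space = filtered_prob_space M F
  for M :: "'a measure" and F :: "real \<Rightarrow> 'a measure" +
  fixes W :: "real \<Rightarrow> 'a \<Rightarrow> real"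
  assumes wiener: "wiener_process M F W"
begin

lemma W_adapted: "0 \<le> t \<Longrightarrow> W t \<in> borel_measurable (F t)"
  using wiener by (simp add: wiener_process_def)

lemma W_measurable [measurable]: "0 \<le> t \<Longrightarrow> W t \<in> borel_measurable M"
  using W_adapted measurable_F_M by blast

text \<open>An increment after time \<open>s\<close> is independent of every \<open>F s\<close>-measurable factor, so the expectation factorises
  and the normal moment can be inserted.\<close>
lemma increment_power:
  assumes su: "0 \<le> s" "s < u" and U: "U \<in> borel_measurable (F s)" "integrable M U"
    and m: "has_bochner_integral lborel (\<lambda>x. normal_density 0 (sqrt (u - s)) x * x ^ p) m"
  shows "has_bochner_integral M (\<lambda>\<omega>. U \<omega> * (W u \<omega> - W s \<omega>) ^ p) (expectation U * m)"
proof -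
  let ?D = "\<lambda>\<omega>. W u \<omega> - W s \<omega>"
  have [measurable]: "W u \<in> borel_measurable M" "W s \<in> borel_measurable M" using su by auto
  have [measurable]: "U \<in> borel_measurable M" using U by auto
  have dist: "distributed M lborel ?D (\<lambda>x. ennreal (normal_density 0 (sqrt (u - s)) x))"
    and ind: "indep_set (sets (F s)) {?D -` A \<inter> space M | A. A \<in> sets borel}"
    using wiener su by (auto simp: wiener_process_def)
  have Di: "integrable M (\<lambda>\<omega>. ?D \<omega> ^ p)"
    using distributed_integrable[OF dist, of "\<lambda>x. x ^ p"] m by (auto simp: has_bochner_integral_iff)
  have Dm: "expectation (\<lambda>\<omega>. ?D \<omega> ^ p) = m"
    using distributed_integral[OF dist, of "\<lambda>x. x ^ p"] m by (auto simp: has_bochner_integral_iff)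
  have "indep_var borel U borel (\<lambda>\<omega>. ?D \<omega> ^ p)"
    unfolding indep_var_eq
  proof (intro conjI)
    show "indep_set (sigma_sets (space M) {U -` A \<inter> space M |A. A \<in> sets borel})
      (sigma_sets (space M) {(\<lambda>\<omega>. ?D \<omega> ^ p) -` A \<inter> space M |A. A \<in> sets borel})"
    proof (rule indep_set_sigma_sets)
      show "indep_set {U -` A \<inter> space M |A. A \<in> sets borel} {(\<lambda>\<omega>. ?D \<omega> ^ p) -` A \<inter> space M |A. A \<in> sets borel}"
      proof (rule indep_setI)
        show "{U -` A \<inter> space M |A. A \<in> sets borel} \<subseteq> events" by auto
        show "{(\<lambda>\<omega>. ?D \<omega> ^ p) -` A \<inter> space M |A. A \<in> sets borel} \<subseteq> events" by auto
        fix a b assume a: "a \<in> {U -` A \<inter> space M |A. A \<in> sets borel}"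
          and b: "b \<in> {(\<lambda>\<omega>. ?D \<omega> ^ p) -` A \<inter> space M |A. A \<in> sets borel}"
        from a U(1) have a': "a \<in> sets (F s)"
          by (auto simp: space_F[of s, symmetric])
        from b obtain A where A: "A \<in> sets borel" "b = (\<lambda>\<omega>. ?D \<omega> ^ p) -` A \<inter> space M" by auto
        then have "b = ?D -` ((\<lambda>x. x ^ p) -` A) \<inter> space M" by auto
        moreover have "(\<lambda>x::real. x ^ p) -` A \<in> sets borel"
          using measurable_sets[of "\<lambda>x::real. x ^ p" borel borel A] A by auto
        ultimately have "b \<in> {?D -` A \<inter> space M | A. A \<in> sets borel}" by blast
        then show "prob (a \<inter> b) = prob a * prob b" by (rule indep_setD[OF ind a'])
      qed
      show "Int_stable {U -` A \<inter> space M |A. A \<in> sets borel}"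
        by (rule Int_stable_preimages)
      show "Int_stable {(\<lambda>\<omega>. ?D \<omega> ^ p) -` A \<inter> space M |A. A \<in> sets borel}"
        by (rule Int_stable_preimages)
    qed
  qed auto
  from indep_var_integrable[OF this U(2) Di] indep_var_lebesgue_integral[OF this U(2) Di] Dm
  show ?thesis by (auto simp: has_bochner_integral_iff)
qed

text \<open>The case \<open>a = b\<close> is included because increments will be stopped at a time \<open>t\<close>: a partition interval
  beyond \<open>t\<close> degenerates, and its coefficient is then measurable only for a later \<open>\<sigma>\<close>-algebra than \<open>F a\<close>.\<close>
lemma increment_moments:
  assumes ab: "0 \<le> a" "a \<le> b" and U: "a < b \<Longrightarrow> U \<in> borel_measurable (F a)" "integrable M U"
  shows "has_bochner_integral M (\<lambda>\<omega>. U \<omega> * (W b \<omega> - W a \<omega>)) 0"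
    and "has_bochner_integral M (\<lambda>\<omega>. U \<omega> * (W b \<omega> - W a \<omega>)\<^sup>2) (expectation U * (b - a))"
    and "has_bochner_integral M (\<lambda>\<omega>. U \<omega> * (W b \<omega> - W a \<omega>)^4) (expectation U * (3 * (b - a)\<^sup>2))"
proof -
  note nm = normal_moment_odd[of "sqrt (b - a)" 0 0] normal_moment_even[of "sqrt (b - a)" 0 1]
    normal_moment_even[of "sqrt (b - a)" 0 2]
  have e2: "fact (2 * 1) / ((2 / (sqrt (b - a))\<^sup>2) ^ 1 * fact 1) = b - a" if "a < b"
    using that by simp
  have e4: "fact (2 * 2) / ((2 / (sqrt (b - a))\<^sup>2) ^ 2 * fact 2) = 3 * (b - a)\<^sup>2" if "a < b"
  proof -
    have "fact (2 * 2) = (24::real)" by (simp add: fact_numeral)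
    then show ?thesis using that by (simp add: power_divide)
  qed
  show "has_bochner_integral M (\<lambda>\<omega>. U \<omega> * (W b \<omega> - W a \<omega>)) 0"
  proof (cases "a < b")
    case True
    have "has_bochner_integral lborel (\<lambda>x. normal_density 0 (sqrt (b - a)) x * x ^ 1) 0"
      using nm(1) True by simp
    from increment_power[OF ab(1) True U(1)[OF True] U(2) this] show ?thesis by simp
  qed (use ab in \<open>auto intro: has_bochner_integral_zero\<close>)
  show "has_bochner_integral M (\<lambda>\<omega>. U \<omega> * (W b \<omega> - W a \<omega>)\<^sup>2) (expectation U * (b - a))"
  proof (cases "a < b")
    case True
    have "has_bochner_integral lborel (\<lambda>x. normal_density 0 (sqrt (b - a)) x * x ^ 2) (b - a)"
      using nm(2)[unfolded e2[OF True]] True by simp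
    from increment_power[OF ab(1) True U(1)[OF True] U(2) this] show ?thesis by simp
  qed (use ab in \<open>auto intro: has_bochner_integral_zero\<close>)
  show "has_bochner_integral M (\<lambda>\<omega>. U \<omega> * (W b \<omega> - W a \<omega>)^4) (expectation U * (3 * (b - a)\<^sup>2))"
  proof (cases "a < b")
    case True
    have "has_bochner_integral lborel (\<lambda>x. normal_density 0 (sqrt (b - a)) x * x ^ 4) (3 * (b - a)\<^sup>2)"
      using nm(3)[unfolded e4[OF True]] True by simp
    from increment_power[OF ab(1) True U(1)[OF True] U(2) this] show ?thesis by simp
  qed (use ab in \<open>auto intro: has_bochner_integral_zero\<close>)
qed

text \<open>In the square of the sum up to \<open>n\<close> the mixed term has expectation 0, since the earlier part and \<open>v n\<close> are
  known at time \<open>s n\<close> while \<open>D n\<close> is centred given that time.  With \<open>D\<close> the Wiener increments this is the Ito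
  isometry; with \<open>D\<close> the squared increments minus their variances it gives the quadratic variation.\<close>
lemma orthogonal_sum:
  fixes v D :: "nat \<Rightarrow> 'a \<Rightarrow> real" and s d :: "nat \<Rightarrow> real"
  assumes "\<And>i. i < n \<Longrightarrow> 0 \<le> s i \<and> s i \<le> s (Suc i)"
    and "\<And>i. i < n \<Longrightarrow> v i \<in> borel_measurable (F (s i)) \<and> (\<exists>C. \<forall>\<omega>\<in>space M. \<bar>v i \<omega>\<bar> \<le> C)"
    and "\<And>i. i < n \<Longrightarrow> D i \<in> borel_measurable (F (s (Suc i)))"
    and "\<And>i U. i < n \<Longrightarrow> U \<in> borel_measurable (F (s i)) \<Longrightarrow> integrable M U \<Longrightarrow>
       has_bochner_integral M (\<lambda>\<omega>. U \<omega> * D i \<omega>) 0"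
    and "\<And>i U. i < n \<Longrightarrow> U \<in> borel_measurable (F (s i)) \<Longrightarrow> integrable M U \<Longrightarrow>
       has_bochner_integral M (\<lambda>\<omega>. U \<omega> * (D i \<omega>)\<^sup>2) (expectation U * d i)"
  shows "(\<lambda>\<omega>. \<Sum>i<n. v i \<omega> * D i \<omega>) \<in> borel_measurable (F (s n)) \<and>
    has_bochner_integral M (\<lambda>\<omega>. (\<Sum>i<n. v i \<omega> * D i \<omega>)\<^sup>2) (\<Sum>i<n. expectation (\<lambda>\<omega>. (v i \<omega>)\<^sup>2) * d i)"
  using assms
proof (induction n)
  case 0
  show ?case by (auto intro: has_bochner_integral_zero)
next
  case (Suc n)
  let ?S = "\<lambda>\<omega>. \<Sum>i<n. v i \<omega> * D i \<omega>"
  have IH: "?S \<in> borel_measurable (F (s n))"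
    "has_bochner_integral M (\<lambda>\<omega>. (?S \<omega>)\<^sup>2) (\<Sum>i<n. expectation (\<lambda>\<omega>. (v i \<omega>)\<^sup>2) * d i)"
    using Suc.IH Suc.prems by (simp_all add: less_SucI)
  have sn: "0 \<le> s n" "s n \<le> s (Suc n)" using Suc.prems(1)[of n] by auto
  have v[measurable]: "v n \<in> borel_measurable (F (s n))" and D: "D n \<in> borel_measurable (F (s (Suc n)))"
    using Suc.prems(2,3)[of n] by auto
  obtain C where C: "\<And>\<omega>. \<omega> \<in> space M \<Longrightarrow> \<bar>v n \<omega>\<bar> \<le> C" using Suc.prems(2)[of n] by auto
  note [measurable] = IH(1)
  have [measurable]: "?S \<in> borel_measurable M" "v n \<in> borel_measurable M"
    using measurable_F_M[OF IH(1) sn(1)] measurable_F_M[OF v sn(1)] by auto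
  have [measurable]: "D n \<in> borel_measurable M"
    using D sn by (intro measurable_F_M[OF D]) auto
  have v2: "integrable M (\<lambda>\<omega>. (v n \<omega>)\<^sup>2)"
  proof (rule integrable_const_bound[where B = "C\<^sup>2"])
    show "AE \<omega> in M. norm ((v n \<omega>)\<^sup>2) \<le> C\<^sup>2"
      using C by (intro AE_I2) (simp, metis abs_ge_zero power2_abs power_mono)
  qed simp
  have Sv: "integrable M (\<lambda>\<omega>. ?S \<omega> * v n \<omega>)"
  proof (rule Bochner_Integration.integrable_bound)
    show "integrable M (\<lambda>\<omega>. (1/2) * ((?S \<omega>)\<^sup>2 + (v n \<omega>)\<^sup>2))"
      using IH(2) v2 by (auto simp: has_bochner_integral_iff)
    show "AE \<omega> in M. norm (?S \<omega> * v n \<omega>) \<le> norm (1/2 * ((?S \<omega>)\<^sup>2 + (v n \<omega>)\<^sup>2))"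
    proof (intro AE_I2)
      fix \<omega> show "norm (?S \<omega> * v n \<omega>) \<le> norm (1/2 * ((?S \<omega>)\<^sup>2 + (v n \<omega>)\<^sup>2))"
        using sum_squares_bound[of "\<bar>?S \<omega>\<bar>" "\<bar>v n \<omega>\<bar>"] by (simp add: abs_mult)
    qed
  qed simp
  have 1: "has_bochner_integral M (\<lambda>\<omega>. (?S \<omega> * v n \<omega>) * D n \<omega>) 0"
    by (rule Suc.prems(4)) (auto intro: Sv)
  have 2: "has_bochner_integral M (\<lambda>\<omega>. (v n \<omega>)\<^sup>2 * (D n \<omega>)\<^sup>2) (expectation (\<lambda>\<omega>. (v n \<omega>)\<^sup>2) * d n)"
    by (rule Suc.prems(5)) (auto intro: v2)
  have "has_bochner_integral M (\<lambda>\<omega>. (?S \<omega>)\<^sup>2 + 2 * ((?S \<omega> * v n \<omega>) * D n \<omega>) + (v n \<omega>)\<^sup>2 * (D n \<omega>)\<^sup>2)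
     ((\<Sum>i<n. expectation (\<lambda>\<omega>. (v i \<omega>)\<^sup>2) * d i) + 2 * 0 + expectation (\<lambda>\<omega>. (v n \<omega>)\<^sup>2) * d n)"
    by (intro has_bochner_integral_add has_bochner_integral_mult_right IH(2) 1 2)
  then have "has_bochner_integral M (\<lambda>\<omega>. (\<Sum>i<Suc n. v i \<omega> * D i \<omega>)\<^sup>2) (\<Sum>i<Suc n. expectation (\<lambda>\<omega>. (v i \<omega>)\<^sup>2) * d i)"
    by (simp add: power2_sum power_mult_distrib algebra_simps)
  moreover have "(\<lambda>\<omega>. \<Sum>i<Suc n. v i \<omega> * D i \<omega>) \<in> borel_measurable (F (s (Suc n)))"
    using measurable_F_mono[OF IH(1) sn(2)] measurable_F_mono[OF v sn(2)] D by simp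
  ultimately show ?case by simp
qed

end

section \<open>Simple processes\<close>

lemma monotone_upto:
  fixes \<tau> :: "nat \<Rightarrow> real"
  assumes "\<And>i. i < n \<Longrightarrow> \<tau> i \<le> \<tau> (Suc i)" "i \<le> j" "j \<le> n"
  shows "\<tau> i \<le> \<tau> j"
  using assms(2,3)
proof (induction j rule: dec_induct)
  case (step m)
  then show ?case using assms(1)[of m] by auto
qed simp

lemma simple_process_at:
  assumes "\<And>i. i < n \<Longrightarrow> \<tau> i \<le> \<tau> (Suc i)" "i < n" "\<tau> i < u" "u \<le> \<tau> (Suc i)"
  shows "simple_process n \<tau> \<xi> u \<omega> = \<xi> i \<omega>"
proof -
  have "simple_process n \<tau> \<xi> u \<omega> = (\<Sum>j<n. if j = i then \<xi> i \<omega> else 0)"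
    unfolding simple_process_def
  proof (intro sum.cong refl)
    fix j assume "j \<in> {..<n}"
    then have j: "j < n" by simp
    have "u \<notin> {\<tau> j<..\<tau> (Suc j)}" if "j \<noteq> i"
    proof (cases "j < i")
      case True
      then have "\<tau> (Suc j) \<le> \<tau> i" 
        using monotone_upto[where n = n and \<tau> = \<tau> and i = "Suc j" and j = i] assms(1,2) by auto
      then show ?thesis using assms by auto
    next
      case False
      then have "\<tau> (Suc i) \<le> \<tau> j" 
        using monotone_upto[where n = n and \<tau> = \<tau> and i = "Suc i" and j = j] assms(1) that j by auto
      then show ?thesis using assms by auto
    qed
    then show "\<xi> j \<omega> * indicator {\<tau> j<..\<tau> (Suc j)} u = (if j = i then \<xi> i \<omega> else 0)"
      using assms by (auto simp: indicator_def)
  qed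
  also have "\<dots> = \<xi> i \<omega>" using assms(2) by simp
  finally show ?thesis .
qed

lemma simple_process_outside:
  assumes "\<And>i. i < n \<Longrightarrow> \<not> (\<tau> i < u \<and> u \<le> \<tau> (Suc i))"
  shows "simple_process n \<tau> \<xi> u \<omega> = 0"
  unfolding simple_process_def using assms by (intro sum.neutral) (auto simp: indicator_def)

text \<open>At most one partition interval contains \<open>u\<close>, so the operation can be applied to the coefficients; the
  condition on \<open>h\<close> concerns the times outside all intervals.\<close>
lemma simple_process_map2:
  assumes "\<And>i. i < n \<Longrightarrow> \<tau> i \<le> \<tau> (Suc i)" and h: "h 0 0 = 0"
  shows "simple_process n \<tau> (\<lambda>i \<omega>. h (\<xi> i \<omega>) (\<zeta> i \<omega>)) u \<omega>
    = h (simple_process n \<tau> \<xi> u \<omega>) (simple_process n \<tau> \<zeta> u \<omega>)"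
proof (cases "\<exists>i<n. \<tau> i < u \<and> u \<le> \<tau> (Suc i)")
  case True
  then obtain i where i: "i < n" "\<tau> i < u" "u \<le> \<tau> (Suc i)" by auto
  show ?thesis by (simp add: simple_process_at[OF assms(1) i])
next
  case False
  then show ?thesis by (simp add: simple_process_outside h)
qed

lemma integral_simple_process:
  assumes "\<And>i. i < n \<Longrightarrow> 0 \<le> \<tau> i \<and> \<tau> i \<le> \<tau> (Suc i)" and t: "0 \<le> t"
  shows "has_bochner_integral lborel (\<lambda>u. indicator {0..t} u * simple_process n \<tau> \<xi> u \<omega>)
    (\<Sum>i<n. \<xi> i \<omega> * (min (\<tau> (Suc i)) t - min (\<tau> i) t))"
proof -
  have "has_bochner_integral lborel (\<lambda>u. \<Sum>i<n. \<xi> i \<omega> * indicator {min (\<tau> i) t<..min (\<tau> (Suc i)) t} u)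
     (\<Sum>i<n. \<xi> i \<omega> * (min (\<tau> (Suc i)) t - min (\<tau> i) t))"
  proof (intro has_bochner_integral_sum has_bochner_integral_mult_right)
    fix i assume "i \<in> {..<n}"
    then have "min (\<tau> i) t \<le> min (\<tau> (Suc i)) t" using assms(1)[of i] by auto
    then show "has_bochner_integral lborel (indicator {min (\<tau> i) t<..min (\<tau> (Suc i)) t})
         (min (\<tau> (Suc i)) t - min (\<tau> i) t)"
      using has_bochner_integral_real_indicator[of "{min (\<tau> i) t<..min (\<tau> (Suc i)) t}" lborel] by simp
  qed
  also have "(\<lambda>u. \<Sum>i<n. \<xi> i \<omega> * indicator {min (\<tau> i) t<..min (\<tau> (Suc i)) t} u)
     = (\<lambda>u. indicator {0..t} u * simple_process n \<tau> \<xi> u \<omega>)"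
  proof
    fix u
    show "(\<Sum>i<n. \<xi> i \<omega> * indicator {min (\<tau> i) t<..min (\<tau> (Suc i)) t} u)
        = indicator {0..t} u * simple_process n \<tau> \<xi> u \<omega>"
      unfolding simple_process_def sum_distrib_left
    proof (intro sum.cong refl)
      fix i assume "i \<in> {..<n}"
      then have "0 \<le> \<tau> i" using assms(1)[of i] by auto
      then show "\<xi> i \<omega> * indicator {min (\<tau> i) t<..min (\<tau> (Suc i)) t} u =
        indicator {0..t} u * (\<xi> i \<omega> * indicator {\<tau> i<..\<tau> (Suc i)} u)"
        by (auto simp: indicator_def min_def split: if_splits)
    qed
  qed
  finally show ?thesis .
qed

lemma simple_integral_bernoulli_noise:
  "simple_integral (bernoulli_noise B W) n \<tau> \<xi> t \<omega> =
    B \<omega> * (\<Sum>i<n. \<xi> i \<omega> * (min (\<tau> (Suc i)) t - min (\<tau> i) t)) + simple_integral W n \<tau> \<xi> t \<omega>"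
  unfolding simple_integral_def bernoulli_noise_def sum_distrib_left sum.distrib[symmetric]
  by (intro sum.cong refl) (simp add: algebra_simps)

lemma simple_integral_diff:
  "simple_integral X n \<tau> (\<lambda>i \<omega>. \<xi> i \<omega> - \<zeta> i \<omega>) t \<omega> = simple_integral X n \<tau> \<xi> t \<omega> - simple_integral X n \<tau> \<zeta> t \<omega>"
  unfolding simple_integral_def sum_subtractf[symmetric] by (intro sum.cong refl) (simp add: algebra_simps)

section \<open>Refinement of partitions\<close>

text \<open>The set \<open>P\<close> of the grid points is a parameter of its own since refining a partition means enlarging
  that set.\<close>
definition grid :: "real \<Rightarrow> nat \<Rightarrow> (nat \<Rightarrow> real) \<Rightarrow> real set \<Rightarrow> bool" where
  "grid T N s P \<longleftrightarrow> s 0 = 0 \<and> s N = T \<and> s ` {..N} = P \<and> (\<forall>i j. i < j \<longrightarrow> j \<le> N \<longrightarrow> s i < s j)"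

lemma grid_exists:
  assumes "finite P" "P \<subseteq> {0..T}" "0 \<in> P" "T \<in> P"
  shows "\<exists>N s. grid T N s P"
proof -
  define l where "l = sorted_list_of_set P"
  have l: "set l = P" "sorted_wrt (<) l" using assms by (simp_all add: l_def)
  have ne: "l \<noteq> []" using assms(3) l(1) by auto
  define N where "N = length l - 1"
  have len: "length l = Suc N" using ne by (simp add: N_def)
  have lt: "l ! i < l ! j" if "i < j" "j \<le> N" for i j
    using l(2) that len by (simp add: sorted_wrt_iff_nth_less)
  have im: "(\<lambda>i. l ! i) ` {..N} = P"
    using l(1) len by (auto simp: set_conv_nth less_Suc_eq_le)
  have "l ! 0 = 0"
  proof -
    obtain i where i: "i \<le> N" "l ! i = 0" using im assms(3) by force
    have "0 \<le> l ! 0" using im assms(2) by force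
    then show ?thesis using lt[of 0 i] i by (cases "i = 0") auto
  qed
  moreover have "l ! N = T"
  proof -
    obtain i where i: "i \<le> N" "l ! i = T" using im assms(4) by force
    have "l ! N \<le> T" using im assms(2) by force
    then show ?thesis using lt[of i N] i by (cases "i = N") auto
  qed
  ultimately show ?thesis unfolding grid_def using lt im by blast
qed

lemma grid_telescope:
  fixes Y :: "real \<Rightarrow> real"
  assumes g: "grid T N s P" and ab: "a \<in> P" "b \<in> P" "a \<le> b"
  shows "(\<Sum>j<N. indicator {a<..b} (s (Suc j)) * (Y (s (Suc j)) - Y (s j))) = Y b - Y a"
proof -
  have lt: "s i < s j" if "i < j" "j \<le> N" for i j using g that by (auto simp: grid_def)
  obtain p q where p: "p \<le> N" "a = s p" and q: "q \<le> N" "b = s q"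
    using g ab by (auto simp: grid_def image_iff)
  have pq: "p \<le> q" using lt[of q p] p q ab(3) by fastforce
  have le: "s i \<le> s j \<longleftrightarrow> i \<le> j" if "i \<le> N" "j \<le> N" for i j
    using lt[of i j] lt[of j i] that by (cases i j rule: linorder_cases) auto
  have "(\<Sum>j<N. indicator {a<..b} (s (Suc j)) * (Y (s (Suc j)) - Y (s j)))
      = (\<Sum>j<N. if j \<in> {p..<q} then Y (s (Suc j)) - Y (s j) else 0)"
  proof (intro sum.cong refl)
    fix j assume "j \<in> {..<N}"
    then have "s (Suc j) \<in> {a<..b} \<longleftrightarrow> j \<in> {p..<q}"
      using le[of "Suc j" p] le[of "Suc j" q] p q by (auto simp: not_le[symmetric])
    then show "indicator {a<..b} (s (Suc j)) * (Y (s (Suc j)) - Y (s j)) =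
       (if j \<in> {p..<q} then Y (s (Suc j)) - Y (s j) else 0)" by (simp add: indicator_def)
  qed
  also have "\<dots> = (\<Sum>j\<in>{p..<q}. Y (s (Suc j)) - Y (s j))"
    using q by (subst sum.inter_restrict[symmetric]) (auto intro!: sum.cong)
  also have "\<dots> = Y b - Y a"
    using sum_Suc_diff'[OF pq, of "\<lambda>i. Y (s i)"] p q by simp
  finally show ?thesis .
qed

text \<open>Applied to a path of the integrator this shows that simple integrals are invariant under refinement.
  Applied to the indicator of \<open>{u..}\<close>, whose increment over \<open>{a<..b}\<close> is the indicator of that interval at \<open>u\<close>,
  it shows the same for simple processes.\<close>
lemma refine_sum:
  fixes Y :: "real \<Rightarrow> real"
  assumes g: "grid T N s P" and \<tau>: "\<And>i. i < n \<Longrightarrow> \<tau> i \<in> P \<and> \<tau> (Suc i) \<in> P \<and> \<tau> i \<le> \<tau> (Suc i)"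
  shows "(\<Sum>j<N. simple_process n \<tau> \<xi> (s (Suc j)) \<omega> * (Y (s (Suc j)) - Y (s j)))
     = (\<Sum>i<n. \<xi> i \<omega> * (Y (\<tau> (Suc i)) - Y (\<tau> i)))"
proof -
  have "(\<Sum>j<N. simple_process n \<tau> \<xi> (s (Suc j)) \<omega> * (Y (s (Suc j)) - Y (s j)))
     = (\<Sum>i<n. \<xi> i \<omega> * (\<Sum>j<N. indicator {\<tau> i<..\<tau> (Suc i)} (s (Suc j)) * (Y (s (Suc j)) - Y (s j))))"
    unfolding simple_process_def sum_distrib_right sum_distrib_left
    by (subst sum.swap) (simp add: mult.assoc)
  also have "\<dots> = (\<Sum>i<n. \<xi> i \<omega> * (Y (\<tau> (Suc i)) - Y (\<tau> i)))"
    using \<tau> by (intro sum.cong refl, subst grid_telescope[OF g]) auto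
  finally show ?thesis .
qed

lemma refine_simple_integral:
  assumes g: "grid T N s P" and \<tau>: "\<And>i. i < n \<Longrightarrow> \<tau> i \<in> P \<and> \<tau> (Suc i) \<in> P \<and> \<tau> i \<le> \<tau> (Suc i)"
  shows "simple_integral X N s (\<lambda>j. simple_process n \<tau> \<xi> (s (Suc j))) t \<omega> = simple_integral X n \<tau> \<xi> t \<omega>"
  using refine_sum[where n = n and \<tau> = \<tau>, OF g \<tau>, of \<xi> \<omega> "\<lambda>x. X (min x t) \<omega>"] by (simp add: simple_integral_def)

lemma refine_simple_process:
  assumes g: "grid T N s P" and \<tau>: "\<And>i. i < n \<Longrightarrow> \<tau> i \<in> P \<and> \<tau> (Suc i) \<in> P \<and> \<tau> i \<le> \<tau> (Suc i)"
  shows "simple_process N s (\<lambda>j. simple_process n \<tau> \<xi> (s (Suc j))) u \<omega> = simple_process n \<tau> \<xi> u \<omega>"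
proof -
  have ind: "indicator {a<..b} u = indicator {u..} b - (indicator {u..} a :: real)" if "a \<le> b" for a b
    using that by (auto simp: indicator_def)
  have sp: "simple_process n \<tau> \<xi> u \<omega> = (\<Sum>i<n. \<xi> i \<omega> * (indicator {u..} (\<tau> (Suc i)) - indicator {u..} (\<tau> i)))"
    if "\<And>i. i < n \<Longrightarrow> \<tau> i \<le> \<tau> (Suc i)" for n \<tau> \<xi>
    unfolding simple_process_def
  proof (intro sum.cong refl)
    fix i assume "i \<in> {..<n}"
    then have "\<tau> i \<le> \<tau> (Suc i)" using that by simp
    from ind[OF this] show "\<xi> i \<omega> * indicator {\<tau> i<..\<tau> (Suc i)} u
      = \<xi> i \<omega> * (indicator {u..} (\<tau> (Suc i)) - indicator {u..} (\<tau> i))" by simp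
  qed
  have lt: "s i < s j" if "i < j" "j \<le> N" for i j using g that by (auto simp: grid_def)
  have s: "s j \<le> s (Suc j)" if "j < N" for j using lt[of j "Suc j"] that by simp
  have "simple_process N s (\<lambda>j. simple_process n \<tau> \<xi> (s (Suc j))) u \<omega>
     = (\<Sum>j<N. simple_process n \<tau> \<xi> (s (Suc j)) \<omega> * (indicator {u..} (s (Suc j)) - indicator {u..} (s j)))"
    by (rule sp) (rule s)
  also have "\<dots> = (\<Sum>i<n. \<xi> i \<omega> * (indicator {u..} (\<tau> (Suc i)) - indicator {u..} (\<tau> i)))"
    by (rule refine_sum[where n = n and \<tau> = \<tau> and \<xi> = \<xi> and \<omega> = \<omega> and Y = "indicator {u..}", OF g \<tau>])
  also have "\<dots> = simple_process n \<tau> \<xi> u \<omega>"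
    by (rule sp[symmetric]) (use \<tau> in blast)
  finally show ?thesis .
qed

lemma refine_simple_integrand:
  assumes g: "grid T N s P" and P: "P \<subseteq> {0..T}"
    and \<tau>: "\<And>i. i < n \<Longrightarrow> \<tau> i \<in> P \<and> \<tau> (Suc i) \<in> P \<and> \<tau> i \<le> \<tau> (Suc i)"
    and \<xi>: "simple_integrand M F T n \<tau> \<xi>" and F: "filtered_prob_space M F"
  shows "simple_integrand M F T N s (\<lambda>j. simple_process n \<tau> \<xi> (s (Suc j)))"
proof -
  interpret filtered_prob_space M F by fact
  have lt: "s i < s j" if "i < j" "j \<le> N" for i j using g that by (auto simp: grid_def)
  have sP: "s i \<in> P" if "i \<le> N" for i using g that by (auto simp: grid_def)
  show ?thesis
    unfolding simple_integrand_def
  proof (intro allI impI conjI)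
    fix j assume j: "j < N"
    show "0 \<le> s j" "s j \<le> s (Suc j)" "s (Suc j) \<le> T"
      using sP[of j] sP[of "Suc j"] P lt[of j "Suc j"] j by auto
    have "(\<lambda>\<omega>. \<xi> i \<omega> * indicator {\<tau> i<..\<tau> (Suc i)} (s (Suc j))) \<in> borel_measurable (F (s j))" if i: "i < n" for i
    proof (cases "\<tau> i < s (Suc j)")
      case True
      obtain p where p: "p \<le> N" "\<tau> i = s p" using \<tau>[OF i] g by (auto simp: grid_def image_iff)
      have "p < Suc j" using True lt[of "Suc j" p] p j by (cases p "Suc j" rule: linorder_cases) auto
      then have "\<tau> i \<le> s j" using lt[of p j] j p by (cases "p = j") auto
      then have "\<xi> i \<in> borel_measurable (F (s j))"
        using \<xi> i by - (rule measurable_F_mono[of _ "\<tau> i"], auto simp: simple_integrand_def)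
      then show ?thesis by simp
    next
      case False
      then have "(\<lambda>\<omega>. \<xi> i \<omega> * indicator {\<tau> i<..\<tau> (Suc i)} (s (Suc j))) = (\<lambda>_. 0)" by auto
      then show ?thesis by simp
    qed
    then show "simple_process n \<tau> \<xi> (s (Suc j)) \<in> borel_measurable (F (s j))"
      unfolding simple_process_def[abs_def] by (intro borel_measurable_sum) auto
    from \<xi> have "\<forall>i. \<exists>C. i < n \<longrightarrow> (\<forall>\<omega>\<in>space M. \<bar>\<xi> i \<omega>\<bar> \<le> C)" by (auto simp: simple_integrand_def)
    then obtain C where C: "\<And>i \<omega>. i < n \<Longrightarrow> \<omega> \<in> space M \<Longrightarrow> \<bar>\<xi> i \<omega>\<bar> \<le> C i" by metis
    show "\<exists>C. \<forall>\<omega>\<in>space M. \<bar>simple_process n \<tau> \<xi> (s (Suc j)) \<omega>\<bar> \<le> C"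
    proof (intro exI[of _ "\<Sum>i<n. C i"] ballI)
      fix \<omega> assume w: "\<omega> \<in> space M"
      show "\<bar>simple_process n \<tau> \<xi> (s (Suc j)) \<omega>\<bar> \<le> (\<Sum>i<n. C i)"
        unfolding simple_process_def
      proof (intro order_trans[OF sum_abs] sum_mono)
        fix i assume "i \<in> {..<n}"
        then show "\<bar>\<xi> i \<omega> * indicator {\<tau> i<..\<tau> (Suc i)} (s (Suc j))\<bar> \<le> C i"
          using C[of i \<omega>] w by (auto simp: indicator_def)
      qed
    qed
  qed
qed

section \<open>Integration over time and probability\<close>

lemma tendsto_zero_by_bounds:
  fixes a :: "nat \<Rightarrow> real"
  assumes "\<And>k. 0 \<le> a k" and "\<And>e. 0 < e \<Longrightarrow> \<exists>p. (\<forall>k. a k \<le> e + p k) \<and> p \<longlonglongrightarrow> 0"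
  shows "a \<longlonglongrightarrow> 0"
proof (rule LIMSEQ_I)
  fix r :: real assume r: "0 < r"
  obtain p where p: "\<And>k. a k \<le> r / 2 + p k" "p \<longlonglongrightarrow> 0" using assms(2)[of "r / 2"] r by auto
  from LIMSEQ_D[OF p(2), of "r / 2"] r obtain n where n: "\<And>k. k \<ge> n \<Longrightarrow> \<bar>p k\<bar> < r / 2" by auto
  show "\<exists>no. \<forall>k\<ge>no. norm (a k - 0) < r"
  proof (intro exI[of _ n] allI impI)
    fix k assume "n \<le> k"
    from n[OF this] p(1)[of k] assms(1)[of k] show "norm (a k - 0) < r"
      unfolding real_norm_def by linarith
  qed
qed

lemma continuous_on_time_integral:
  fixes f :: "real \<Rightarrow> real"
  assumes "set_integrable lborel {0..T} f"
  shows "continuous_on {0..T} (\<lambda>t. LINT s:{0..t}|lborel. f s)"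
proof -
  have "f integrable_on {0..T}" using set_borel_integral_eq_integral(1)[OF assms] .
  then have c: "continuous_on {0..T} (\<lambda>t. integral {0..t} f)" by (rule indefinite_integral_continuous_1)
  have "(LINT s:{0..t}|lborel. f s) = integral {0..t} f" if "t \<in> {0..T}" for t
    using that by (intro set_borel_integral_eq_integral(2) set_integrable_subset[OF assms]) auto
  with c show ?thesis by (intro continuous_on_eq[OF c]) simp
qed

locale wiener_horizon = wiener_space M F W
  for M :: "'a measure" and F :: "real \<Rightarrow> 'a measure" and W +
  fixes T :: real
  assumes T_pos: "0 < T"
begin

abbreviation L :: "real measure" where "L \<equiv> restrict_space lborel {0..T}"

lemma space_L [simp]: "space L = {0..T}" by (simp add: space_restrict_space)

sublocale L: finite_measure L
  by standard (simp add: emeasure_restrict_space emeasure_lborel_Icc_eq)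

sublocale LM: pair_sigma_finite L M
  by (intro pair_sigma_finite.intro L.sigma_finite_measure sigma_finite_measure)

lemma measure_L: "measure L (space L) = T"
  using T_pos by (simp add: measure_restrict_space)

text \<open>The class of processes for which all integrals over time and expectations exist and can be
  interchanged.\<close>
definition bounded_joint :: "(real \<Rightarrow> 'a \<Rightarrow> real) \<Rightarrow> bool" where
  "bounded_joint H \<longleftrightarrow> (\<lambda>(u, \<omega>). H u \<omega>) \<in> borel_measurable (L \<Otimes>\<^sub>M M) \<and>
     (\<exists>C. \<forall>u\<in>{0..T}. \<forall>\<omega>\<in>space M. \<bar>H u \<omega>\<bar> \<le> C)"

lemma id_measurable_F: "0 \<le> t \<Longrightarrow> (\<lambda>\<omega>. \<omega>) \<in> measurable M (F t)"
  by (rule measurable_from_subalg[OF subalgebra_F]) auto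

lemma progressive_joint:
  assumes "progressive F T H"
  shows "(\<lambda>(u, \<omega>). H u \<omega>) \<in> borel_measurable (L \<Otimes>\<^sub>M M)"
proof -
  have H: "(\<lambda>(s, \<omega>). H s \<omega>) \<in> borel_measurable (restrict_space borel {0..T} \<Otimes>\<^sub>M F T)"
    using assms T_pos by (auto simp: progressive_def)
  have "(\<lambda>x. x) \<in> measurable L (restrict_space borel {0..T})"
    by (rule measurable_ident_sets) (simp add: sets_restrict_space)
  then have "(\<lambda>x. (fst x, snd x)) \<in> measurable (L \<Otimes>\<^sub>M M) (restrict_space borel {0..T} \<Otimes>\<^sub>M F T)"
    using id_measurable_F[of T] T_pos
    by (intro measurable_Pair measurable_compose[OF measurable_fst] measurable_compose[OF measurable_snd]) auto
  from measurable_compose[OF this H] show ?thesis by (simp add: case_prod_unfold)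
qed

lemma bounded_jointI:
  assumes "progressive F T H" "\<And>u \<omega>. u \<in> {0..T} \<Longrightarrow> \<omega> \<in> space M \<Longrightarrow> \<bar>H u \<omega>\<bar> \<le> C"
  shows "bounded_joint H"
  using progressive_joint[OF assms(1)] assms(2) unfolding bounded_joint_def by blast

lemma progressive_adapted:
  assumes "progressive F T H" "u \<in> {0..T}"
  shows "H u \<in> borel_measurable (F u)"
proof -
  have "(\<lambda>(s, \<omega>). H s \<omega>) \<in> borel_measurable (restrict_space borel {0..u} \<Otimes>\<^sub>M F u)"
    using assms by (auto simp: progressive_def)
  from measurable_compose[OF measurable_Pair1' this, of u] assms show ?thesis
    by (auto simp: space_restrict_space)
qed

lemma progressive_time_integral_adapted:
  assumes "progressive F T H" "t \<in> {0..T}"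
  shows "(\<lambda>\<omega>. LINT s:{0..t}|lborel. H s \<omega>) \<in> borel_measurable (F t)"
proof -
  let ?Lt = "restrict_space lborel {0..t}"
  interpret Lt: finite_measure ?Lt by standard (simp add: emeasure_restrict_space space_restrict_space emeasure_lborel_Icc_eq)
  have H: "(\<lambda>(s, \<omega>). H s \<omega>) \<in> borel_measurable (restrict_space borel {0..t} \<Otimes>\<^sub>M F t)"
    using assms by (auto simp: progressive_def)
  have "sets (?Lt \<Otimes>\<^sub>M F t) = sets (restrict_space borel {0..t} \<Otimes>\<^sub>M F t)"
    by (intro sets_pair_measure_cong) (simp_all add: sets_restrict_space)
  then have "(\<lambda>(s, \<omega>). H s \<omega>) \<in> borel_measurable (?Lt \<Otimes>\<^sub>M F t)"
    using H by (simp cong: measurable_cong_sets)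
  from measurable_pair_swap[OF this]
  have "(\<lambda>\<omega>. \<integral>s. H s \<omega> \<partial>?Lt) \<in> borel_measurable (F t)"
    by (intro Lt.borel_measurable_lebesgue_integral) simp
  then show ?thesis by (simp add: integral_restrict_space set_lebesgue_integral_def)
qed

lemma bounded_joint_diff: "bounded_joint H \<Longrightarrow> bounded_joint G \<Longrightarrow> bounded_joint (\<lambda>u \<omega>. H u \<omega> - G u \<omega>)"
proof -
  assume H: "bounded_joint H" and G: "bounded_joint G"
  then obtain C D where CD: "\<And>u \<omega>. u \<in> {0..T} \<Longrightarrow> \<omega> \<in> space M \<Longrightarrow> \<bar>H u \<omega>\<bar> \<le> C"
     "\<And>u \<omega>. u \<in> {0..T} \<Longrightarrow> \<omega> \<in> space M \<Longrightarrow> \<bar>G u \<omega>\<bar> \<le> D" unfolding bounded_joint_def by metis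
  have "\<bar>H u \<omega> - G u \<omega>\<bar> \<le> C + D" if "u \<in> {0..T}" "\<omega> \<in> space M" for u \<omega>
    using CD(1)[OF that] CD(2)[OF that] by linarith
  then have b: "\<exists>C. \<forall>u\<in>{0..T}. \<forall>\<omega>\<in>space M. \<bar>H u \<omega> - G u \<omega>\<bar> \<le> C" by blast
  show ?thesis using H G unfolding bounded_joint_def by (intro conjI b) (auto simp: case_prod_unfold)
qed

lemma bounded_joint_add: "bounded_joint H \<Longrightarrow> bounded_joint G \<Longrightarrow> bounded_joint (\<lambda>u \<omega>. H u \<omega> + G u \<omega>)"
proof -
  assume H: "bounded_joint H" and G: "bounded_joint G"
  then obtain C D where CD: "\<And>u \<omega>. u \<in> {0..T} \<Longrightarrow> \<omega> \<in> space M \<Longrightarrow> \<bar>H u \<omega>\<bar> \<le> C"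
     "\<And>u \<omega>. u \<in> {0..T} \<Longrightarrow> \<omega> \<in> space M \<Longrightarrow> \<bar>G u \<omega>\<bar> \<le> D" unfolding bounded_joint_def by metis
  have "\<bar>H u \<omega> + G u \<omega>\<bar> \<le> C + D" if "u \<in> {0..T}" "\<omega> \<in> space M" for u \<omega>
    using CD(1)[OF that] CD(2)[OF that] by linarith
  then have b: "\<exists>C. \<forall>u\<in>{0..T}. \<forall>\<omega>\<in>space M. \<bar>H u \<omega> + G u \<omega>\<bar> \<le> C" by blast
  show ?thesis using H G unfolding bounded_joint_def by (intro conjI b) (auto simp: case_prod_unfold)
qed

lemma bounded_joint_mult: "bounded_joint H \<Longrightarrow> bounded_joint G \<Longrightarrow> bounded_joint (\<lambda>u \<omega>. H u \<omega> * G u \<omega>)"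
proof -
  assume H: "bounded_joint H" and G: "bounded_joint G"
  then obtain C D where CD: "\<And>u \<omega>. u \<in> {0..T} \<Longrightarrow> \<omega> \<in> space M \<Longrightarrow> \<bar>H u \<omega>\<bar> \<le> C"
     "\<And>u \<omega>. u \<in> {0..T} \<Longrightarrow> \<omega> \<in> space M \<Longrightarrow> \<bar>G u \<omega>\<bar> \<le> D" unfolding bounded_joint_def by metis
  have "\<bar>H u \<omega> * G u \<omega>\<bar> \<le> C * D" if "u \<in> {0..T}" "\<omega> \<in> space M" for u \<omega>
    using mult_mono[OF CD(1)[OF that] CD(2)[OF that]] CD(1)[OF that] by (simp add: abs_mult)
  then have b: "\<exists>C. \<forall>u\<in>{0..T}. \<forall>\<omega>\<in>space M. \<bar>H u \<omega> * G u \<omega>\<bar> \<le> C" by blast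
  show ?thesis using H G unfolding bounded_joint_def by (intro conjI b) (auto simp: case_prod_unfold)
qed

lemma bounded_joint_const: "bounded_joint (\<lambda>_ _. c)"
  unfolding bounded_joint_def by auto

lemma bounded_joint_power2: "bounded_joint H \<Longrightarrow> bounded_joint (\<lambda>u \<omega>. (H u \<omega>)\<^sup>2)"
  unfolding power2_eq_square by (rule bounded_joint_mult)

lemma bounded_joint_abs: "bounded_joint H \<Longrightarrow> bounded_joint (\<lambda>u \<omega>. \<bar>H u \<omega>\<bar>)"
  unfolding bounded_joint_def by (auto simp: case_prod_unfold)

lemma bounded_joint_indicator: "bounded_joint (\<lambda>u \<omega>. indicator {0..t} u)"
proof -
  have "indicator {0..t} \<in> borel_measurable L"
    by (intro measurable_restrict_space1) auto
  from measurable_compose[OF measurable_fst this]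
  have "(\<lambda>x. indicator {0..t} (fst x) :: real) \<in> borel_measurable (L \<Otimes>\<^sub>M M)" .
  then show ?thesis
    unfolding bounded_joint_def by (auto simp: case_prod_unfold intro!: exI[of _ 1] split: split_indicator)
qed

lemmas bounded_joint_until = bounded_joint_mult[OF bounded_joint_indicator]

lemmas bounded_joint_intros = bounded_joint_diff bounded_joint_add bounded_joint_mult
  bounded_joint_const bounded_joint_power2 bounded_joint_abs bounded_joint_indicator

lemma bounded_joint_integrable_L:
  assumes "bounded_joint H" "\<omega> \<in> space M"
  shows "integrable L (\<lambda>u. H u \<omega>)"
proof -
  obtain C where C: "\<And>u \<omega>. u \<in> {0..T} \<Longrightarrow> \<omega> \<in> space M \<Longrightarrow> \<bar>H u \<omega>\<bar> \<le> C"
    using assms(1) unfolding bounded_joint_def by metis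
  have "(\<lambda>u. H u \<omega>) \<in> borel_measurable L"
    using assms measurable_compose[OF measurable_Pair2'[OF assms(2)], of "\<lambda>(u, \<omega>). H u \<omega>" L borel]
    unfolding bounded_joint_def by simp
  then show ?thesis using C assms(2) by (intro L.integrable_const_bound[where B = C] AE_I2) auto
qed

lemma bounded_joint_integrable_M:
  assumes "bounded_joint H" "u \<in> {0..T}"
  shows "integrable M (H u)"
proof -
  obtain C where C: "\<And>u \<omega>. u \<in> {0..T} \<Longrightarrow> \<omega> \<in> space M \<Longrightarrow> \<bar>H u \<omega>\<bar> \<le> C"
    using assms(1) unfolding bounded_joint_def by metis
  have "u \<in> space L" using assms(2) by simp
  from measurable_compose[OF measurable_Pair1'[OF this], of "\<lambda>(u, \<omega>). H u \<omega>" M borel]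
  have "H u \<in> borel_measurable M" using assms unfolding bounded_joint_def by simp
  then show ?thesis using C assms(2) by (intro integrable_const_bound[where B = C] AE_I2) auto
qed

lemma bounded_joint_integrable_LM:
  assumes "bounded_joint H"
  shows "integrable (L \<Otimes>\<^sub>M M) (\<lambda>(u, \<omega>). H u \<omega>)"
proof -
  obtain C where C: "\<And>u \<omega>. u \<in> {0..T} \<Longrightarrow> \<omega> \<in> space M \<Longrightarrow> \<bar>H u \<omega>\<bar> \<le> C"
    using assms(1) unfolding bounded_joint_def by metis
  interpret LMf: finite_measure "L \<Otimes>\<^sub>M M"
  proof
    have "emeasure (L \<Otimes>\<^sub>M M) (space (L \<Otimes>\<^sub>M M)) = emeasure L (space L) * emeasure M (space M)"
      unfolding space_pair_measure by (intro emeasure_pair_measure_Times sets.top)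
    then show "emeasure (L \<Otimes>\<^sub>M M) (space (L \<Otimes>\<^sub>M M)) \<noteq> \<infinity>"
      using L.emeasure_finite by (simp add: emeasure_space_1)
  qed
  show ?thesis
    using assms C unfolding bounded_joint_def
    by (intro LMf.integrable_const_bound[where B = C] AE_I2) (auto simp: space_pair_measure)
qed

lemma
  assumes "bounded_joint H"
  shows integrable_time_integral: "integrable M (\<lambda>\<omega>. \<integral>u. H u \<omega> \<partial>L)"
    and expectation_time_integral: "expectation (\<lambda>\<omega>. \<integral>u. H u \<omega> \<partial>L) = (\<integral>u. expectation (H u) \<partial>L)"
    and integrable_expectation: "integrable L (\<lambda>u. expectation (H u))"
  using LM.Fubini_integral[OF bounded_joint_integrable_LM[OF assms]]
    LM.integrable_snd[OF bounded_joint_integrable_LM[OF assms]]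
    LM.integrable_fst[OF bounded_joint_integrable_LM[OF assms]] by simp_all

lemma expectation_time_integral_le:
  assumes H: "bounded_joint H" and le: "\<And>u. 0 < u \<Longrightarrow> u \<le> T \<Longrightarrow> expectation (H u) \<le> c"
  shows "expectation (\<lambda>\<omega>. \<integral>u. H u \<omega> \<partial>L) \<le> c * T"
proof -
  have "AE u in lborel. u \<noteq> (0::real)" by (rule AE_lborel_singleton)
  then have "AE u in L. u \<noteq> 0" by (subst AE_restrict_space_iff) auto
  then have "AE u in L. expectation (H u) \<le> c"
    using AE_space by eventually_elim (use le in auto)
  then have "(\<integral>u. expectation (H u) \<partial>L) \<le> (\<integral>u. c \<partial>L)"
    by (intro integral_mono_AE integrable_expectation H) auto
  also have "\<dots> = c * T" using measure_L by simp
  finally show ?thesis by (simp add: expectation_time_integral[OF H])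
qed

lemma time_integral_mono:
  assumes "bounded_joint H" "bounded_joint G" "\<omega> \<in> space M" "\<And>u. 0 < u \<Longrightarrow> u \<le> T \<Longrightarrow> H u \<omega> \<le> G u \<omega>"
  shows "(\<integral>u. H u \<omega> \<partial>L) \<le> (\<integral>u. G u \<omega> \<partial>L)"
proof -
  have "AE u in lborel. u \<noteq> (0::real)" by (rule AE_lborel_singleton)
  then have "AE u in L. u \<noteq> 0" by (subst AE_restrict_space_iff) auto
  then have "AE u in L. H u \<omega> \<le> G u \<omega>"
    using AE_space by eventually_elim (use assms(4) in auto)
  then show ?thesis by (intro integral_mono_AE bounded_joint_integrable_L assms)
qed

lemma time_integral_until:
  fixes f :: "real \<Rightarrow> real"
  assumes "0 \<le> t" "t \<le> T"
  shows "(LINT s:{0..t}|lborel. f s) = (\<integral>u. indicator {0..t} u * f u \<partial>L)"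
proof -
  have "(\<integral>u. indicator {0..t} u * f u \<partial>L) = (\<integral>u. indicator {0..T} u *\<^sub>R (indicator {0..t} u * f u) \<partial>lborel)"
    by (simp add: integral_restrict_space)
  also have "\<dots> = (LINT s:{0..t}|lborel. f s)"
    unfolding set_lebesgue_integral_def using assms
    by (intro Bochner_Integration.integral_cong) (auto split: split_indicator)
  finally show ?thesis by simp
qed

lemma bounded_joint_set_integrable:
  assumes "bounded_joint H" "\<omega> \<in> space M"
  shows "set_integrable lborel {0..T} (\<lambda>u. H u \<omega>)"
  using bounded_joint_integrable_L[OF assms] by (simp add: integrable_restrict_space set_integrable_def)

lemma time_integral_measurable:
  assumes "bounded_joint H" "t \<in> {0..T}"
  shows "(\<lambda>\<omega>. LINT s:{0..t}|lborel. H s \<omega>) \<in> borel_measurable M"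
  using integrable_time_integral[OF bounded_joint_until[OF assms(1), of t]] assms(2)
  by (simp add: time_integral_until borel_measurable_integrable)

lemma time_integral_increment_bound:
  assumes H: "bounded_joint H" "\<omega> \<in> space M" and K: "\<And>u. u \<in> {0..T} \<Longrightarrow> \<bar>H u \<omega>\<bar> \<le> K"
    and ab: "0 \<le> a" "a \<le> b" "b \<le> T"
  shows "\<bar>(LINT s:{0..b}|lborel. H s \<omega>) - (LINT s:{0..a}|lborel. H s \<omega>)\<bar> \<le> K * (b - a)"
proof -
  have i: "integrable L (\<lambda>u. indicator {0..t} u * H u \<omega>)" for t
    using bounded_joint_integrable_L[OF bounded_joint_until[OF H(1)] H(2)] .
  have iI: "integrable L (\<lambda>u. indicator {a<..b} u * K)"
    by (intro L.integrable_const_bound[where B = "\<bar>K\<bar>"] AE_I2 borel_measurable_times measurable_restrict_space1)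
      (auto split: split_indicator)
  have "(LINT s:{0..b}|lborel. H s \<omega>) - (LINT s:{0..a}|lborel. H s \<omega>)
    = (\<integral>u. indicator {0..b} u * H u \<omega> - indicator {0..a} u * H u \<omega> \<partial>L)"
    using ab by (simp add: time_integral_until i)
  also have "\<bar>\<dots>\<bar> \<le> (\<integral>u. \<bar>indicator {0..b} u * H u \<omega> - indicator {0..a} u * H u \<omega>\<bar> \<partial>L)"
    by (rule integral_abs_bound)
  also have "\<dots> \<le> (\<integral>u. indicator {a<..b} u * K \<partial>L)"
  proof (intro integral_mono)
    show "integrable L (\<lambda>u. \<bar>indicator {0..b} u * H u \<omega> - indicator {0..a} u * H u \<omega>\<bar>)"
      by (intro integrable_abs Bochner_Integration.integrable_diff i)
    fix u assume "u \<in> space L"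
    then show "\<bar>indicator {0..b} u * H u \<omega> - indicator {0..a} u * H u \<omega>\<bar> \<le> indicator {a<..b} u * K"
      using K[of u] ab by (auto split: split_indicator)
  qed (rule iI)
  also have "\<dots> = (\<integral>u. indicator {0..T} u *\<^sub>R (indicator {a<..b} u * K) \<partial>lborel)"
    by (subst integral_restrict_space) auto
  also have "\<dots> = (\<integral>u. indicator {a<..b} u * K \<partial>lborel)"
    using ab by (intro Bochner_Integration.integral_cong) (auto split: split_indicator)
  also have "\<dots> = K * (b - a)" using ab by simp
  finally show ?thesis .
qed

text \<open>The Cauchy-Schwarz inequality, obtained from the integral of \<open>(f - m / T)\<^sup>2\<close>, where \<open>m\<close> is the integral of
  the integrand \<open>f\<close> cut off at \<open>t\<close>.\<close>
lemma time_integral_square_le: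
  assumes H: "bounded_joint H" "\<omega> \<in> space M" and t: "t \<in> {0..T}"
  shows "(LINT s:{0..t}|lborel. H s \<omega>)\<^sup>2 \<le> T * (\<integral>u. (H u \<omega>)\<^sup>2 \<partial>L)"
proof -
  let ?f = "\<lambda>u. indicator {0..t} u * H u \<omega>"
  have i: "integrable L ?f" by (intro bounded_joint_integrable_L bounded_joint_intros H)
  have i2: "integrable L (\<lambda>u. (?f u)\<^sup>2)"
    using bounded_joint_integrable_L[OF bounded_joint_power2[OF bounded_joint_until[OF H(1)]] H(2)] .
  define m where "m = (\<integral>u. ?f u \<partial>L)"
  have "0 \<le> (\<integral>u. (?f u - m / T)\<^sup>2 \<partial>L)" by simp
  also have "\<dots> = (\<integral>u. (?f u)\<^sup>2 - 2 * (m / T) * ?f u + (m / T)\<^sup>2 \<partial>L)"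
    by (intro Bochner_Integration.integral_cong refl) (simp add: power2_diff algebra_simps)
  also have "\<dots> = (\<integral>u. (?f u)\<^sup>2 \<partial>L) - 2 * (m / T) * m + (m / T)\<^sup>2 * T"
    using measure_L i i2 by (simp add: m_def)
  also have "\<dots> = (\<integral>u. (?f u)\<^sup>2 \<partial>L) - m\<^sup>2 / T"
    using T_pos by (simp add: field_simps power2_eq_square)
  finally have "m\<^sup>2 \<le> T * (\<integral>u. (?f u)\<^sup>2 \<partial>L)" using T_pos by (simp add: field_simps)
  also have "\<dots> \<le> T * (\<integral>u. (H u \<omega>)\<^sup>2 \<partial>L)"
    using T_pos by (intro mult_left_mono time_integral_mono bounded_joint_intros H) (auto split: split_indicator)
  finally show ?thesis using t by (simp add: m_def time_integral_until)
qed

section \<open>Convergence in probability\<close>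

lemma integrable_tsq: "X \<in> borel_measurable M \<Longrightarrow> integrable M (\<lambda>\<omega>. tsq (X \<omega>))"
  by (intro integrable_const_bound[where B = 1] AE_I2) auto

lemma expectation_le_prob:
  assumes X: "integrable M X" and e: "0 \<le> e" and C: "0 \<le> C"
    and A: "{\<omega> \<in> space M. P \<omega>} \<in> events"
    and le: "AE \<omega> in M. X \<omega> \<le> (if P \<omega> then C else e)"
  shows "expectation X \<le> e + C * prob {\<omega> \<in> space M. P \<omega>}"
proof -
  define B where "B = {\<omega> \<in> space M. P \<omega>}"
  have B: "B \<in> events" using A by (simp add: B_def)
  have iB: "integrable M (indicator B :: 'a \<Rightarrow> real)"
    using B by (intro integrable_real_indicator) (auto simp: less_top[symmetric])
  have "expectation X \<le> expectation (\<lambda>\<omega>. e + C * indicator B \<omega>)"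
  proof (intro integral_mono_AE X)
    show "integrable M (\<lambda>\<omega>. e + C * indicator B \<omega>)"
      by (intro Bochner_Integration.integrable_add integrable_mult_right iB) simp
    show "AE \<omega> in M. X \<omega> \<le> e + C * indicator B \<omega>"
      using le AE_space
    proof eventually_elim
      case (elim \<omega>)
      then show ?case using e C by (cases "P \<omega>") (auto simp: B_def)
    qed
  qed
  also have "\<dots> = e + C * prob B"
    using B iB by (subst Bochner_Integration.integral_add) (auto simp: prob_space)
  finally show ?thesis by (simp add: B_def)
qed

text \<open>Together with \<open>null_in_probI\<close> below: convergence in probability is convergence of expected truncated
  squares, on which the triangle inequality \<open>expectation_tsq_add_le\<close> is available.\<close>
lemma expectation_tsq_tendsto:
  assumes X: "\<And>k. X k \<in> borel_measurable M" and n: "null_in_prob M (\<lambda>k \<omega>. ennreal \<bar>X k \<omega>\<bar>)"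
  shows "(\<lambda>k. expectation (\<lambda>\<omega>. tsq (X k \<omega>))) \<longlonglongrightarrow> 0"
proof (rule tendsto_zero_by_bounds)
  fix e :: real assume e: "0 < e"
  note [measurable] = X
  have "expectation (\<lambda>\<omega>. tsq (X k \<omega>)) \<le> e + 1 * prob {\<omega> \<in> space M. ennreal e < ennreal \<bar>X k \<omega>\<bar>}" for k
  proof (intro expectation_le_prob integrable_tsq X AE_I2)
    fix \<omega> show "tsq (X k \<omega>) \<le> (if ennreal e < ennreal \<bar>X k \<omega>\<bar> then 1 else e)"
      using e tsq_le_abs[of "X k \<omega>"] by (auto simp: ennreal_less_iff)
  qed (use e in auto)
  moreover have "(\<lambda>k. prob {\<omega> \<in> space M. ennreal e < ennreal \<bar>X k \<omega>\<bar>}) \<longlonglongrightarrow> 0"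
    using n e by (auto simp: null_in_prob_def)
  ultimately show "\<exists>p. (\<forall>k. expectation (\<lambda>\<omega>. tsq (X k \<omega>)) \<le> e + p k) \<and> p \<longlonglongrightarrow> 0"
    by (intro exI[of _ "\<lambda>k. prob {\<omega> \<in> space M. ennreal e < ennreal \<bar>X k \<omega>\<bar>}"]) simp
qed simp

lemma prob_less_abs_le:
  assumes [measurable]: "X \<in> borel_measurable M" and e: "0 < e"
  shows "prob {\<omega> \<in> space M. ennreal e < ennreal \<bar>X \<omega>\<bar>} \<le> expectation (\<lambda>\<omega>. tsq (X \<omega>)) / tsq e"
proof -
  have te: "0 < tsq e" using e by (simp add: tsq_def)
  define B where "B = {\<omega> \<in> space M. ennreal e < ennreal \<bar>X \<omega>\<bar>}"
  have B: "B \<in> events" unfolding B_def by measurable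
  have iB: "integrable M (indicator B :: 'a \<Rightarrow> real)"
    using B by (intro integrable_real_indicator) (auto simp: less_top[symmetric])
  have "tsq e * prob B = expectation (\<lambda>\<omega>. tsq e * indicator B \<omega>)" using B by simp
  also have "\<dots> \<le> expectation (\<lambda>\<omega>. tsq (X \<omega>))"
  proof (intro integral_mono integrable_tsq)
    show "integrable M (\<lambda>\<omega>. tsq e * indicator B \<omega>)" by (intro integrable_mult_right iB)
    show "tsq e * indicator B \<omega> \<le> tsq (X \<omega>)" for \<omega>
      using e by (auto simp: B_def ennreal_less_iff intro: tsq_mono split: split_indicator)
  qed simp
  finally show ?thesis using te by (simp add: field_simps B_def)
qed

lemma null_in_probI:
  assumes X: "\<And>k. X k \<in> borel_measurable M" and n: "(\<lambda>k. expectation (\<lambda>\<omega>. tsq (X k \<omega>))) \<longlonglongrightarrow> 0"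
  shows "null_in_prob M (\<lambda>k \<omega>. ennreal \<bar>X k \<omega>\<bar>)"
  unfolding null_in_prob_def
proof (intro conjI allI impI)
  show "(\<lambda>\<omega>. ennreal \<bar>X k \<omega>\<bar>) \<in> borel_measurable M" for k
    using X[of k] by (intro measurable_compose[OF _ measurable_ennreal] borel_measurable_abs)
  fix e :: real assume e: "0 < e"
  have "(\<lambda>k. expectation (\<lambda>\<omega>. tsq (X k \<omega>)) / tsq e) \<longlonglongrightarrow> 0 / tsq e"
    using e by (intro tendsto_divide n tendsto_const) (auto simp: tsq_def min_def split: if_splits)
  then have "(\<lambda>k. expectation (\<lambda>\<omega>. tsq (X k \<omega>)) / tsq e) \<longlonglongrightarrow> 0" by simp
  then show "(\<lambda>k. prob {\<omega> \<in> space M. ennreal e < ennreal \<bar>X k \<omega>\<bar>}) \<longlonglongrightarrow> 0"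
    by (rule tendsto_sandwich[OF _ _ tendsto_const, rotated -1])
      (auto simp del: ennreal_less_iff intro!: always_eventually prob_less_abs_le X e)
qed

lemma expectation_tsq_add_le:
  assumes [measurable]: "X \<in> borel_measurable M" "Y \<in> borel_measurable M"
  shows "expectation (\<lambda>\<omega>. tsq (X \<omega> + Y \<omega>)) \<le> 2 * expectation (\<lambda>\<omega>. tsq (X \<omega>)) + 2 * expectation (\<lambda>\<omega>. tsq (Y \<omega>))"
proof -
  have "expectation (\<lambda>\<omega>. tsq (X \<omega> + Y \<omega>)) \<le> expectation (\<lambda>\<omega>. 2 * tsq (X \<omega>) + 2 * tsq (Y \<omega>))"
    by (intro integral_mono integrable_tsq Bochner_Integration.integrable_add integrable_mult_right)
      (auto intro: tsq_add)
  then show ?thesis by (simp add: integrable_tsq)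
qed

section \<open>The Ito isometry\<close>

lemma simple_integrandD:
  assumes "simple_integrand M F T n \<tau> \<xi>" "i < n"
  shows "0 \<le> \<tau> i" "\<tau> i \<le> \<tau> (Suc i)" "\<tau> (Suc i) \<le> T" "\<xi> i \<in> borel_measurable (F (\<tau> i))"
    "\<xi> i \<in> borel_measurable M" "\<exists>C. \<forall>\<omega>\<in>space M. \<bar>\<xi> i \<omega>\<bar> \<le> C"
proof -
  show *: "0 \<le> \<tau> i" "\<tau> i \<le> \<tau> (Suc i)" "\<tau> (Suc i) \<le> T" "\<xi> i \<in> borel_measurable (F (\<tau> i))"
    "\<exists>C. \<forall>\<omega>\<in>space M. \<bar>\<xi> i \<omega>\<bar> \<le> C"
    using assms by (auto simp: simple_integrand_def)
  show "\<xi> i \<in> borel_measurable M" by (rule measurable_F_M[OF *(4,1)])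
qed

lemma simple_bounded_joint:
  assumes "simple_integrand M F T n \<tau> \<xi>"
  shows "bounded_joint (simple_process n \<tau> \<xi>)"
  unfolding bounded_joint_def
proof
  have "(\<lambda>x. \<Sum>i<n. \<xi> i (snd x) * indicator {\<tau> i<..\<tau> (Suc i)} (fst x)) \<in> borel_measurable (L \<Otimes>\<^sub>M M)"
  proof (intro borel_measurable_sum borel_measurable_times)
    fix i assume "i \<in> {..<n}"
    then show "(\<lambda>x. \<xi> i (snd x)) \<in> borel_measurable (L \<Otimes>\<^sub>M M)"
      using simple_integrandD(5)[OF assms, of i] by (intro measurable_compose[OF measurable_snd]) auto
    have "indicator {\<tau> i<..\<tau> (Suc i)} \<in> borel_measurable L"
      by (intro measurable_restrict_space1) auto
    from measurable_compose[OF measurable_fst this]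
    show "(\<lambda>x. indicator {\<tau> i<..\<tau> (Suc i)} (fst x) :: real) \<in> borel_measurable (L \<Otimes>\<^sub>M M)" .
  qed
  then show "(\<lambda>(u, \<omega>). simple_process n \<tau> \<xi> u \<omega>) \<in> borel_measurable (L \<Otimes>\<^sub>M M)"
    by (simp add: simple_process_def case_prod_unfold)
  have "\<forall>i. \<exists>C. i < n \<longrightarrow> (\<forall>\<omega>\<in>space M. \<bar>\<xi> i \<omega>\<bar> \<le> C)"
    using simple_integrandD(6)[OF assms] by blast
  then obtain C where C: "\<And>i \<omega>. i < n \<Longrightarrow> \<omega> \<in> space M \<Longrightarrow> \<bar>\<xi> i \<omega>\<bar> \<le> C i" by metis
  show "\<exists>C. \<forall>u\<in>{0..T}. \<forall>\<omega>\<in>space M. \<bar>simple_process n \<tau> \<xi> u \<omega>\<bar> \<le> C"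
  proof (intro exI[of _ "\<Sum>i<n. C i"] ballI)
    fix u \<omega> assume w: "\<omega> \<in> space M"
    show "\<bar>simple_process n \<tau> \<xi> u \<omega>\<bar> \<le> (\<Sum>i<n. C i)"
      unfolding simple_process_def
    proof (intro order_trans[OF sum_abs] sum_mono)
      fix i assume "i \<in> {..<n}"
      then show "\<bar>\<xi> i \<omega> * indicator {\<tau> i<..\<tau> (Suc i)} u\<bar> \<le> C i"
        using C[of i \<omega>] w by (auto simp: indicator_def)
    qed
  qed
qed

lemma simple_integral_measurable:
  assumes "simple_integrand M F T n \<tau> \<xi>" "0 \<le> t"
  shows "simple_integral W n \<tau> \<xi> t \<in> borel_measurable M"
  unfolding simple_integral_def[abs_def]
proof (intro borel_measurable_sum borel_measurable_times borel_measurable_diff)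
  fix i assume "i \<in> {..<n}"
  then have i: "i < n" by simp
  note D = simple_integrandD[OF assms(1) i]
  show "\<xi> i \<in> borel_measurable M" by (rule D(5))
  show "W (min (\<tau> (Suc i)) t) \<in> borel_measurable M" "W (min (\<tau> i) t) \<in> borel_measurable M"
    using D(1,2) assms(2) by (auto intro!: W_measurable)
qed

lemma time_integral_simple_square:
  assumes "simple_integrand M F T n \<tau> \<xi>"
  shows "(\<integral>u. (simple_process n \<tau> \<xi> u \<omega>)\<^sup>2 \<partial>L) = (\<Sum>i<n. (\<xi> i \<omega>)\<^sup>2 * (\<tau> (Suc i) - \<tau> i))"
proof -
  note D = simple_integrandD[OF assms]
  have sq: "(simple_process n \<tau> \<xi> u \<omega>)\<^sup>2 = simple_process n \<tau> (\<lambda>i \<omega>. (\<xi> i \<omega>)\<^sup>2) u \<omega>" for u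
    using simple_process_map2[of n \<tau> "\<lambda>x y. x\<^sup>2" \<xi> \<xi> u \<omega>] D(2) by simp
  have "(\<integral>u. (simple_process n \<tau> \<xi> u \<omega>)\<^sup>2 \<partial>L)
     = (\<integral>u. indicator {0..T} u * simple_process n \<tau> (\<lambda>i \<omega>. (\<xi> i \<omega>)\<^sup>2) u \<omega> \<partial>lborel)"
    unfolding sq by (subst integral_restrict_space) auto
  also have "\<dots> = (\<Sum>i<n. (\<xi> i \<omega>)\<^sup>2 * (min (\<tau> (Suc i)) T - min (\<tau> i) T))"
    using integral_simple_process[of n \<tau> T "\<lambda>i \<omega>. (\<xi> i \<omega>)\<^sup>2" \<omega>] D(1,2) T_pos
    by (simp add: has_bochner_integral_iff)
  also have "\<dots> = (\<Sum>i<n. (\<xi> i \<omega>)\<^sup>2 * (\<tau> (Suc i) - \<tau> i))"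
  proof (intro sum.cong refl)
    fix i assume "i \<in> {..<n}"
    then show "(\<xi> i \<omega>)\<^sup>2 * (min (\<tau> (Suc i)) T - min (\<tau> i) T) = (\<xi> i \<omega>)\<^sup>2 * (\<tau> (Suc i) - \<tau> i)"
      using D(2,3)[of i] by simp
  qed
  finally show ?thesis .
qed

lemma increment_adapted:
  assumes "0 \<le> a" "a \<le> b" "0 \<le> t"
  shows "(\<lambda>\<omega>. W (min b t) \<omega> - W (min a t) \<omega>) \<in> borel_measurable (F b)"
  using measurable_F_mono[OF W_adapted[of "min b t"], of b] measurable_F_mono[OF W_adapted[of "min a t"], of b] assms
  by auto

text \<open>The increments stopped at \<open>t\<close> are orthogonal; on an interval that lies beyond \<open>t\<close> both the increment and
  its variance vanish.\<close>
lemma simple_isometry: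
  assumes \<xi>: "simple_integrand M F T n \<tau> \<xi>" and t: "0 \<le> t"
  shows "has_bochner_integral M (\<lambda>\<omega>. (simple_integral W n \<tau> \<xi> t \<omega>)\<^sup>2)
    (\<Sum>i<n. expectation (\<lambda>\<omega>. (\<xi> i \<omega>)\<^sup>2) * (min (\<tau> (Suc i)) t - min (\<tau> i) t))"
proof -
  note D = simple_integrandD[OF \<xi>]
  have U: "U \<in> borel_measurable (F (min (\<tau> i) t))"
    if "U \<in> borel_measurable (F (\<tau> i))" "min (\<tau> i) t < min (\<tau> (Suc i)) t" for U :: "'a \<Rightarrow> real" and i
  proof -
    have "min (\<tau> i) t = \<tau> i" using that(2) by auto
    with that show ?thesis by simp
  qed
  show ?thesis
    unfolding simple_integral_def
  proof (rule orthogonal_sum[where s = \<tau>, THEN conjunct2])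
    fix i assume i: "i < n"
    show "0 \<le> \<tau> i \<and> \<tau> i \<le> \<tau> (Suc i)" using D(1,2) i by auto
    show "\<xi> i \<in> borel_measurable (F (\<tau> i)) \<and> (\<exists>C. \<forall>\<omega>\<in>space M. \<bar>\<xi> i \<omega>\<bar> \<le> C)" using D(4,6) i by auto
    show "(\<lambda>\<omega>. W (min (\<tau> (Suc i)) t) \<omega> - W (min (\<tau> i) t) \<omega>) \<in> borel_measurable (F (\<tau> (Suc i)))"
      by (rule increment_adapted) (use D(1,2) i t in auto)
    have ab: "0 \<le> min (\<tau> i) t" "min (\<tau> i) t \<le> min (\<tau> (Suc i)) t" using D(1,2)[OF i] t by auto
    fix U :: "'a \<Rightarrow> real" assume Um: "U \<in> borel_measurable (F (\<tau> i))" "integrable M U"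
    show "has_bochner_integral M (\<lambda>\<omega>. U \<omega> * (W (min (\<tau> (Suc i)) t) \<omega> - W (min (\<tau> i) t) \<omega>)) 0"
      "has_bochner_integral M (\<lambda>\<omega>. U \<omega> * (W (min (\<tau> (Suc i)) t) \<omega> - W (min (\<tau> i) t) \<omega>)\<^sup>2)
        (expectation U * (min (\<tau> (Suc i)) t - min (\<tau> i) t))"
      by (rule increment_moments[OF ab U[OF Um(1)] Um(2)]; assumption)+
  qed
qed

lemma
  assumes \<xi>: "simple_integrand M F T n \<tau> \<xi>" and t: "0 \<le> t"
  shows simple_integral_square_integrable: "integrable M (\<lambda>\<omega>. (simple_integral W n \<tau> \<xi> t \<omega>)\<^sup>2)"
    and simple_integral_square_le: "expectation (\<lambda>\<omega>. (simple_integral W n \<tau> \<xi> t \<omega>)\<^sup>2)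
      \<le> expectation (\<lambda>\<omega>. \<integral>u. (simple_process n \<tau> \<xi> u \<omega>)\<^sup>2 \<partial>L)"
proof -
  note D = simple_integrandD[OF \<xi>]
  have i2: "integrable M (\<lambda>\<omega>. (\<xi> i \<omega>)\<^sup>2)" if i: "i < n" for i
  proof -
    obtain C where C: "\<forall>\<omega>\<in>space M. \<bar>\<xi> i \<omega>\<bar> \<le> C" using D(6)[OF i] by auto
    show ?thesis
    proof (intro integrable_const_bound[where B = "C\<^sup>2"] AE_I2)
      fix \<omega> assume "\<omega> \<in> space M"
      then have "\<bar>\<xi> i \<omega>\<bar>\<^sup>2 \<le> C\<^sup>2" using C by (intro power_mono) auto
      then show "norm ((\<xi> i \<omega>)\<^sup>2) \<le> C\<^sup>2" by simp
    qed (use D(5)[OF i] in measurable)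
  qed
  show "integrable M (\<lambda>\<omega>. (simple_integral W n \<tau> \<xi> t \<omega>)\<^sup>2)"
    using simple_isometry[OF assms] by (simp add: has_bochner_integral_iff)
  have "expectation (\<lambda>\<omega>. (simple_integral W n \<tau> \<xi> t \<omega>)\<^sup>2)
    = (\<Sum>i<n. expectation (\<lambda>\<omega>. (\<xi> i \<omega>)\<^sup>2) * (min (\<tau> (Suc i)) t - min (\<tau> i) t))"
    using simple_isometry[OF assms] by (simp add: has_bochner_integral_iff)
  also have "\<dots> \<le> (\<Sum>i<n. expectation (\<lambda>\<omega>. (\<xi> i \<omega>)\<^sup>2) * (\<tau> (Suc i) - \<tau> i))"
  proof (intro sum_mono mult_left_mono)
    fix i assume "i \<in> {..<n}"
    then show "min (\<tau> (Suc i)) t - min (\<tau> i) t \<le> \<tau> (Suc i) - \<tau> i" using D(2)[of i] by (simp add: min_def)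
  qed simp
  also have "\<dots> = expectation (\<lambda>\<omega>. \<Sum>i<n. (\<xi> i \<omega>)\<^sup>2 * (\<tau> (Suc i) - \<tau> i))"
    using i2 by (subst Bochner_Integration.integral_sum) auto
  also have "\<dots> = expectation (\<lambda>\<omega>. \<integral>u. (simple_process n \<tau> \<xi> u \<omega>)\<^sup>2 \<partial>L)"
    by (simp add: time_integral_simple_square[OF \<xi>])
  finally show "expectation (\<lambda>\<omega>. (simple_integral W n \<tau> \<xi> t \<omega>)\<^sup>2)
      \<le> expectation (\<lambda>\<omega>. \<integral>u. (simple_process n \<tau> \<xi> u \<omega>)\<^sup>2 \<partial>L)" .
qed

text \<open>Convergence in probability of the integrands carries over to the integrals by truncation.  The
  coefficients are set to 0 as soon as the accumulated integral of the square exceeds \<open>e\<close>.  The truncated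
  coefficients \<open>\<zeta>\<close> are still adapted, their integral has second moment at most \<open>e\<close> by the isometry, and they
  differ from \<open>\<xi>\<close> only on the event on the right-hand side.\<close>
lemma simple_integral_tsq_le:
  assumes \<xi>: "simple_integrand M F T n \<tau> \<xi>" and t: "0 \<le> t" and e: "0 < e"
  shows "expectation (\<lambda>\<omega>. tsq (simple_integral W n \<tau> \<xi> t \<omega>))
    \<le> e + prob {\<omega> \<in> space M. e < (\<integral>u. (simple_process n \<tau> \<xi> u \<omega>)\<^sup>2 \<partial>L)}"
proof -
  note D = simple_integrandD[OF \<xi>]
  define q where "q = (\<lambda>i \<omega>. (\<xi> i \<omega>)\<^sup>2 * (\<tau> (Suc i) - \<tau> i))"
  define Q where "Q = (\<lambda>i \<omega>. \<Sum>j<i. q j \<omega>)"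
  define \<zeta> where "\<zeta> = (\<lambda>i \<omega>. if Q (Suc i) \<omega> \<le> e then \<xi> i \<omega> else 0)"
  have q0: "0 \<le> q i \<omega>" if "i < n" for i \<omega> using D(2)[OF that] by (simp add: q_def)
  have Qmono: "Q i \<omega> \<le> Q n \<omega>" if "i \<le> n" for i \<omega>
    unfolding Q_def using that q0 by (intro sum_mono2) auto
  have \<zeta>: "simple_integrand M F T n \<tau> \<zeta>"
    unfolding simple_integrand_def
  proof (intro allI impI conjI D)
    fix i assume i: "i < n"
    have "\<xi> j \<in> borel_measurable (F (\<tau> i))" if "j < Suc i" for j
    proof -
      have j: "j < n" "j \<le> i" using that i by auto
      have "\<tau> j \<le> \<tau> i" using monotone_upto[where n = n and \<tau> = \<tau> and i = j and j = i] D(2) j i by auto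
      then show ?thesis by (rule measurable_F_mono[OF D(4)[OF j(1)]])
    qed
    then have "Q (Suc i) \<in> borel_measurable (F (\<tau> i))" unfolding Q_def q_def
      by (intro borel_measurable_sum borel_measurable_times borel_measurable_power borel_measurable_const) auto
    then show "\<zeta> i \<in> borel_measurable (F (\<tau> i))"
      unfolding \<zeta>_def using D(4)[OF i] by measurable
    show "\<exists>C. \<forall>\<omega>\<in>space M. \<bar>\<zeta> i \<omega>\<bar> \<le> C"
      using D(6)[OF i] unfolding \<zeta>_def by (metis (full_types) abs_ge_zero abs_zero order_trans)
  qed
  have \<zeta>Q: "(\<Sum>i<m. (\<zeta> i \<omega>)\<^sup>2 * (\<tau> (Suc i) - \<tau> i)) \<le> min e (Q m \<omega>)" if "m \<le> n" for m \<omega>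
    using that
  proof (induction m)
    case (Suc m)
    then have IH: "(\<Sum>i<m. (\<zeta> i \<omega>)\<^sup>2 * (\<tau> (Suc i) - \<tau> i)) \<le> min e (Q m \<omega>)" by simp
    have "Q (Suc m) \<omega> = Q m \<omega> + q m \<omega>" by (simp add: Q_def)
    moreover have "0 \<le> q m \<omega>" using q0 Suc.prems by simp
    ultimately show ?case using IH by (auto simp: \<zeta>_def q_def)
  qed (use e in \<open>simp add: Q_def\<close>)
  have Qn: "(\<integral>u. (simple_process n \<tau> \<xi> u \<omega>)\<^sup>2 \<partial>L) = Q n \<omega>" for \<omega>
    by (simp add: time_integral_simple_square[OF \<xi>] Q_def q_def)
  have eq: "simple_integral W n \<tau> \<zeta> t \<omega> = simple_integral W n \<tau> \<xi> t \<omega>" if "Q n \<omega> \<le> e" for \<omega>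
    unfolding simple_integral_def
  proof (intro sum.cong refl)
    fix i assume "i \<in> {..<n}"
    then have "Q (Suc i) \<omega> \<le> e" using Qmono[of "Suc i" \<omega>] that by simp
    then show "\<zeta> i \<omega> * (W (min (\<tau> (Suc i)) t) \<omega> - W (min (\<tau> i) t) \<omega>)
      = \<xi> i \<omega> * (W (min (\<tau> (Suc i)) t) \<omega> - W (min (\<tau> i) t) \<omega>)" by (simp add: \<zeta>_def)
  qed
  have Qm: "{\<omega> \<in> space M. e < Q n \<omega>} \<in> events"
  proof -
    have "Q n \<in> borel_measurable M" unfolding Q_def q_def
      using D(5) by (intro borel_measurable_sum borel_measurable_times borel_measurable_power borel_measurable_const) auto
    then show ?thesis by measurable
  qed
  have "expectation (\<lambda>\<omega>. (simple_integral W n \<tau> \<zeta> t \<omega>)\<^sup>2)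
     \<le> expectation (\<lambda>\<omega>. \<integral>u. (simple_process n \<tau> \<zeta> u \<omega>)\<^sup>2 \<partial>L)"
    by (rule simple_integral_square_le[OF \<zeta> t])
  also have "\<dots> \<le> expectation (\<lambda>\<omega>. e)"
    using \<zeta>Q[of n]
    by (intro integral_mono integrable_time_integral bounded_joint_intros simple_bounded_joint[OF \<zeta>])
      (auto simp: time_integral_simple_square[OF \<zeta>])
  also have "\<dots> = e" by (simp add: prob_space)
  finally have 1: "expectation (\<lambda>\<omega>. (simple_integral W n \<tau> \<zeta> t \<omega>)\<^sup>2) \<le> e" .
  define B where "B = {\<omega> \<in> space M. e < Q n \<omega>}"
  have B: "B \<in> events" using Qm by (simp add: B_def)
  have iB: "integrable M (indicator B :: 'a \<Rightarrow> real)"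
    using B by (intro integrable_real_indicator) (auto simp: less_top[symmetric])
  have "expectation (\<lambda>\<omega>. tsq (simple_integral W n \<tau> \<xi> t \<omega>))
    \<le> expectation (\<lambda>\<omega>. (simple_integral W n \<tau> \<zeta> t \<omega>)\<^sup>2 + indicator B \<omega>)"
  proof (intro integral_mono integrable_tsq simple_integral_measurable[OF \<xi> t]
      Bochner_Integration.integrable_add simple_integral_square_integrable[OF \<zeta> t] iB)
    fix \<omega> assume w: "\<omega> \<in> space M"
    show "tsq (simple_integral W n \<tau> \<xi> t \<omega>) \<le> (simple_integral W n \<tau> \<zeta> t \<omega>)\<^sup>2 + indicator B \<omega>"
    proof (cases "Q n \<omega> \<le> e")
      case True
      then show ?thesis using tsq_le_square[of "simple_integral W n \<tau> \<xi> t \<omega>"] eq[OF True]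
        by (simp add: B_def)
    next
      case False
      then have "indicator B \<omega> = (1::real)" using w by (simp add: B_def)
      then show ?thesis using tsq_le_1[of "simple_integral W n \<tau> \<xi> t \<omega>"]
        zero_le_power2[of "simple_integral W n \<tau> \<zeta> t \<omega>"] by linarith
    qed
  qed
  also have "\<dots> = expectation (\<lambda>\<omega>. (simple_integral W n \<tau> \<zeta> t \<omega>)\<^sup>2) + prob B"
    using B by (subst Bochner_Integration.integral_add[OF simple_integral_square_integrable[OF \<zeta> t] iB]) simp
  finally show ?thesis using 1 by (simp add: Qn B_def)
qed

section \<open>Removing the random drift from the integrator\<close>

lemma nn_integral_sqdist:
  assumes H: "bounded_joint H" and \<xi>: "simple_integrand M F T n \<tau> \<xi>" and w: "\<omega> \<in> space M"
  shows "(\<integral>\<^sup>+s\<in>{0..T}. ennreal ((simple_process n \<tau> \<xi> s \<omega> - H s \<omega>)\<^sup>2) \<partial>lborel)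
     = ennreal (\<integral>u. (simple_process n \<tau> \<xi> u \<omega> - H u \<omega>)\<^sup>2 \<partial>L)"
proof -
  have "(\<integral>\<^sup>+s\<in>{0..T}. ennreal ((simple_process n \<tau> \<xi> s \<omega> - H s \<omega>)\<^sup>2) \<partial>lborel)
    = (\<integral>\<^sup>+s. ennreal ((simple_process n \<tau> \<xi> s \<omega> - H s \<omega>)\<^sup>2) \<partial>L)"
    by (subst nn_integral_restrict_space) auto
  also have "\<dots> = ennreal (\<integral>u. (simple_process n \<tau> \<xi> u \<omega> - H u \<omega>)\<^sup>2 \<partial>L)"
    using bounded_joint_integrable_L[OF bounded_joint_power2[OF bounded_joint_diff[OF simple_bounded_joint[OF \<xi>] H]] w]
    by (intro nn_integral_eq_integral) auto
  finally show ?thesis .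
qed

lemma sqdist_prob_tendsto:
  assumes H: "bounded_joint H" and \<xi>: "\<And>k. simple_integrand M F T (n k) (\<tau> k) (\<xi> k)"
    and null: "null_in_prob M (\<lambda>k \<omega>. \<integral>\<^sup>+s\<in>{0..T}.
          ennreal ((simple_process (n k) (\<tau> k) (\<xi> k) s \<omega> - H s \<omega>)\<^sup>2) \<partial>lborel)"
    and e: "0 < e"
  shows "(\<lambda>k. prob {\<omega> \<in> space M. e < (\<integral>u. (simple_process (n k) (\<tau> k) (\<xi> k) u \<omega> - H u \<omega>)\<^sup>2 \<partial>L)}) \<longlonglongrightarrow> 0"
proof -
  have "{\<omega> \<in> space M. e < (\<integral>u. (simple_process (n k) (\<tau> k) (\<xi> k) u \<omega> - H u \<omega>)\<^sup>2 \<partial>L)}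
    = {\<omega> \<in> space M. ennreal e < (\<integral>\<^sup>+s\<in>{0..T}.
          ennreal ((simple_process (n k) (\<tau> k) (\<xi> k) s \<omega> - H s \<omega>)\<^sup>2) \<partial>lborel)}" for k
    using e by (auto simp: nn_integral_sqdist[OF H \<xi>] ennreal_less_iff)
  with null e show ?thesis by (simp add: null_in_prob_def)
qed

lemma sqdist_measurable:
  assumes "bounded_joint H" "simple_integrand M F T n \<tau> \<xi>"
  shows "(\<lambda>\<omega>. \<integral>u. (simple_process n \<tau> \<xi> u \<omega> - H u \<omega>)\<^sup>2 \<partial>L) \<in> borel_measurable M"
  by (intro borel_measurable_integrable integrable_time_integral bounded_joint_intros simple_bounded_joint assms)

text \<open>Integrals of simple integrands with respect to \<open>B * t + W t\<close> and to \<open>W t\<close> differ by \<open>B\<close> times an integral over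
  time, and the latter converges by the Cauchy-Schwarz inequality.\<close>
lemma stoch_integral_drift_removal:
  assumes I: "stoch_integral M F T (bernoulli_noise B W) H I"
    and B: "B \<in> borel_measurable M" and \<beta>: "AE \<omega> in M. \<bar>B \<omega>\<bar> \<le> \<beta>"
    and H: "\<And>u \<omega>. u \<in> {0..T} \<Longrightarrow> \<omega> \<in> space M \<Longrightarrow> \<bar>H u \<omega>\<bar> \<le> K"
  shows "stoch_integral M F T W H (\<lambda>t \<omega>. I t \<omega> - B \<omega> * (LINT s:{0..t}|lborel. H s \<omega>))"
proof -
  let ?X = "bernoulli_noise B W"
  from I obtain n \<tau> \<xi> where prog: "progressive F T H" and Im: "\<And>t. t \<in> {0..T} \<Longrightarrow> I t \<in> borel_measurable M"
    and Ic: "AE \<omega> in M. continuous_on {0..T} (\<lambda>t. I t \<omega>)"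
    and \<xi>: "\<And>k. simple_integrand M F T (n k) (\<tau> k) (\<xi> k)"
    and null: "null_in_prob M (\<lambda>k \<omega>. \<integral>\<^sup>+s\<in>{0..T}.
          ennreal ((simple_process (n k) (\<tau> k) (\<xi> k) s \<omega> - H s \<omega>)\<^sup>2) \<partial>lborel)"
    and nullX: "\<And>t. t \<in> {0..T} \<Longrightarrow> null_in_prob M (\<lambda>k \<omega>.
          ennreal \<bar>simple_integral ?X (n k) (\<tau> k) (\<xi> k) t \<omega> - I t \<omega>\<bar>)"
    unfolding stoch_integral_def by blast
  have bH: "bounded_joint H" by (rule bounded_jointI[OF prog H])
  define A where "A = (\<lambda>k t \<omega>. (LINT s:{0..t}|lborel. simple_process (n k) (\<tau> k) (\<xi> k) s \<omega> - H s \<omega>))"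
  define sq where "sq = (\<lambda>k \<omega>. \<integral>u. (simple_process (n k) (\<tau> k) (\<xi> k) u \<omega> - H u \<omega>)\<^sup>2 \<partial>L)"
  have bd: "bounded_joint (\<lambda>u \<omega>. simple_process (n k) (\<tau> k) (\<xi> k) u \<omega> - H u \<omega>)" for k
    by (intro bounded_joint_intros simple_bounded_joint[OF \<xi>] bH)
  have Am: "A k t \<in> borel_measurable M" if "t \<in> {0..T}" for k t
    unfolding A_def by (rule time_integral_measurable[OF bd that])
  have sqm: "sq k \<in> borel_measurable M" for k
    unfolding sq_def by (rule sqdist_measurable[OF bH \<xi>])
  have Asq: "(A k t \<omega>)\<^sup>2 \<le> T * sq k \<omega>" if "t \<in> {0..T}" "\<omega> \<in> space M" for k t \<omega>
    unfolding A_def sq_def by (rule time_integral_square_le[OF bd that(2,1)])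
  have Xm: "(\<lambda>\<omega>. simple_integral ?X (n k) (\<tau> k) (\<xi> k) t \<omega>) \<in> borel_measurable M" if t: "t \<in> {0..T}" for k t
    unfolding simple_integral_bernoulli_noise
    using B simple_integral_measurable[OF \<xi>, of t k] simple_integrandD(5)[OF \<xi>] t
    by (intro borel_measurable_add borel_measurable_times borel_measurable_sum) auto
  have key: "simple_integral W (n k) (\<tau> k) (\<xi> k) t \<omega> - (I t \<omega> - B \<omega> * (LINT s:{0..t}|lborel. H s \<omega>))
      = (simple_integral ?X (n k) (\<tau> k) (\<xi> k) t \<omega> - I t \<omega>) + - (B \<omega> * A k t \<omega>)"
    if t: "t \<in> {0..T}" and w: "\<omega> \<in> space M" for k t \<omega>
  proof -
    have "set_integrable lborel {0..t} (\<lambda>s. simple_process (n k) (\<tau> k) (\<xi> k) s \<omega>)"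
      using t by (intro set_integrable_subset[OF bounded_joint_set_integrable[OF simple_bounded_joint[OF \<xi>] w]]) auto
    moreover have "set_integrable lborel {0..t} (\<lambda>s. H s \<omega>)"
      using t by (intro set_integrable_subset[OF bounded_joint_set_integrable[OF bH w]]) auto
    ultimately have "A k t \<omega> = (LINT s:{0..t}|lborel. simple_process (n k) (\<tau> k) (\<xi> k) s \<omega>) - (LINT s:{0..t}|lborel. H s \<omega>)"
      unfolding A_def by (rule set_integral_diff(2))
    also have "(LINT s:{0..t}|lborel. simple_process (n k) (\<tau> k) (\<xi> k) s \<omega>)
       = (\<Sum>i<n k. \<xi> k i \<omega> * (min (\<tau> k (Suc i)) t - min (\<tau> k i) t))"
      using integral_simple_process[of "n k" "\<tau> k" t "\<xi> k" \<omega>] simple_integrandD(1,2)[OF \<xi>[of k]] t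
      by (simp add: has_bochner_integral_iff set_lebesgue_integral_def)
    finally have eq: "(\<Sum>i<n k. \<xi> k i \<omega> * (min (\<tau> k (Suc i)) t - min (\<tau> k i) t))
      = A k t \<omega> + (LINT s:{0..t}|lborel. H s \<omega>)" by simp
    show ?thesis unfolding simple_integral_bernoulli_noise eq by (simp add: algebra_simps)
  qed
  show ?thesis
    unfolding stoch_integral_def
  proof (intro conjI ballI exI[of _ n] exI[of _ \<tau>] exI[of _ \<xi>] allI prog \<xi> null)
    fix t assume t: "t \<in> {0..T}"
    show Jm: "(\<lambda>\<omega>. I t \<omega> - B \<omega> * (LINT s:{0..t}|lborel. H s \<omega>)) \<in> borel_measurable M"
      by (intro borel_measurable_diff borel_measurable_times Im t B time_integral_measurable[OF bH])
    show "null_in_prob M (\<lambda>k \<omega>. ennreal \<bar>simple_integral W (n k) (\<tau> k) (\<xi> k) t \<omega>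
        - (I t \<omega> - B \<omega> * (LINT s:{0..t}|lborel. H s \<omega>))\<bar>)"
    proof (rule null_in_probI)
      show "(\<lambda>\<omega>. simple_integral W (n k) (\<tau> k) (\<xi> k) t \<omega> - (I t \<omega> - B \<omega> * (LINT s:{0..t}|lborel. H s \<omega>)))
         \<in> borel_measurable M" for k
        using t by (intro borel_measurable_diff[OF _ Jm] simple_integral_measurable[OF \<xi>]) auto
      let ?a = "\<lambda>k. expectation (\<lambda>\<omega>. tsq (simple_integral ?X (n k) (\<tau> k) (\<xi> k) t \<omega> - I t \<omega>))"
      let ?b = "\<lambda>k. expectation (\<lambda>\<omega>. tsq (- (B \<omega> * A k t \<omega>)))"
      have m: "(\<lambda>\<omega>. simple_integral ?X (n k) (\<tau> k) (\<xi> k) t \<omega> - I t \<omega>) \<in> borel_measurable M"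
        "(\<lambda>\<omega>. - (B \<omega> * A k t \<omega>)) \<in> borel_measurable M" for k
        using Xm Im Am B t by auto
      have a0: "?a \<longlonglongrightarrow> 0" by (rule expectation_tsq_tendsto[OF m(1) nullX[OF t]])
      have b0: "?b \<longlonglongrightarrow> 0"
      proof (rule tendsto_zero_by_bounds)
        fix e :: real assume e: "0 < e"
        define b where "b = (\<beta>\<^sup>2 + 1) * T"
        define c where "c = e / b"
        have bp: "0 < b" using T_pos by (simp add: b_def add_nonneg_pos)
        have c: "0 < c" using e bp by (simp add: c_def)
        have "b * c = e" using bp by (simp add: c_def)
        then have cT: "(\<beta>\<^sup>2 + 1) * (T * c) = e" by (simp add: b_def)
        have "?b k \<le> e + 1 * prob {\<omega> \<in> space M. c < sq k \<omega>}" for k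
        proof (intro expectation_le_prob integrable_tsq m)
          show "{\<omega> \<in> space M. c < sq k \<omega>} \<in> events" using sqm[of k] by measurable
          show "AE \<omega> in M. tsq (- (B \<omega> * A k t \<omega>)) \<le> (if c < sq k \<omega> then 1 else e)"
            using \<beta> AE_space
          proof eventually_elim
            case (elim \<omega>)
            show ?case
            proof (cases "c < sq k \<omega>")
              case False
              have B2: "(B \<omega>)\<^sup>2 \<le> \<beta>\<^sup>2 + 1"
                using power_mono[OF elim(1), of 2] by simp
              have "T * sq k \<omega> \<le> T * c" using False T_pos by simp
              then have A2: "(A k t \<omega>)\<^sup>2 \<le> T * c" using Asq[OF t elim(2), of k] by linarith
              have "tsq (- (B \<omega> * A k t \<omega>)) \<le> (B \<omega>)\<^sup>2 * (A k t \<omega>)\<^sup>2"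
                using tsq_le_square[of "B \<omega> * A k t \<omega>"] by (simp add: power_mult_distrib)
              also have "\<dots> \<le> (\<beta>\<^sup>2 + 1) * (T * c)"
                using B2 A2 by (intro mult_mono) auto
              finally show ?thesis using False cT by simp
            qed simp
          qed
        qed (use e in auto)
        moreover have "(\<lambda>k. prob {\<omega> \<in> space M. c < sq k \<omega>}) \<longlonglongrightarrow> 0"
          unfolding sq_def by (rule sqdist_prob_tendsto[OF bH \<xi> null c])
        ultimately show "\<exists>p. (\<forall>k. ?b k \<le> e + p k) \<and> p \<longlonglongrightarrow> 0"
          by (intro exI[of _ "\<lambda>k. prob {\<omega> \<in> space M. c < sq k \<omega>}"]) simp
      qed simp
      have lim: "(\<lambda>k. 2 * ?a k + 2 * ?b k) \<longlonglongrightarrow> 0"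
        using tendsto_add[OF tendsto_mult_right_zero[OF a0, of 2] tendsto_mult_right_zero[OF b0, of 2]] by simp
      show "(\<lambda>k. expectation (\<lambda>\<omega>. tsq (simple_integral W (n k) (\<tau> k) (\<xi> k) t \<omega>
         - (I t \<omega> - B \<omega> * (LINT s:{0..t}|lborel. H s \<omega>))))) \<longlonglongrightarrow> 0"
      proof (rule tendsto_sandwich[OF _ _ tendsto_const lim]; intro always_eventually allI)
        fix k
        have "expectation (\<lambda>\<omega>. tsq (simple_integral W (n k) (\<tau> k) (\<xi> k) t \<omega>
           - (I t \<omega> - B \<omega> * (LINT s:{0..t}|lborel. H s \<omega>))))
          = expectation (\<lambda>\<omega>. tsq ((simple_integral ?X (n k) (\<tau> k) (\<xi> k) t \<omega> - I t \<omega>) + - (B \<omega> * A k t \<omega>)))"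
          by (intro Bochner_Integration.integral_cong refl arg_cong[where f = tsq] key t)
        also have "\<dots> \<le> 2 * ?a k + 2 * ?b k" by (rule expectation_tsq_add_le[OF m])
        finally show "expectation (\<lambda>\<omega>. tsq (simple_integral W (n k) (\<tau> k) (\<xi> k) t \<omega>
           - (I t \<omega> - B \<omega> * (LINT s:{0..t}|lborel. H s \<omega>)))) \<le> 2 * ?a k + 2 * ?b k" .
      qed simp
    qed
  next
    show "AE \<omega> in M. continuous_on {0..T} (\<lambda>t. I t \<omega> - B \<omega> * (LINT s:{0..t}|lborel. H s \<omega>))"
      using Ic AE_space
    proof eventually_elim
      case (elim \<omega>)
      from continuous_on_time_integral[OF bounded_joint_set_integrable[OF bH elim(2)]] elim(1)
      show ?case by (intro continuous_intros)
    qed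
  qed
qed

end

section \<open>Uniform approximation of integrals of bounded integrands\<close>

text \<open>The multiples of \<open>T / m\<close>, with \<open>T / m \<le> \<delta>\<close>, are added to \<open>Q\<close>: every grid point before \<open>T\<close> is then followed
  by another one no later than the next multiple.\<close>
lemma grid_with_mesh:
  assumes T: "0 < T" and \<delta>: "0 < \<delta>" and Q: "finite Q" "Q \<subseteq> {0..T}"
  shows "\<exists>N s P. grid T N s P \<and> Q \<subseteq> P \<and> P \<subseteq> {0..T} \<and> (\<forall>i<N. s (Suc i) - s i \<le> \<delta>)"
proof -
  define m where "m = nat \<lceil>T / \<delta>\<rceil> + 1"
  have m: "0 < real m" by (simp add: m_def)
  have "T / \<delta> \<le> m" unfolding m_def by linarith
  then have Tm: "T / m \<le> \<delta>" using \<delta> m by (simp add: field_simps)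
  define R where "R = (\<lambda>j. real j * T / m) ` {..m}"
  have R: "finite R" "R \<subseteq> {0..T}" using T m by (auto simp: R_def field_simps)
  have "0 \<in> R" unfolding R_def by (intro image_eqI[of _ _ 0]) auto
  moreover have "T \<in> R" unfolding R_def using m by (intro image_eqI[of _ _ m]) auto
  ultimately have "finite (Q \<union> R)" "Q \<union> R \<subseteq> {0..T}" "0 \<in> Q \<union> R" "T \<in> Q \<union> R" using Q R by auto
  from grid_exists[OF this] obtain N s where g: "grid T N s (Q \<union> R)" by auto
  have lt: "s i < s j" if "i < j" "j \<le> N" for i j using g that by (auto simp: grid_def)
  have "s (Suc i) - s i \<le> \<delta>" if i: "i < N" for i
  proof -
    have "s i \<in> Q \<union> R" using g i by (auto simp: grid_def)
    then have si: "0 \<le> s i" using Q(2) R(2) by auto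
    have "s i < T" using lt[of i N] i g by (simp add: grid_def)
    define j where "j = nat \<lfloor>s i * m / T\<rfloor>"
    have j: "real j \<le> s i * m / T" "s i * m / T < real j + 1"
      using si T m by (auto simp: j_def)
    have "s i * m / T < m" using \<open>s i < T\<close> T m by (simp add: field_simps)
    then have "Suc j \<le> m" using j(1) by linarith
    then have "real (Suc j) * T / m \<in> Q \<union> R" unfolding R_def by blast
    also have "Q \<union> R = s ` {..N}" using g by (simp add: grid_def)
    finally obtain q where q: "q \<le> N" "real (Suc j) * T / m = s q" by blast
    have "s i < s q" unfolding q(2)[symmetric] using j(2) T m by (simp add: field_simps)
    then have "i < q" using lt[of q i] i by (cases q i rule: linorder_cases) auto
    then have "s (Suc i) \<le> s q" using lt[of "Suc i" q] q(1) by (cases "Suc i = q") auto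
    also have "\<dots> \<le> s i + T / m"
      unfolding q(2)[symmetric] using j(1) T m by (simp add: field_simps)
    finally show ?thesis using Tm by linarith
  qed
  then show ?thesis using g Q R by (intro exI[of _ N] exI[of _ s] exI[of _ "Q \<union> R"]) auto
qed

context wiener_horizon
begin

definition partition_points :: "nat \<Rightarrow> (nat \<Rightarrow> real) \<Rightarrow> real set" where
  "partition_points n \<tau> = (\<Union>i<n. {\<tau> i, \<tau> (Suc i)})"

lemma partition_points:
  assumes "simple_integrand M F T n \<tau> \<xi>"
  shows "finite (partition_points n \<tau>)" "partition_points n \<tau> \<subseteq> {0..T}"
proof -
  have "\<tau> i \<in> {0..T} \<and> \<tau> (Suc i) \<in> {0..T}" if "i < n" for i
    using simple_integrandD(1,2,3)[OF assms that] by auto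
  then show "finite (partition_points n \<tau>)" "partition_points n \<tau> \<subseteq> {0..T}"
    by (auto simp: partition_points_def)
qed

lemma refine_to_grid:
  assumes \<xi>: "simple_integrand M F T n \<tau> \<xi>" and g: "grid T N s P" "P \<subseteq> {0..T}" "partition_points n \<tau> \<subseteq> P"
  defines "v \<equiv> \<lambda>j. simple_process n \<tau> \<xi> (s (Suc j))"
  shows "simple_integrand M F T N s v" "simple_process N s v u \<omega> = simple_process n \<tau> \<xi> u \<omega>"
    "simple_integral X N s v t \<omega> = simple_integral X n \<tau> \<xi> t \<omega>"
proof -
  have \<tau>: "\<tau> i \<in> P \<and> \<tau> (Suc i) \<in> P \<and> \<tau> i \<le> \<tau> (Suc i)" if "i < n" for i
    using that g(3) simple_integrandD(2)[OF \<xi> that] by (auto simp: partition_points_def)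
  show "simple_integrand M F T N s v"
    unfolding v_def by (rule refine_simple_integrand[OF g(1,2) \<tau> \<xi>]) (auto intro: filtered_prob_space_axioms)
  show "simple_process N s v u \<omega> = simple_process n \<tau> \<xi> u \<omega>"
    unfolding v_def by (rule refine_simple_process[where n = n and \<tau> = \<tau>, OF g(1) \<tau>])
  show "simple_integral X N s v t \<omega> = simple_integral X n \<tau> \<xi> t \<omega>"
    unfolding v_def by (rule refine_simple_integral[where n = n and \<tau> = \<tau>, OF g(1) \<tau>])
qed

lemma simple_integrand_diff:
  assumes "simple_integrand M F T n \<tau> \<xi>" "simple_integrand M F T n \<tau> \<zeta>"
  shows "simple_integrand M F T n \<tau> (\<lambda>i \<omega>. \<xi> i \<omega> - \<zeta> i \<omega>)"
  unfolding simple_integrand_def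
proof (intro allI impI conjI)
  fix i assume i: "i < n"
  note X = simple_integrandD[OF assms(1) i] and Z = simple_integrandD[OF assms(2) i]
  show "0 \<le> \<tau> i" "\<tau> i \<le> \<tau> (Suc i)" "\<tau> (Suc i) \<le> T" by (rule X)+
  show "(\<lambda>\<omega>. \<xi> i \<omega> - \<zeta> i \<omega>) \<in> borel_measurable (F (\<tau> i))" by (intro borel_measurable_diff X Z)
  obtain C D where "\<forall>\<omega>\<in>space M. \<bar>\<xi> i \<omega>\<bar> \<le> C" "\<forall>\<omega>\<in>space M. \<bar>\<zeta> i \<omega>\<bar> \<le> D" using X(6) Z(6) by auto
  then have "\<forall>\<omega>\<in>space M. \<bar>\<xi> i \<omega> - \<zeta> i \<omega>\<bar> \<le> C + D" by (metis abs_triangle_ineq4 add_mono order_trans)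
  then show "\<exists>C. \<forall>\<omega>\<in>space M. \<bar>\<xi> i \<omega> - \<zeta> i \<omega>\<bar> \<le> C" by blast
qed

lemma simple_process_diff:
  assumes "simple_integrand M F T n \<tau> \<xi>"
  shows "simple_process n \<tau> (\<lambda>i \<omega>. \<xi> i \<omega> - \<zeta> i \<omega>) u \<omega>
    = simple_process n \<tau> \<xi> u \<omega> - simple_process n \<tau> \<zeta> u \<omega>"
  using simple_process_map2[of n \<tau> "(-)" \<xi> \<zeta> u \<omega>] simple_integrandD(2)[OF assms] by simp

text \<open>On a common refinement of both partitions the isometry applies to the difference.\<close>
lemma simple_integral_diff_tsq_le:
  assumes \<xi>: "simple_integrand M F T n \<tau> \<xi>" and \<zeta>: "simple_integrand M F T m \<sigma> \<zeta>" and t: "0 \<le> t"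
  shows "expectation (\<lambda>\<omega>. tsq (simple_integral W n \<tau> \<xi> t \<omega> - simple_integral W m \<sigma> \<zeta> t \<omega>))
    \<le> expectation (\<lambda>\<omega>. \<integral>u. (simple_process n \<tau> \<xi> u \<omega> - simple_process m \<sigma> \<zeta> u \<omega>)\<^sup>2 \<partial>L)"
proof -
  obtain N s P where g: "grid T N s P" and sub: "partition_points n \<tau> \<union> partition_points m \<sigma> \<subseteq> P" and P: "P \<subseteq> {0..T}"
    using grid_with_mesh[OF T_pos zero_less_one, of "partition_points n \<tau> \<union> partition_points m \<sigma>"]
      partition_points[OF \<xi>] partition_points[OF \<zeta>] by auto
  from sub have sub1: "partition_points n \<tau> \<subseteq> P" and sub2: "partition_points m \<sigma> \<subseteq> P" by auto
  define v w where "v = (\<lambda>j. simple_process n \<tau> \<xi> (s (Suc j)))" and "w = (\<lambda>j. simple_process m \<sigma> \<zeta> (s (Suc j)))"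
  note V = refine_to_grid[OF \<xi> g P sub1, folded v_def] and Z = refine_to_grid[OF \<zeta> g P sub2, folded w_def]
  define x where "x = (\<lambda>i \<omega>. v i \<omega> - w i \<omega>)"
  have x: "simple_integrand M F T N s x" unfolding x_def by (rule simple_integrand_diff[OF V(1) Z(1)])
  have xp: "simple_process N s x u \<omega> = simple_process n \<tau> \<xi> u \<omega> - simple_process m \<sigma> \<zeta> u \<omega>" for u \<omega>
    unfolding x_def simple_process_diff[OF V(1)] V(2) Z(2) ..
  have xi: "simple_integral W N s x t \<omega> = simple_integral W n \<tau> \<xi> t \<omega> - simple_integral W m \<sigma> \<zeta> t \<omega>" for \<omega>
    unfolding x_def simple_integral_diff V(3) Z(3) ..
  have "expectation (\<lambda>\<omega>. tsq (simple_integral W N s x t \<omega>)) \<le> expectation (\<lambda>\<omega>. (simple_integral W N s x t \<omega>)\<^sup>2)"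
    by (intro integral_mono integrable_tsq simple_integral_measurable[OF x t]
        simple_integral_square_integrable[OF x t] tsq_le_square)
  also note simple_integral_square_le[OF x t]
  finally show ?thesis unfolding xi xp .
qed

lemma clamp_to_range: "\<bar>y\<bar> \<le> K \<Longrightarrow> \<bar>clamp_to K x - y\<bar> \<le> \<bar>x - y\<bar>" "\<bar>y\<bar> \<le> K \<Longrightarrow> \<bar>x - clamp_to K x\<bar> \<le> \<bar>x - y\<bar>"
  unfolding clamp_to_def by linarith+

text \<open>Clipping the approximating integrands to the range of \<open>S\<close> brings them closer to \<open>S\<close>, and by boundedness
  their squared \<open>L\<^sup>2\<close>-distances to \<open>S\<close> then tend to 0 in mean.  That the integrals converge uniformly in \<open>t\<close> is
  seen by comparing two members of the sequence by the isometry and letting the second one tend to its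
  limit.\<close>
lemma bounded_integrand_approximation:
  assumes I: "stoch_integral M F T W S J"
    and S: "\<And>u \<omega>. u \<in> {0..T} \<Longrightarrow> \<omega> \<in> space M \<Longrightarrow> \<bar>S u \<omega>\<bar> \<le> K" and \<delta>: "0 < \<delta>"
  shows "\<exists>N s v P. grid T N s P \<and> P \<subseteq> {0..T} \<and> (\<forall>i<N. s (Suc i) - s i \<le> \<delta>) \<and> simple_integrand M F T N s v \<and>
    (\<forall>i<N. \<forall>\<omega>\<in>space M. \<bar>v i \<omega>\<bar> \<le> K) \<and>
    expectation (\<lambda>\<omega>. \<integral>u. (simple_process N s v u \<omega> - S u \<omega>)\<^sup>2 \<partial>L) \<le> \<delta> \<and>
    (\<forall>t\<in>{0..T}. expectation (\<lambda>\<omega>. tsq (simple_integral W N s v t \<omega> - J t \<omega>)) \<le> \<delta>)"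
proof -
  obtain \<omega>0 where "\<omega>0 \<in> space M" using not_empty by auto
  from S[OF _ this, of 0] T_pos have K: "0 \<le> K" by simp
  from I obtain n \<tau> \<xi> where prog: "progressive F T S" and Jm: "\<And>t. t \<in> {0..T} \<Longrightarrow> J t \<in> borel_measurable M"
    and \<xi>: "\<And>k. simple_integrand M F T (n k) (\<tau> k) (\<xi> k)"
    and null: "null_in_prob M (\<lambda>k \<omega>. \<integral>\<^sup>+s\<in>{0..T}.
          ennreal ((simple_process (n k) (\<tau> k) (\<xi> k) s \<omega> - S s \<omega>)\<^sup>2) \<partial>lborel)"
    and nullJ: "\<And>t. t \<in> {0..T} \<Longrightarrow> null_in_prob M (\<lambda>k \<omega>.
          ennreal \<bar>simple_integral W (n k) (\<tau> k) (\<xi> k) t \<omega> - J t \<omega>\<bar>)"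
    unfolding stoch_integral_def by blast
  have bS: "bounded_joint S" by (rule bounded_jointI[OF prog S])
  define \<eta> where "\<eta> = (\<lambda>k i \<omega>. clamp_to K (\<xi> k i \<omega>))"
  let ?x = "\<lambda>k. simple_process (n k) (\<tau> k) (\<xi> k)" and ?y = "\<lambda>k. simple_process (n k) (\<tau> k) (\<eta> k)"
  have y: "?y k u \<omega> = clamp_to K (?x k u \<omega>)" for k u \<omega>
    unfolding \<eta>_def using simple_process_map2[of "n k" "\<tau> k" "\<lambda>x y. clamp_to K x" "\<xi> k" "\<xi> k" u \<omega>]
      simple_integrandD(2)[OF \<xi>] K by simp
  have \<eta>: "simple_integrand M F T (n k) (\<tau> k) (\<eta> k)" for k
    unfolding simple_integrand_def \<eta>_def
  proof (intro allI impI conjI simple_integrandD(1,2,3)[OF \<xi>])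
    fix i assume i: "i < n k"
    show "(\<lambda>\<omega>. clamp_to K (\<xi> k i \<omega>)) \<in> borel_measurable (F (\<tau> k i))"
      by (rule measurable_compose[OF simple_integrandD(4)[OF \<xi> i] borel_measurable_clamp_to])
    show "\<exists>C. \<forall>\<omega>\<in>space M. \<bar>clamp_to K (\<xi> k i \<omega>)\<bar> \<le> C" using abs_clamp_to[OF K] by blast
  qed
  define sq where "sq = (\<lambda>k \<omega>. \<integral>u. (?x k u \<omega> - S u \<omega>)\<^sup>2 \<partial>L)"
  define e where "e = (\<lambda>k. expectation (\<lambda>\<omega>. \<integral>u. (?y k u \<omega> - S u \<omega>)\<^sup>2 \<partial>L))"
  have bx: "bounded_joint (?x k)" and by': "bounded_joint (?y k)" for k
    by (rule simple_bounded_joint[OF \<xi>], rule simple_bounded_joint[OF \<eta>])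
  have sqm: "{\<omega> \<in> space M. c < sq k \<omega>} \<in> events" for c k
    unfolding sq_def using sqdist_measurable[OF bS \<xi>, of k] by measurable
  have sq0: "(\<lambda>k. prob {\<omega> \<in> space M. c < sq k \<omega>}) \<longlonglongrightarrow> 0" if "0 < c" for c
    unfolding sq_def by (rule sqdist_prob_tendsto[OF bS \<xi> null that])
  have e0: "0 \<le> e k" for k unfolding e_def by simp
  have "e \<longlonglongrightarrow> 0"
  proof (rule tendsto_zero_by_bounds[OF e0])
    fix c :: real assume c: "0 < c"
    have "e k \<le> c + (4 * K\<^sup>2 * T) * prob {\<omega> \<in> space M. c < sq k \<omega>}" for k
      unfolding e_def
    proof (intro expectation_le_prob sqm AE_I2 integrable_time_integral bounded_joint_intros bS by')
      fix \<omega> assume w: "\<omega> \<in> space M"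
      show "(\<integral>u. (?y k u \<omega> - S u \<omega>)\<^sup>2 \<partial>L) \<le> (if c < sq k \<omega> then 4 * K\<^sup>2 * T else c)"
      proof (cases "c < sq k \<omega>")
        case True
        have "(\<integral>u. (?y k u \<omega> - S u \<omega>)\<^sup>2 \<partial>L) \<le> (\<integral>u. 4 * K\<^sup>2 \<partial>L)"
        proof (intro time_integral_mono[where G = "\<lambda>_ _. 4 * K\<^sup>2"] bounded_joint_intros bS by' w)
          fix u assume u: "0 < u" "u \<le> T"
          have "\<bar>?y k u \<omega> - S u \<omega>\<bar> \<le> 2 * K"
            using abs_clamp_to[OF K, of "?x k u \<omega>"] S[of u \<omega>] u w unfolding y by auto
          then have "\<bar>?y k u \<omega> - S u \<omega>\<bar>\<^sup>2 \<le> (2 * K)\<^sup>2" by (intro power_mono) auto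
          then show "(?y k u \<omega> - S u \<omega>)\<^sup>2 \<le> 4 * K\<^sup>2" by (simp add: power_mult_distrib)
        qed
        also have "\<dots> = 4 * K\<^sup>2 * T" using measure_L by simp
        finally show ?thesis using True by simp
      next
        case False
        have "(\<integral>u. (?y k u \<omega> - S u \<omega>)\<^sup>2 \<partial>L) \<le> sq k \<omega>"
          unfolding sq_def
        proof (intro time_integral_mono bounded_joint_intros bS by' bx w)
          fix u assume "0 < u" "u \<le> T"
          then show "(?y k u \<omega> - S u \<omega>)\<^sup>2 \<le> (?x k u \<omega> - S u \<omega>)\<^sup>2"
            unfolding y abs_le_square_iff[symmetric] using S[of u \<omega>] w by (intro clamp_to_range) auto
        qed
        then show ?thesis using False by simp
      qed
    qed (use c T_pos in auto)
    then show "\<exists>p. (\<forall>k. e k \<le> c + p k) \<and> p \<longlonglongrightarrow> 0"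
      using tendsto_mult_right_zero[OF sq0[OF c], of "4 * K\<^sup>2 * T"]
      by (intro exI[of _ "\<lambda>k. 4 * K\<^sup>2 * T * prob {\<omega> \<in> space M. c < sq k \<omega>}"]) simp
  qed
  have SIm: "(\<lambda>\<omega>. simple_integral W (n k) (\<tau> k) (\<eta> k) t \<omega>) \<in> borel_measurable M"
    "(\<lambda>\<omega>. simple_integral W (n k) (\<tau> k) (\<xi> k) t \<omega>) \<in> borel_measurable M" if "t \<in> {0..T}" for k t
    using simple_integral_measurable[OF \<eta>, of t k] simple_integral_measurable[OF \<xi>, of t k] that by auto
  define q where "q = (\<lambda>k t. expectation (\<lambda>\<omega>. tsq (simple_integral W (n k) (\<tau> k) (\<eta> k) t \<omega> - J t \<omega>)))"
  have q0: "(\<lambda>k. q k t) \<longlonglongrightarrow> 0" if t: "t \<in> {0..T}" for t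
  proof -
    let ?d = "\<lambda>k. simple_integral W (n k) (\<tau> k) (\<lambda>i \<omega>. \<eta> k i \<omega> - \<xi> k i \<omega>) t"
    have d: "simple_integrand M F T (n k) (\<tau> k) (\<lambda>i \<omega>. \<eta> k i \<omega> - \<xi> k i \<omega>)" for k
      by (rule simple_integrand_diff[OF \<eta> \<xi>])
    have dm: "?d k \<in> borel_measurable M" for k using simple_integral_measurable[OF d] t by simp
    let ?a = "\<lambda>k. expectation (\<lambda>\<omega>. tsq (?d k \<omega>))"
    let ?b = "\<lambda>k. expectation (\<lambda>\<omega>. tsq (simple_integral W (n k) (\<tau> k) (\<xi> k) t \<omega> - J t \<omega>))"
    have m: "(\<lambda>\<omega>. simple_integral W (n k) (\<tau> k) (\<xi> k) t \<omega> - J t \<omega>) \<in> borel_measurable M" for k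
      by (intro borel_measurable_diff SIm Jm t)
    have b0: "?b \<longlonglongrightarrow> 0" by (rule expectation_tsq_tendsto[OF m nullJ[OF t]])
    have a0: "?a \<longlonglongrightarrow> 0"
    proof (rule tendsto_zero_by_bounds)
      fix c :: real assume c: "0 < c"
      have "?a k \<le> c + prob {\<omega> \<in> space M. c < sq k \<omega>}" for k
      proof -
        have "?a k \<le> c + prob {\<omega> \<in> space M. c < (\<integral>u. (simple_process (n k) (\<tau> k) (\<lambda>i \<omega>. \<eta> k i \<omega> - \<xi> k i \<omega>) u \<omega>)\<^sup>2 \<partial>L)}"
          using t by (intro simple_integral_tsq_le[OF d _ c]) auto
        also have "\<dots> \<le> c + prob {\<omega> \<in> space M. c < sq k \<omega>}"
        proof (intro add_left_mono finite_measure_mono sqm subsetI)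
          fix \<omega> assume *: "\<omega> \<in> {\<omega> \<in> space M. c < (\<integral>u. (simple_process (n k) (\<tau> k) (\<lambda>i \<omega>. \<eta> k i \<omega> - \<xi> k i \<omega>) u \<omega>)\<^sup>2 \<partial>L)}"
          then have w: "\<omega> \<in> space M" by simp
          have "(\<integral>u. (simple_process (n k) (\<tau> k) (\<lambda>i \<omega>. \<eta> k i \<omega> - \<xi> k i \<omega>) u \<omega>)\<^sup>2 \<partial>L) \<le> sq k \<omega>"
            unfolding sq_def
          proof (intro time_integral_mono bounded_joint_intros bS bx w simple_bounded_joint[OF d])
            fix u assume "0 < u" "u \<le> T"
            then show "(simple_process (n k) (\<tau> k) (\<lambda>i \<omega>. \<eta> k i \<omega> - \<xi> k i \<omega>) u \<omega>)\<^sup>2 \<le> (?x k u \<omega> - S u \<omega>)\<^sup>2"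
              unfolding simple_process_diff[OF \<eta>] y abs_le_square_iff[symmetric]
              using clamp_to_range(2)[of "S u \<omega>" K "?x k u \<omega>"] S[of u \<omega>] w
              by (simp add: abs_minus_commute)
          qed
          then show "\<omega> \<in> {\<omega> \<in> space M. c < sq k \<omega>}" using * by auto
        qed
        finally show ?thesis .
      qed
      then show "\<exists>p. (\<forall>k. ?a k \<le> c + p k) \<and> p \<longlonglongrightarrow> 0" using sq0[OF c]
        by (intro exI[of _ "\<lambda>k. prob {\<omega> \<in> space M. c < sq k \<omega>}"]) simp
    qed simp
    have lim: "(\<lambda>k. 2 * ?a k + 2 * ?b k) \<longlonglongrightarrow> 0"
      using tendsto_add[OF tendsto_mult_right_zero[OF a0, of 2] tendsto_mult_right_zero[OF b0, of 2]] by simp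
    show ?thesis
    proof (rule tendsto_sandwich[OF _ _ tendsto_const lim]; intro always_eventually allI)
      fix k
      show "0 \<le> q k t" by (simp add: q_def)
      have "q k t = expectation (\<lambda>\<omega>. tsq (?d k \<omega> + (simple_integral W (n k) (\<tau> k) (\<xi> k) t \<omega> - J t \<omega>)))"
        unfolding q_def simple_integral_diff by simp
      also have "\<dots> \<le> 2 * ?a k + 2 * ?b k" by (rule expectation_tsq_add_le[OF dm m])
      finally show "q k t \<le> 2 * ?a k + 2 * ?b k" .
    qed
  qed
  have unif: "q k t \<le> 4 * e k" if t: "t \<in> {0..T}" for k t
  proof -
    have "q k t \<le> 4 * e k + (4 * e l + 2 * q l t)" for l
    proof -
      let ?I = "\<lambda>k \<omega>. simple_integral W (n k) (\<tau> k) (\<eta> k) t \<omega>"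
      have "q k t = expectation (\<lambda>\<omega>. tsq ((?I k \<omega> - ?I l \<omega>) + (?I l \<omega> - J t \<omega>)))" by (simp add: q_def)
      also have "\<dots> \<le> 2 * expectation (\<lambda>\<omega>. tsq (?I k \<omega> - ?I l \<omega>)) + 2 * q l t"
        unfolding q_def by (intro expectation_tsq_add_le borel_measurable_diff SIm Jm t)
      also have "expectation (\<lambda>\<omega>. tsq (?I k \<omega> - ?I l \<omega>))
        \<le> expectation (\<lambda>\<omega>. \<integral>u. (?y k u \<omega> - ?y l u \<omega>)\<^sup>2 \<partial>L)"
        using t by (intro simple_integral_diff_tsq_le \<eta>) auto
      also have "\<dots> \<le> expectation (\<lambda>\<omega>. \<integral>u. 2 * (?y k u \<omega> - S u \<omega>)\<^sup>2 + 2 * (?y l u \<omega> - S u \<omega>)\<^sup>2 \<partial>L)"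
      proof (rule integral_mono)
        fix \<omega> assume w: "\<omega> \<in> space M"
        have "(?y k u \<omega> - ?y l u \<omega>)\<^sup>2 \<le> 2 * (?y k u \<omega> - S u \<omega>)\<^sup>2 + 2 * (?y l u \<omega> - S u \<omega>)\<^sup>2" for u
          using zero_le_power2[of "(?y k u \<omega> - S u \<omega>) + (?y l u \<omega> - S u \<omega>)"]
          by (simp add: power2_eq_square algebra_simps)
        then show "(\<integral>u. (?y k u \<omega> - ?y l u \<omega>)\<^sup>2 \<partial>L)
          \<le> (\<integral>u. 2 * (?y k u \<omega> - S u \<omega>)\<^sup>2 + 2 * (?y l u \<omega> - S u \<omega>)\<^sup>2 \<partial>L)"
          by (intro time_integral_mono bounded_joint_intros bS by' w) auto
      qed (intro integrable_time_integral bounded_joint_intros bS by')+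
      also have "\<dots> = expectation (\<lambda>\<omega>. 2 * (\<integral>u. (?y k u \<omega> - S u \<omega>)\<^sup>2 \<partial>L) + 2 * (\<integral>u. (?y l u \<omega> - S u \<omega>)\<^sup>2 \<partial>L))"
        by (intro Bochner_Integration.integral_cong refl, subst Bochner_Integration.integral_add)
          (auto intro!: bounded_joint_integrable_L bounded_joint_intros bS by')
      also have "\<dots> = 2 * e k + 2 * e l"
        unfolding e_def
        by (subst Bochner_Integration.integral_add)
          (auto intro!: integrable_time_integral bounded_joint_intros bS by')
      finally show ?thesis by simp
    qed
    moreover have "(\<lambda>l. 4 * e k + (4 * e l + 2 * q l t)) \<longlonglongrightarrow> 4 * e k + (4 * 0 + 2 * 0)"
      by (intro tendsto_intros \<open>e \<longlonglongrightarrow> 0\<close> q0 t)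
    ultimately have "q k t \<le> 4 * e k + (4 * 0 + 2 * 0)" by (intro LIMSEQ_le_const) auto
    then show ?thesis by simp
  qed
  from LIMSEQ_D[OF \<open>e \<longlonglongrightarrow> 0\<close>, of "\<delta> / 4"] \<delta> obtain k where "\<bar>e k\<bar> < \<delta> / 4" by auto
  then have ek: "4 * e k \<le> \<delta>" "e k \<le> \<delta>" using e0[of k] by auto
  obtain N s P where g: "grid T N s P" and sub: "partition_points (n k) (\<tau> k) \<subseteq> P" and P: "P \<subseteq> {0..T}"
    and mesh: "\<forall>i<N. s (Suc i) - s i \<le> \<delta>"
    using grid_with_mesh[OF T_pos \<delta> partition_points[OF \<xi>[of k]]] by auto
  define v where "v = (\<lambda>j. ?y k (s (Suc j)))"
  note V = refine_to_grid[OF \<eta>[of k] g P sub, folded v_def]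
  have "\<forall>i<N. \<forall>\<omega>\<in>space M. \<bar>v i \<omega>\<bar> \<le> K" unfolding v_def y using abs_clamp_to[OF K] by blast
  moreover have "expectation (\<lambda>\<omega>. \<integral>u. (simple_process N s v u \<omega> - S u \<omega>)\<^sup>2 \<partial>L) \<le> \<delta>"
    using ek(2) unfolding V(2) e_def .
  moreover have "\<forall>t\<in>{0..T}. expectation (\<lambda>\<omega>. tsq (simple_integral W N s v t \<omega> - J t \<omega>)) \<le> \<delta>"
    using unif[of _ k] ek(1) unfolding V(3) q_def by (meson order_trans)
  ultimately show ?thesis using g P mesh V(1) by blast
qed

end

section \<open>Approximation of a bounded Ito process on a grid\<close>

text \<open>One grid step of length \<open>d\<close>, in which the space variable moves by a part \<open>\<beta>\<close> due to the drift and a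
  part \<open>v * D\<close> due to the Wiener increment \<open>D\<close>.  In the second-order term only \<open>v\<^sup>2 * D\<^sup>2\<close> matters, and it
  is split into \<open>v\<^sup>2 * d\<close> and a centred part.  The mixed product of \<open>\<beta>\<close> and \<open>D\<close> is estimated by
  \<open>2 * \<bar>D\<bar> \<le> \<epsilon> + D\<^sup>2 / \<epsilon>\<close>, so that only even moments of \<open>D\<close> occur in the bound.\<close>
lemma taylor_step_expanded:
  assumes g: "class_C21 T g gt gz gzz" and e: "0 < \<epsilon>" and C: "0 \<le> C"
    and t: "\<And>z z' s s'. s \<in> {0..T} \<Longrightarrow> s' \<in> {0..T} \<Longrightarrow> \<bar>gt z s - gt z' s'\<bar> \<le> \<epsilon> + C * (tsq (z - z') + \<bar>s - s'\<bar>)"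
    and zz: "\<And>z z' s s'. s \<in> {0..T} \<Longrightarrow> s' \<in> {0..T} \<Longrightarrow> \<bar>gzz z s - gzz z' s'\<bar> \<le> \<epsilon> + C * (tsq (z - z') + \<bar>s - s'\<bar>)"
    and G: "\<bar>gzz z s\<bar> \<le> G"
    and s: "0 \<le> s" "0 \<le> d" "s + d \<le> T" "d \<le> 1" and K: "\<bar>\<beta>\<bar> \<le> K * d" "\<bar>v\<bar> \<le> K"
  shows "\<bar>g (z + (\<beta> + v * D)) (s + d) - g z s - (gt z s * d + gz z s * \<beta> + gzz z s / 2 * v\<^sup>2 * d)
      - gz z s * v * D - gzz z s / 2 * v\<^sup>2 * (D\<^sup>2 - d)\<bar>
     \<le> \<epsilon> * (1 + 2 * K\<^sup>2) * (d + D\<^sup>2) + 2 * C * (1 + 2 * K\<^sup>2)\<^sup>2 * (d\<^sup>2 + D^4)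
       + G * K\<^sup>2 / 2 * (d\<^sup>2 + \<epsilon> * d + d * D\<^sup>2 / \<epsilon>)"
proof -
  define h where "h = \<beta> + v * D"
  define c where "c = 1 + 2 * K\<^sup>2"
  have K0: "0 \<le> K" using K(2) by simp
  have c: "0 \<le> c" by (simp add: c_def)
  have G0: "0 \<le> G" using G by simp
  have b2: "\<beta>\<^sup>2 \<le> K\<^sup>2 * d\<^sup>2"
    using power_mono[OF K(1), of 2] by (simp add: power_mult_distrib)
  have v2: "v\<^sup>2 \<le> K\<^sup>2" using power_mono[OF K(2), of 2] by simp
  have dd: "d\<^sup>2 \<le> d" using s mult_left_mono[of d 1 d] by (simp add: power2_eq_square)
  have "h\<^sup>2 \<le> 2 * \<beta>\<^sup>2 + 2 * (v * D)\<^sup>2"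
    unfolding h_def using sum_squares_bound[of \<beta> "v * D"] by (simp add: power2_sum)
  also have "\<dots> \<le> 2 * (K\<^sup>2 * d\<^sup>2) + 2 * (K\<^sup>2 * D\<^sup>2)"
    using b2 mult_right_mono[OF v2, of "D\<^sup>2"] by (simp add: power_mult_distrib)
  also have "\<dots> \<le> 2 * (K\<^sup>2 * d) + 2 * (K\<^sup>2 * D\<^sup>2)"
    using mult_left_mono[OF dd, of "K\<^sup>2"] by simp
  finally have "d + h\<^sup>2 \<le> d + (2 * (K\<^sup>2 * d) + 2 * (K\<^sup>2 * D\<^sup>2))" by simp
  also have "\<dots> \<le> c * (d + D\<^sup>2)" by (simp add: c_def algebra_simps)
  finally have y: "d + h\<^sup>2 \<le> c * (d + D\<^sup>2)" .
  have y0: "0 \<le> d + h\<^sup>2" using s by simp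
  have "\<bar>g (z + h) (s + d) - g z s - gt z s * d - gz z s * h - gzz z s * h\<^sup>2 / 2\<bar>
      \<le> (\<epsilon> + C * (h\<^sup>2 + d)) * (d + h\<^sup>2)"
    by (rule taylor_step[OF g e C t zz s(1,2,3)])
  also have "\<dots> = \<epsilon> * (d + h\<^sup>2) + C * (d + h\<^sup>2)\<^sup>2" by (simp add: power2_eq_square algebra_simps)
  also have "\<dots> \<le> \<epsilon> * (c * (d + D\<^sup>2)) + C * (c * (d + D\<^sup>2))\<^sup>2"
    using y y0 e C by (intro add_mono mult_left_mono power_mono) auto
  also have "(c * (d + D\<^sup>2))\<^sup>2 \<le> c\<^sup>2 * (2 * (d\<^sup>2 + D^4))"
  proof -
    have "D^4 = (D\<^sup>2)\<^sup>2" by (simp flip: power_mult)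
    then have "(d + D\<^sup>2)\<^sup>2 \<le> 2 * (d\<^sup>2 + D^4)"
      using sum_squares_bound[of d "D\<^sup>2"] by (simp add: power2_sum)
    then show ?thesis by (simp add: power_mult_distrib mult_left_mono)
  qed
  finally have 1: "\<bar>g (z + h) (s + d) - g z s - gt z s * d - gz z s * h - gzz z s * h\<^sup>2 / 2\<bar>
      \<le> \<epsilon> * (c * (d + D\<^sup>2)) + C * (c\<^sup>2 * (2 * (d\<^sup>2 + D^4)))"
    using C by (simp add: mult_left_mono)
  have "\<bar>gzz z s / 2 * (\<beta>\<^sup>2 + 2 * \<beta> * v * D)\<bar> \<le> G / 2 * (K\<^sup>2 * d\<^sup>2 + K\<^sup>2 * (\<epsilon> * d + d * D\<^sup>2 / \<epsilon>))"
  proof -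
    have "2 * \<bar>D\<bar> \<le> \<epsilon> + D\<^sup>2 / \<epsilon>"
    proof -
      have "0 \<le> (\<bar>D\<bar> - \<epsilon>)\<^sup>2" by simp
      then have "2 * \<bar>D\<bar> * \<epsilon> \<le> \<epsilon> * \<epsilon> + D\<^sup>2" by (simp add: power2_diff power2_eq_square[of \<epsilon>])
      then have "2 * \<bar>D\<bar> \<le> (\<epsilon> * \<epsilon> + D\<^sup>2) / \<epsilon>" using e by (simp add: field_simps)
      then show ?thesis using e by (simp add: add_divide_distrib)
    qed
    then have D: "d * (2 * \<bar>D\<bar>) \<le> d * (\<epsilon> + D\<^sup>2 / \<epsilon>)" by (intro mult_left_mono s)
    have "\<bar>2 * \<beta> * v * D\<bar> = (\<bar>\<beta>\<bar> * \<bar>v\<bar>) * (2 * \<bar>D\<bar>)" by (simp add: abs_mult)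
    also have "\<dots> \<le> ((K * d) * K) * (2 * \<bar>D\<bar>)"
      using K K0 s by (intro mult_right_mono mult_mono) auto
    also have "\<dots> = K\<^sup>2 * (d * (2 * \<bar>D\<bar>))" by (simp add: power2_eq_square)
    also have "\<dots> \<le> K\<^sup>2 * (d * (\<epsilon> + D\<^sup>2 / \<epsilon>))" by (rule mult_left_mono[OF D]) simp
    finally have "\<bar>2 * \<beta> * v * D\<bar> \<le> K\<^sup>2 * (\<epsilon> * d + d * D\<^sup>2 / \<epsilon>)" by (simp add: algebra_simps)
    then have "\<bar>\<beta>\<^sup>2 + 2 * \<beta> * v * D\<bar> \<le> K\<^sup>2 * d\<^sup>2 + K\<^sup>2 * (\<epsilon> * d + d * D\<^sup>2 / \<epsilon>)"
      using b2 abs_triangle_ineq[of "\<beta>\<^sup>2" "2 * \<beta> * v * D"] by simp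
    then have "\<bar>gzz z s / 2\<bar> * \<bar>\<beta>\<^sup>2 + 2 * \<beta> * v * D\<bar> \<le> G / 2 * (K\<^sup>2 * d\<^sup>2 + K\<^sup>2 * (\<epsilon> * d + d * D\<^sup>2 / \<epsilon>))"
      using G G0 by (intro mult_mono) auto
    then show ?thesis by (simp only: abs_mult)
  qed
  note 2 = this
  obtain w where w: "d * D\<^sup>2 / \<epsilon> = w" by blast
  have eq: "g (z + h) (s + d) - g z s - (gt z s * d + gz z s * \<beta> + gzz z s / 2 * v\<^sup>2 * d)
      - gz z s * v * D - gzz z s / 2 * v\<^sup>2 * (D\<^sup>2 - d)
     = (g (z + h) (s + d) - g z s - gt z s * d - gz z s * h - gzz z s * h\<^sup>2 / 2)
       + gzz z s / 2 * (\<beta>\<^sup>2 + 2 * \<beta> * v * D)"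
    unfolding h_def by (simp add: power2_eq_square algebra_simps) (simp add: field_simps)
  have "\<bar>g (z + h) (s + d) - g z s - (gt z s * d + gz z s * \<beta> + gzz z s / 2 * v\<^sup>2 * d)
      - gz z s * v * D - gzz z s / 2 * v\<^sup>2 * (D\<^sup>2 - d)\<bar>
    \<le> (\<epsilon> * (c * (d + D\<^sup>2)) + C * (c\<^sup>2 * (2 * (d\<^sup>2 + D^4)))) + G / 2 * (K\<^sup>2 * d\<^sup>2 + K\<^sup>2 * (\<epsilon> * d + d * D\<^sup>2 / \<epsilon>))"
    unfolding eq by (rule order_trans[OF abs_triangle_ineq add_mono[OF 1 2]])
  also have "\<dots> = \<epsilon> * c * (d + D\<^sup>2) + 2 * C * c\<^sup>2 * (d\<^sup>2 + D^4) + G * K\<^sup>2 / 2 * (d\<^sup>2 + \<epsilon> * d + d * D\<^sup>2 / \<epsilon>)"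
    unfolding w by (simp add: algebra_simps)
  finally show ?thesis unfolding h_def c_def .
qed

context wiener_space
begin

lemma W_increment_moments:
  assumes "0 \<le> a" "a \<le> b"
  shows "has_bochner_integral M (\<lambda>\<omega>. (W b \<omega> - W a \<omega>)\<^sup>2) (b - a)"
    "has_bochner_integral M (\<lambda>\<omega>. (W b \<omega> - W a \<omega>)^4) (3 * (b - a)\<^sup>2)"
proof -
  have e: "expectation (\<lambda>_. 1 :: real) = 1" by (simp add: prob_space)
  show "has_bochner_integral M (\<lambda>\<omega>. (W b \<omega> - W a \<omega>)\<^sup>2) (b - a)"
    "has_bochner_integral M (\<lambda>\<omega>. (W b \<omega> - W a \<omega>)^4) (3 * (b - a)\<^sup>2)"
    using increment_moments(2,3)[OF assms borel_measurable_const integrable_const, of 1]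
    unfolding e mult_1 .
qed

end

text \<open>The setting \<open>dZ = b dt + S dW\<close> with bounded coefficients.  The stochastic integral is not part of the
  data: it has to be \<open>martingale_part\<close>, what remains of \<open>Z\<close> without its starting value and its drift.\<close>
locale bounded_ito_process = wiener_horizon M F W T
  for M :: "'a measure" and F :: "real \<Rightarrow> 'a measure" and W T +
  fixes Z b S :: "real \<Rightarrow> 'a \<Rightarrow> real" and K :: real
  assumes Z_prog: "progressive F T Z" and b_prog: "progressive F T b" and S_prog: "progressive F T S"
    and b_bound: "\<And>u \<omega>. u \<in> {0..T} \<Longrightarrow> \<omega> \<in> space M \<Longrightarrow> \<bar>b u \<omega>\<bar> \<le> K"
    and S_bound: "\<And>u \<omega>. u \<in> {0..T} \<Longrightarrow> \<omega> \<in> space M \<Longrightarrow> \<bar>S u \<omega>\<bar> \<le> K"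
    and K_nonneg: "0 \<le> K"
begin

definition martingale_part :: "real \<Rightarrow> 'a \<Rightarrow> real" where
  "martingale_part t \<omega> = Z t \<omega> - Z 0 \<omega> - (LINT s:{0..t}|lborel. b s \<omega>)"

lemma b_joint: "bounded_joint b" by (rule bounded_jointI[OF b_prog b_bound])
lemma S_joint: "bounded_joint S" by (rule bounded_jointI[OF S_prog S_bound])

lemma half_square_joint: "bounded_joint (\<lambda>u \<omega>. (S u \<omega>)\<^sup>2 / 2)"
  using bounded_joint_mult[OF bounded_joint_power2[OF S_joint] bounded_joint_const[of "1 / 2"]] by simp

lemma Z_adapted: "u \<in> {0..T} \<Longrightarrow> Z u \<in> borel_measurable (F u)"
  by (rule progressive_adapted[OF Z_prog])

lemma Z_measurable: "u \<in> {0..T} \<Longrightarrow> Z u \<in> borel_measurable M"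
  using Z_adapted measurable_F_M by auto

end

text \<open>The simple process with coefficients \<open>v\<close> stands in for \<open>S\<close>; \<open>bounded_integrand_approximation\<close> provides it
  for every \<open>\<delta>\<close>.\<close>
locale grid_approximation = bounded_ito_process M F W T Z b S K
  for M :: "'a measure" and F :: "real \<Rightarrow> 'a measure" and W T Z b S K +
  fixes N :: nat and s :: "nat \<Rightarrow> real" and P :: "real set" and v :: "nat \<Rightarrow> 'a \<Rightarrow> real" and \<delta> :: real
  assumes grid: "grid T N s P" and P_sub: "P \<subseteq> {0..T}"
    and \<delta>: "0 < \<delta>" "\<delta> \<le> 1" and mesh: "\<And>i. i < N \<Longrightarrow> s (Suc i) - s i \<le> \<delta>"
    and v_simple: "simple_integrand M F T N s v"
    and v_bound: "\<And>i \<omega>. i < N \<Longrightarrow> \<omega> \<in> space M \<Longrightarrow> \<bar>v i \<omega>\<bar> \<le> K"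
    and v_close: "expectation (\<lambda>\<omega>. \<integral>u. (simple_process N s v u \<omega> - S u \<omega>)\<^sup>2 \<partial>L) \<le> \<delta>"
    and J_close: "\<And>t. t \<in> {0..T} \<Longrightarrow>
       expectation (\<lambda>\<omega>. tsq (simple_integral W N s v t \<omega> - martingale_part t \<omega>)) \<le> \<delta>"
begin

text \<open>The process with the drift of \<open>Z\<close> and the diffusion coefficient \<open>v\<close>.  On a grid interval its stochastic part is
  a multiple of one Wiener increment, which makes all moments explicit.\<close>
definition A :: "real \<Rightarrow> 'a \<Rightarrow> real" where
  "A u \<omega> = Z 0 \<omega> + (LINT r:{0..u}|lborel. b r \<omega>) + simple_integral W N s v u \<omega>"

lemma s_less: "i < j \<Longrightarrow> j \<le> N \<Longrightarrow> s i < s j"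
  and s_0 [simp]: "s 0 = 0" and s_N [simp]: "s N = T"
  using grid by (auto simp: grid_def)

lemma s_le: "i \<le> j \<Longrightarrow> j \<le> N \<Longrightarrow> s i \<le> s j"
  using s_less[of i j] by (cases "i = j") auto

lemma s_in: "i \<le> N \<Longrightarrow> s i \<in> {0..T}"
  using s_le[of 0 i] s_le[of i N] by simp

lemma s_Suc: "i < N \<Longrightarrow> s i \<le> s (Suc i)"
  by (rule s_le) auto

lemma grid_interval_exists:
  assumes "0 < u" "u \<le> T"
  shows "\<exists>i<N. s i < u \<and> u \<le> s (Suc i)"
proof -
  define k where "k = (LEAST k. u \<le> s k)"
  have N: "u \<le> s N" using assms by simp
  have k: "u \<le> s k" unfolding k_def by (rule LeastI[of _ N]) (rule N)
  have kN: "k \<le> N" unfolding k_def by (rule Least_le) (rule N)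
  have "k \<noteq> 0" using k assms by (cases k) auto
  then obtain i where i: "k = Suc i" by (cases k) auto
  have "\<not> u \<le> s i" using not_less_Least[of i "\<lambda>k. u \<le> s k"] i by (simp add: k_def)
  then show ?thesis using i k kN by (intro exI[of _ i]) auto
qed

lemma simple_integral_increment:
  assumes i: "i < N" and u: "s i \<le> u" "u \<le> s (Suc i)"
  shows "simple_integral W N s v u \<omega> = (\<Sum>j<i. v j \<omega> * (W (s (Suc j)) \<omega> - W (s j) \<omega>)) + v i \<omega> * (W u \<omega> - W (s i) \<omega>)"
proof -
  have "simple_integral W N s v u \<omega> = (\<Sum>j<N. if j < i then v j \<omega> * (W (s (Suc j)) \<omega> - W (s j) \<omega>)
     else if j = i then v i \<omega> * (W u \<omega> - W (s i) \<omega>) else 0)"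
    unfolding simple_integral_def
  proof (intro sum.cong refl)
    fix j assume "j \<in> {..<N}"
    then have j: "j < N" by simp
    consider "j < i" | "j = i" | "i < j" by linarith
    then show "v j \<omega> * (W (min (s (Suc j)) u) \<omega> - W (min (s j) u) \<omega>)
      = (if j < i then v j \<omega> * (W (s (Suc j)) \<omega> - W (s j) \<omega>)
     else if j = i then v i \<omega> * (W u \<omega> - W (s i) \<omega>) else 0)"
    proof cases
      case 1
      then have "s (Suc j) \<le> s i" "s j \<le> s i" using i by (auto intro: s_le)
      then show ?thesis using u 1 by (simp add: min_absorb1)
    next
      case 2
      then show ?thesis using u by (simp add: min_absorb1 min_absorb2)
    next
      case 3
      then have "s (Suc i) \<le> s j" "s (Suc i) \<le> s (Suc j)" using j by (auto intro: s_le)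
      then show ?thesis using u 3 by (simp add: min_absorb2)
    qed
  qed
  also have "\<dots> = (\<Sum>j<i. v j \<omega> * (W (s (Suc j)) \<omega> - W (s j) \<omega>)) + v i \<omega> * (W u \<omega> - W (s i) \<omega>)"
  proof -
    let ?f = "\<lambda>j. if j < i then v j \<omega> * (W (s (Suc j)) \<omega> - W (s j) \<omega>)
       else if j = i then v i \<omega> * (W u \<omega> - W (s i) \<omega>) else 0"
    have "(\<Sum>j<N. ?f j) = (\<Sum>j<Suc i. ?f j)"
      using i by (intro sum.mono_neutral_right) auto
    then show ?thesis by simp
  qed
  finally show ?thesis .
qed

lemma A_increment:
  assumes i: "i < N" and u: "s i \<le> u" "u \<le> s (Suc i)"
  shows "A u \<omega> = A (s i) \<omega> + (((LINT r:{0..u}|lborel. b r \<omega>) - (LINT r:{0..s i}|lborel. b r \<omega>)) + v i \<omega> * (W u \<omega> - W (s i) \<omega>))"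
  using simple_integral_increment[OF i u, of \<omega>] simple_integral_increment[OF i order_refl s_Suc[OF i], of \<omega>]
  unfolding A_def by simp

lemma A_adapted:
  assumes i: "i < N"
  shows "A (s i) \<in> borel_measurable (F (s i))"
proof -
  have "(\<lambda>\<omega>. (\<Sum>j<i. v j \<omega> * (W (s (Suc j)) \<omega> - W (s j) \<omega>))) \<in> borel_measurable (F (s i))"
  proof (intro borel_measurable_sum borel_measurable_times borel_measurable_diff)
    fix j assume "j \<in> {..<i}"
    then have j: "j < N" "s j \<le> s i" "s (Suc j) \<le> s i" using i by (auto intro: s_le)
    show "v j \<in> borel_measurable (F (s i))"
      by (rule measurable_F_mono[OF simple_integrandD(4)[OF v_simple j(1)] j(2)])
    show "W (s (Suc j)) \<in> borel_measurable (F (s i))" "W (s j) \<in> borel_measurable (F (s i))"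
      using s_in[of j] s_in[of "Suc j"] j
      by (auto intro: measurable_F_mono[OF W_adapted])
  qed
  moreover have "Z 0 \<in> borel_measurable (F (s i))"
    using s_in[of i] i T_pos by (intro measurable_F_mono[OF Z_adapted[of 0]]) auto
  moreover have "(\<lambda>\<omega>. LINT r:{0..s i}|lborel. b r \<omega>) \<in> borel_measurable (F (s i))"
    using s_in[of i] i by (intro progressive_time_integral_adapted[OF b_prog]) auto
  moreover have "A (s i) = (\<lambda>\<omega>. Z 0 \<omega> + (LINT r:{0..s i}|lborel. b r \<omega>) + (\<Sum>j<i. v j \<omega> * (W (s (Suc j)) \<omega> - W (s j) \<omega>)))"
    using simple_integral_increment[OF i order_refl s_Suc[OF i]] by (auto simp: A_def)
  ultimately show ?thesis by simp
qed

lemma A_measurable: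
  assumes "u \<in> {0..T}"
  shows "A u \<in> borel_measurable M"
proof -
  have "0 \<in> {0..T}" using T_pos by simp
  then show ?thesis unfolding A_def[abs_def] using assms
    by (intro borel_measurable_add Z_measurable time_integral_measurable[OF b_joint] simple_integral_measurable[OF v_simple]) auto
qed

lemma A_0: "A 0 \<omega> = Z 0 \<omega>"
proof -
  have "simple_integral W N s v 0 \<omega> = 0"
    unfolding simple_integral_def
  proof (intro sum.neutral ballI)
    fix i assume "i \<in> {..<N}"
    then have "0 \<le> s i" "0 \<le> s (Suc i)" using s_in[of i] s_in[of "Suc i"] by auto
    then show "v i \<omega> * (W (min (s (Suc i)) 0) \<omega> - W (min (s i) 0) \<omega>) = 0" by (simp add: min_absorb2)
  qed
  moreover have "(LINT r:{0..0}|lborel. b r \<omega>) = 0"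
    unfolding set_lebesgue_integral_def
    by (rule integral_eq_zero_AE, rule eventually_mono[OF AE_lborel_singleton[of 0]]) (auto split: split_indicator)
  ultimately show ?thesis by (simp add: A_def)
qed

lemma A_close:
  assumes "u \<in> {0..T}"
  shows "expectation (\<lambda>\<omega>. tsq (A u \<omega> - Z u \<omega>)) \<le> \<delta>"
proof -
  have "A u \<omega> - Z u \<omega> = simple_integral W N s v u \<omega> - martingale_part u \<omega>" for \<omega>
    by (simp add: A_def martingale_part_def)
  then show ?thesis using J_close[OF assms] by simp
qed

lemma drift_increment:
  assumes "\<omega> \<in> space M" "0 \<le> a" "a \<le> u" "u \<le> T"
  shows "\<bar>(LINT r:{0..u}|lborel. b r \<omega>) - (LINT r:{0..a}|lborel. b r \<omega>)\<bar> \<le> K * (u - a)"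
  using assms by (intro time_integral_increment_bound b_joint b_bound) auto

text \<open>Within a grid interval \<open>A\<close> moves by at most \<open>K * \<delta>\<close> plus \<open>K\<close> times a Wiener increment, and at time \<open>u\<close> it is
  close to \<open>Z\<close>.\<close>
lemma frozen_close:
  assumes i: "i < N" and u: "s i < u" "u \<le> s (Suc i)"
  shows "expectation (\<lambda>\<omega>. tsq (Z u \<omega> - A (s i) \<omega>)) \<le> (2 + 8 * K\<^sup>2) * \<delta>"
proof -
  have uT: "u \<in> {0..T}" "s i \<in> {0..T}" using s_in[of i] s_in[of "Suc i"] i u by auto
  define d where "d = u - s i"
  have d: "0 \<le> d" "d \<le> \<delta>" "d\<^sup>2 \<le> d" using u mesh[OF i] \<delta> mult_left_mono[of d 1 d]
    by (auto simp: d_def power2_eq_square)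
  note [measurable] = A_measurable[OF uT(1)] A_measurable[OF uT(2)] Z_measurable[OF uT(1)]
  have D2: "has_bochner_integral M (\<lambda>\<omega>. (W u \<omega> - W (s i) \<omega>)\<^sup>2) d"
    using W_increment_moments(1)[of "s i" u] u uT by (simp add: d_def)
  have "expectation (\<lambda>\<omega>. tsq (A u \<omega> - A (s i) \<omega>))
    \<le> expectation (\<lambda>\<omega>. 2 * (K\<^sup>2 * d\<^sup>2) + 2 * (K\<^sup>2 * (W u \<omega> - W (s i) \<omega>)\<^sup>2))"
  proof (intro integral_mono integrable_tsq Bochner_Integration.integrable_add integrable_mult_right)
    show "integrable M (\<lambda>\<omega>. (W u \<omega> - W (s i) \<omega>)\<^sup>2)" using D2 by (simp add: has_bochner_integral_iff)
    fix \<omega> assume w: "\<omega> \<in> space M"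
    define \<beta> where "\<beta> = (LINT r:{0..u}|lborel. b r \<omega>) - (LINT r:{0..s i}|lborel. b r \<omega>)"
    have "\<bar>\<beta>\<bar> \<le> K * d" unfolding \<beta>_def d_def using drift_increment[OF w, of "s i" u] u uT by simp
    then have b2: "\<beta>\<^sup>2 \<le> K\<^sup>2 * d\<^sup>2" using power_mono[of "\<bar>\<beta>\<bar>" "K * d" 2] by (simp add: power_mult_distrib)
    have v2: "(v i \<omega>)\<^sup>2 \<le> K\<^sup>2" using power_mono[OF v_bound[OF i w], of 2] by simp
    have "A u \<omega> - A (s i) \<omega> = \<beta> + v i \<omega> * (W u \<omega> - W (s i) \<omega>)"
      using A_increment[OF i _ u(2), of \<omega>] u by (simp add: \<beta>_def)
    then have "tsq (A u \<omega> - A (s i) \<omega>) \<le> (\<beta> + v i \<omega> * (W u \<omega> - W (s i) \<omega>))\<^sup>2" using tsq_le_square by simp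
    also have "\<dots> \<le> 2 * \<beta>\<^sup>2 + 2 * ((v i \<omega>)\<^sup>2 * (W u \<omega> - W (s i) \<omega>)\<^sup>2)"
      using sum_squares_bound[of \<beta> "v i \<omega> * (W u \<omega> - W (s i) \<omega>)"] by (simp add: power2_sum power_mult_distrib)
    also have "\<dots> \<le> 2 * (K\<^sup>2 * d\<^sup>2) + 2 * (K\<^sup>2 * (W u \<omega> - W (s i) \<omega>)\<^sup>2)"
      using b2 mult_right_mono[OF v2, of "(W u \<omega> - W (s i) \<omega>)\<^sup>2"] by simp
    finally show "tsq (A u \<omega> - A (s i) \<omega>) \<le> 2 * (K\<^sup>2 * d\<^sup>2) + 2 * (K\<^sup>2 * (W u \<omega> - W (s i) \<omega>)\<^sup>2)" .
  qed simp_all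
  also have "\<dots> = 2 * (K\<^sup>2 * d\<^sup>2) + 2 * (K\<^sup>2 * d)"
    using D2 by (simp add: has_bochner_integral_iff prob_space)
  also have "\<dots> \<le> 4 * (K\<^sup>2 * \<delta>)"
    using mult_left_mono[OF order_trans[OF d(3,2)], of "K\<^sup>2"] mult_left_mono[OF d(2), of "K\<^sup>2"] by simp
  finally have 1: "expectation (\<lambda>\<omega>. tsq (A u \<omega> - A (s i) \<omega>)) \<le> 4 * (K\<^sup>2 * \<delta>)" .
  have "expectation (\<lambda>\<omega>. tsq (Z u \<omega> - A (s i) \<omega>))
     = expectation (\<lambda>\<omega>. tsq ((A u \<omega> - A (s i) \<omega>) + - (A u \<omega> - Z u \<omega>)))" by simp
  also have "\<dots> \<le> 2 * expectation (\<lambda>\<omega>. tsq (A u \<omega> - A (s i) \<omega>)) + 2 * expectation (\<lambda>\<omega>. tsq (- (A u \<omega> - Z u \<omega>)))"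
    by (rule expectation_tsq_add_le) measurable
  also have "\<dots> \<le> 2 * (4 * (K\<^sup>2 * \<delta>)) + 2 * \<delta>"
    using 1 A_close[OF uT(1)] unfolding tsq_minus by simp
  finally show ?thesis by (simp add: algebra_simps)
qed

end

section \<open>Taylor expansion along the grid\<close>
lemma (in filtered_prob_space) progressive_comp:
  assumes Z: "progressive F T Z" and f: "(\<lambda>(z, t). f z t) \<in> borel_measurable (restrict_space borel (UNIV \<times> {0..T}))"
  shows "progressive F T (\<lambda>t \<omega>. f (Z t \<omega>) t)"
  unfolding progressive_def
proof
  fix t assume t: "t \<in> {0..T}"
  let ?N = "restrict_space borel {0..t} \<Otimes>\<^sub>M F t"
  have Zt: "(\<lambda>x. Z (fst x) (snd x)) \<in> borel_measurable ?N"
    using Z t by (auto simp: progressive_def case_prod_unfold)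
  have "(\<lambda>x. x) \<in> borel_measurable (restrict_space borel {0..t})"
    by (intro measurable_restrict_space1) simp
  then have tt: "fst \<in> borel_measurable ?N" by (rule measurable_compose[OF measurable_fst])
  have "(\<lambda>x. (Z (fst x) (snd x), fst x)) \<in> measurable ?N (restrict_space borel (UNIV \<times> {0..T}))"
  proof (rule measurable_restrict_space2)
    show "(\<lambda>x. (Z (fst x) (snd x), fst x)) \<in> borel_measurable ?N"
      by (intro borel_measurable_Pair Zt tt)
    show "(\<lambda>x. (Z (fst x) (snd x), fst x)) \<in> space ?N \<rightarrow> UNIV \<times> {0..T}"
      using t by (auto simp: space_pair_measure space_restrict_space)
  qed
  from measurable_compose[OF this f]
  show "(\<lambda>(s, \<omega>). f (Z s \<omega>) s) \<in> borel_measurable ?N" by (simp add: case_prod_unfold)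
qed

lemma (in filtered_prob_space) progressive_comp_continuous:
  assumes "progressive F T Z" "continuous_on (UNIV \<times> {0..T}) (\<lambda>(z, t). f z t)"
  shows "progressive F T (\<lambda>t \<omega>. f (Z t \<omega>) t)"
  by (rule progressive_comp[OF assms(1) borel_measurable_continuous_on_restrict[OF assms(2)]])

text \<open>What tameness gives for a fixed \<open>\<epsilon>\<close>, with the constants made explicit.\<close>
definition controlled :: "real \<Rightarrow> real \<Rightarrow> real \<Rightarrow> real \<Rightarrow> (real \<Rightarrow> real \<Rightarrow> real) \<Rightarrow> bool" where
  "controlled T \<epsilon> C G f \<longleftrightarrow> continuous_on (UNIV \<times> {0..T}) (\<lambda>(z, t). f z t) \<and>
     (\<forall>z. \<forall>s\<in>{0..T}. \<bar>f z s\<bar> \<le> G) \<and>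
     (\<forall>z z'. \<forall>s\<in>{0..T}. \<forall>s'\<in>{0..T}. \<bar>f z s - f z' s'\<bar> \<le> \<epsilon> + C * (tsq (z - z') + \<bar>s - s'\<bar>))"

lemma controlled_measurable:
  assumes "controlled T \<epsilon> C G f" "t \<in> {0..T}"
  shows "(\<lambda>z. f z t) \<in> borel_measurable borel"
proof -
  have c: "continuous_on (UNIV \<times> {0..T}) (\<lambda>(z, t). f z t)" using assms(1) by (simp add: controlled_def)
  have p: "continuous_on UNIV (\<lambda>z::real. (z, t))" by (intro continuous_intros)
  have sub: "range (\<lambda>z. (z, t)) \<subseteq> UNIV \<times> {0..T}" using assms(2) by auto
  from continuous_on_compose2[OF c p sub] have "continuous_on UNIV (\<lambda>z. f z t)" by simp
  then show ?thesis by (rule borel_measurable_continuous_onI)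
qed

lemma controlledD:
  assumes "controlled T \<epsilon> C G f"
  shows "s \<in> {0..T} \<Longrightarrow> \<bar>f z s\<bar> \<le> G"
    "s \<in> {0..T} \<Longrightarrow> s' \<in> {0..T} \<Longrightarrow> \<bar>f z s - f z' s'\<bar> \<le> \<epsilon> + C * (tsq (z - z') + \<bar>s - s'\<bar>)"
  using assms unfolding controlled_def by blast+

locale ito_step = grid_approximation M F W T Z b S K N s P v \<delta>
  for M :: "'a measure" and F :: "real \<Rightarrow> 'a measure" and W T Z b S K N s P v \<delta> +
  fixes g gt gz gzz :: "real \<Rightarrow> real \<Rightarrow> real" and \<epsilon> C G :: real
  assumes C21: "class_C21 T g gt gz gzz" and \<epsilon>: "0 < \<epsilon>" and C: "0 \<le> C"
    and ctrl: "controlled T \<epsilon> C G g" "controlled T \<epsilon> C G gt" "controlled T \<epsilon> C G gz" "controlled T \<epsilon> C G gzz"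
begin

text \<open>Evaluation at the left end points makes the values adapted, so that they can serve as coefficients of
  simple integrands.\<close>
definition frozen :: "(real \<Rightarrow> real \<Rightarrow> real) \<Rightarrow> nat \<Rightarrow> 'a \<Rightarrow> real" where
  "frozen f i \<omega> = f (A (s i) \<omega>) (s i)"

lemma G_nonneg: "0 \<le> G"
  using controlledD(1)[OF ctrl(1), of 0 0] T_pos by simp

lemma frozen_bound: "controlled T \<epsilon> C G f \<Longrightarrow> i \<le> N \<Longrightarrow> \<bar>frozen f i \<omega>\<bar> \<le> G"
  unfolding frozen_def using controlledD(1)[of T \<epsilon> C G f "s i" "A (s i) \<omega>"] s_in[of i] by simp

lemma frozen_adapted:
  assumes f: "controlled T \<epsilon> C G f" and i: "i < N"
  shows "frozen f i \<in> borel_measurable (F (s i))"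
  unfolding frozen_def[abs_def]
  by (rule measurable_compose[OF A_adapted[OF i] controlled_measurable[OF f]]) (use s_in[of i] i in simp)

lemma simple_integrandI:
  assumes "\<And>i. i < N \<Longrightarrow> x i \<in> borel_measurable (F (s i))" "\<And>i \<omega>. i < N \<Longrightarrow> \<omega> \<in> space M \<Longrightarrow> \<bar>x i \<omega>\<bar> \<le> B"
  shows "simple_integrand M F T N s x"
  unfolding simple_integrand_def
proof (intro allI impI conjI)
  fix i assume i: "i < N"
  show "0 \<le> s i" "s i \<le> s (Suc i)" "s (Suc i) \<le> T" using s_in[of i] s_in[of "Suc i"] s_Suc[OF i] i by auto
  show "x i \<in> borel_measurable (F (s i))" "\<exists>C. \<forall>\<omega>\<in>space M. \<bar>x i \<omega>\<bar> \<le> C" using assms i by auto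
qed

lemma frozen_simple: "controlled T \<epsilon> C G f \<Longrightarrow> simple_integrand M F T N s (frozen f)"
  by (rule simple_integrandI[OF frozen_adapted frozen_bound]) auto

lemma v_adapted: "i < N \<Longrightarrow> v i \<in> borel_measurable (F (s i))"
  by (rule simple_integrandD(4)[OF v_simple])

lemma comp_joint:
  assumes f: "controlled T \<epsilon> C G f"
  shows "bounded_joint (\<lambda>u \<omega>. f (Z u \<omega>) u)"
proof (rule bounded_jointI)
  show "progressive F T (\<lambda>u \<omega>. f (Z u \<omega>) u)"
    using f by (intro progressive_comp_continuous[OF Z_prog]) (simp add: controlled_def)
qed (rule controlledD(1)[OF f])

definition freezing_bound :: real where "freezing_bound = \<epsilon> + C * ((3 + 8 * K\<^sup>2) * \<delta>)"

lemma frozen_L1: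
  assumes f: "controlled T \<epsilon> C G f"
  shows "expectation (\<lambda>\<omega>. \<integral>u. \<bar>f (Z u \<omega>) u - simple_process N s (frozen f) u \<omega>\<bar> \<partial>L) \<le> freezing_bound * T"
proof (rule expectation_time_integral_le)
  show bj: "bounded_joint (\<lambda>u \<omega>. \<bar>f (Z u \<omega>) u - simple_process N s (frozen f) u \<omega>\<bar>)"
    by (intro bounded_joint_intros comp_joint[OF f] simple_bounded_joint[OF frozen_simple[OF f]])
  fix u assume u: "0 < u" "u \<le> T"
  then obtain i where i: "i < N" "s i < u" "u \<le> s (Suc i)" using grid_interval_exists by blast
  have uT: "u \<in> {0..T}" "s i \<in> {0..T}" using u s_in[of i] i by auto
  have sp: "simple_process N s (frozen f) u \<omega> = f (A (s i) \<omega>) (s i)" for \<omega>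
    using simple_process_at[OF s_Suc i, of "frozen f" \<omega>] by (simp add: frozen_def)
  note [measurable] = Z_measurable[OF uT(1)] A_measurable[OF uT(2)]
  have m: "(\<lambda>\<omega>. Z u \<omega> - A (s i) \<omega>) \<in> borel_measurable M" by measurable
  have "expectation (\<lambda>\<omega>. \<bar>f (Z u \<omega>) u - simple_process N s (frozen f) u \<omega>\<bar>)
    \<le> expectation (\<lambda>\<omega>. \<epsilon> + C * (tsq (Z u \<omega> - A (s i) \<omega>) + \<delta>))"
  proof (intro integral_mono bounded_joint_integrable_M[OF bj uT(1)])
    show "integrable M (\<lambda>\<omega>. \<epsilon> + C * (tsq (Z u \<omega> - A (s i) \<omega>) + \<delta>))"
      using integrable_tsq[OF m] by simp
    fix \<omega>
    have "\<bar>u - s i\<bar> \<le> \<delta>" using mesh[OF i(1)] i by simp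
    then have "C * (tsq (Z u \<omega> - A (s i) \<omega>) + \<bar>u - s i\<bar>) \<le> C * (tsq (Z u \<omega> - A (s i) \<omega>) + \<delta>)"
      using C by (intro mult_left_mono) auto
    then show "\<bar>f (Z u \<omega>) u - simple_process N s (frozen f) u \<omega>\<bar> \<le> \<epsilon> + C * (tsq (Z u \<omega> - A (s i) \<omega>) + \<delta>)"
      unfolding sp using controlledD(2)[OF f uT, of "Z u \<omega>" "A (s i) \<omega>"] by linarith
  qed
  also have "\<dots> = \<epsilon> + C * (expectation (\<lambda>\<omega>. tsq (Z u \<omega> - A (s i) \<omega>)) + \<delta>)"
    using integrable_tsq[OF m] by (simp add: prob_space)
  also have "\<dots> \<le> \<epsilon> + C * ((2 + 8 * K\<^sup>2) * \<delta> + \<delta>)"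
    using C frozen_close[OF i] by (intro add_left_mono mult_left_mono add_mono) auto
  also have "\<dots> = freezing_bound" by (simp add: freezing_bound_def algebra_simps)
  finally show "expectation (\<lambda>\<omega>. \<bar>f (Z u \<omega>) u - simple_process N s (frozen f) u \<omega>\<bar>) \<le> freezing_bound" .
qed

text \<open>Length, Wiener increment and drift increment of the \<open>i\<close>-th grid interval stopped at \<open>t\<close>.\<close>
definition d :: "real \<Rightarrow> nat \<Rightarrow> real" where
  "d t i = min (s (Suc i)) t - min (s i) t"
definition D :: "real \<Rightarrow> nat \<Rightarrow> 'a \<Rightarrow> real" where
  "D t i \<omega> = W (min (s (Suc i)) t) \<omega> - W (min (s i) t) \<omega>"
definition \<beta> :: "real \<Rightarrow> nat \<Rightarrow> 'a \<Rightarrow> real" where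
  "\<beta> t i \<omega> = (LINT r:{0..min (s (Suc i)) t}|lborel. b r \<omega>) - (LINT r:{0..min (s i) t}|lborel. b r \<omega>)"

text \<open>The bound of \<open>taylor_step_expanded\<close>, for a step of length \<open>x\<close> with Wiener increment \<open>y\<close>.\<close>
definition remainder :: "real \<Rightarrow> real \<Rightarrow> real" where
  "remainder x y = \<epsilon> * (1 + 2 * K\<^sup>2) * (x + y\<^sup>2) + 2 * C * (1 + 2 * K\<^sup>2)\<^sup>2 * (x\<^sup>2 + y^4)
       + G * K\<^sup>2 / 2 * (x\<^sup>2 + \<epsilon> * x + x * y\<^sup>2 / \<epsilon>)"

lemma d_bounds: "i < N \<Longrightarrow> 0 \<le> d t i" "i < N \<Longrightarrow> d t i \<le> \<delta>" "i < N \<Longrightarrow> d t i \<le> 1"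
proof -
  assume i: "i < N"
  show "0 \<le> d t i" "d t i \<le> \<delta>" using s_Suc[OF i] mesh[OF i] \<delta> by (auto simp: d_def min_def)
  then show "d t i \<le> 1" using \<delta> by simp
qed

lemma sum_d: "t \<in> {0..T} \<Longrightarrow> (\<Sum>i<N. d t i) = t"
  using sum_lessThan_telescope[of "\<lambda>i. min (s i) t" N] by (simp add: d_def min_absorb2)

lemma step_bound:
  assumes i: "i < N" and t: "t \<in> {0..T}" and w: "\<omega> \<in> space M"
  shows "\<bar>g (A (min (s (Suc i)) t) \<omega>) (min (s (Suc i)) t) - g (A (min (s i) t) \<omega>) (min (s i) t)
     - (frozen gt i \<omega> * d t i + frozen gz i \<omega> * \<beta> t i \<omega> + frozen gzz i \<omega> / 2 * (v i \<omega>)\<^sup>2 * d t i)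
     - frozen gz i \<omega> * v i \<omega> * D t i \<omega> - frozen gzz i \<omega> / 2 * (v i \<omega>)\<^sup>2 * ((D t i \<omega>)\<^sup>2 - d t i)\<bar>
   \<le> remainder (d t i) (D t i \<omega>)"
proof (cases "s i < t")
  case False
  then have "min (s i) t = t" "min (s (Suc i)) t = t" using s_Suc[OF i] by auto
  then show ?thesis by (simp add: d_def D_def \<beta>_def remainder_def)
next
  case True
  then have m: "min (s i) t = s i" by simp
  define u where "u = min (s (Suc i)) t"
  have u: "s i \<le> u" "u \<le> s (Suc i)" "u \<le> T" "0 \<le> s i" using True s_Suc[OF i] t s_in[of i] i by (auto simp: u_def)
  have du: "u = s i + d t i" by (simp add: d_def m u_def)
  have Du: "W u \<omega> - W (s i) \<omega> = D t i \<omega>" by (simp add: D_def m u_def)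
  have bu: "(LINT r:{0..u}|lborel. b r \<omega>) - (LINT r:{0..s i}|lborel. b r \<omega>) = \<beta> t i \<omega>"
    by (simp add: \<beta>_def m u_def)
  have Au: "A u \<omega> = A (s i) \<omega> + (\<beta> t i \<omega> + v i \<omega> * D t i \<omega>)"
    using A_increment[OF i u(1,2), of \<omega>] unfolding Du bu .
  have bK: "\<bar>\<beta> t i \<omega>\<bar> \<le> K * d t i"
    using drift_increment[OF w u(4,1,3)] unfolding bu using du by simp
  show ?thesis
    unfolding m u_def[symmetric] Au frozen_def remainder_def
    unfolding du
    by (rule taylor_step_expanded[OF C21 \<epsilon> C controlledD(2)[OF ctrl(2)] controlledD(2)[OF ctrl(4)]])
      (use u du d_bounds[OF i] controlledD(1)[OF ctrl(4)] s_in[of i] i bK v_bound[OF i w] in auto)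
qed

lemma D_moments:
  assumes i: "i < N" and t: "t \<in> {0..T}"
  shows "has_bochner_integral M (\<lambda>\<omega>. (D t i \<omega>)\<^sup>2) (d t i)"
    "has_bochner_integral M (\<lambda>\<omega>. (D t i \<omega>)^4) (3 * (d t i)\<^sup>2)"
  using W_increment_moments[of "min (s i) t" "min (s (Suc i)) t"] s_Suc[OF i] s_in[of i] i t
  unfolding D_def d_def by auto

definition taylor_bound :: real where
  "taylor_bound = 2 * \<epsilon> * (1 + 2 * K\<^sup>2) + 8 * C * (1 + 2 * K\<^sup>2)\<^sup>2 * \<delta> + G * K\<^sup>2 / 2 * (\<delta> + \<epsilon> + \<delta> / \<epsilon>)"

lemma remainder_expectation:
  assumes i: "i < N" and t: "t \<in> {0..T}"
  shows "integrable M (\<lambda>\<omega>. remainder (d t i) (D t i \<omega>))"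
    "expectation (\<lambda>\<omega>. remainder (d t i) (D t i \<omega>)) \<le> taylor_bound * d t i"
proof -
  let ?d = "d t i"
  have c: "has_bochner_integral M (\<lambda>\<omega>. x) (x::real)" for x
    by (simp add: has_bochner_integral_iff prob_space)
  have "has_bochner_integral M (\<lambda>\<omega>. remainder (d t i) (D t i \<omega>))
   (\<epsilon> * (1 + 2 * K\<^sup>2) * (?d + ?d) + 2 * C * (1 + 2 * K\<^sup>2)\<^sup>2 * (?d\<^sup>2 + 3 * ?d\<^sup>2)
       + G * K\<^sup>2 / 2 * (?d\<^sup>2 + \<epsilon> * ?d + ?d * ?d / \<epsilon>))"
    unfolding remainder_def
    by (intro has_bochner_integral_add has_bochner_integral_mult_right has_bochner_integral_divide_zero c D_moments[OF assms])
  then have 1: "integrable M (\<lambda>\<omega>. remainder (d t i) (D t i \<omega>))"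
    and 2: "expectation (\<lambda>\<omega>. remainder (d t i) (D t i \<omega>)) =
   \<epsilon> * (1 + 2 * K\<^sup>2) * (?d + ?d) + 2 * C * (1 + 2 * K\<^sup>2)\<^sup>2 * (?d\<^sup>2 + 3 * ?d\<^sup>2)
       + G * K\<^sup>2 / 2 * (?d\<^sup>2 + \<epsilon> * ?d + ?d * ?d / \<epsilon>)"
    by (simp_all add: has_bochner_integral_iff)
  show "integrable M (\<lambda>\<omega>. remainder (d t i) (D t i \<omega>))" by (rule 1)
  have dd: "?d * ?d \<le> \<delta> * ?d" using d_bounds[OF i, of t] by (intro mult_right_mono) auto
  have d2: "?d\<^sup>2 \<le> \<delta> * ?d" using dd by (simp add: power2_eq_square)
  have de: "?d * ?d / \<epsilon> \<le> \<delta> * ?d / \<epsilon>" using dd \<epsilon> by (intro divide_right_mono) auto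
  have "\<epsilon> * (1 + 2 * K\<^sup>2) * (?d + ?d) + 2 * C * (1 + 2 * K\<^sup>2)\<^sup>2 * (?d\<^sup>2 + 3 * ?d\<^sup>2)
       + G * K\<^sup>2 / 2 * (?d\<^sup>2 + \<epsilon> * ?d + ?d * ?d / \<epsilon>)
    \<le> \<epsilon> * (1 + 2 * K\<^sup>2) * (?d + ?d) + 2 * C * (1 + 2 * K\<^sup>2)\<^sup>2 * (\<delta> * ?d + 3 * (\<delta> * ?d))
       + G * K\<^sup>2 / 2 * (\<delta> * ?d + \<epsilon> * ?d + \<delta> * ?d / \<epsilon>)"
    using d2 de C G_nonneg \<epsilon>
    by (intro add_mono mult_left_mono order_refl) auto
  also have "\<dots> = taylor_bound * ?d" unfolding taylor_bound_def by (simp add: algebra_simps add_divide_distrib)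
  finally show "expectation (\<lambda>\<omega>. remainder (d t i) (D t i \<omega>)) \<le> taylor_bound * ?d" using 2 by simp
qed

text \<open>The Taylor expansion along the grid splits into the terms of order \<open>dt\<close>, the compensated squares of the
  Wiener increments, and a simple integral with coefficients \<open>\<xi>\<close>.\<close>
definition riemann_part :: "real \<Rightarrow> 'a \<Rightarrow> real" where
  "riemann_part t \<omega> = (\<Sum>i<N. frozen gt i \<omega> * d t i + frozen gz i \<omega> * \<beta> t i \<omega>
     + frozen gzz i \<omega> / 2 * (v i \<omega>)\<^sup>2 * d t i)"

definition variation_part :: "real \<Rightarrow> 'a \<Rightarrow> real" where
  "variation_part t \<omega> = (\<Sum>i<N. frozen gzz i \<omega> / 2 * (v i \<omega>)\<^sup>2 * ((D t i \<omega>)\<^sup>2 - d t i))"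

definition \<xi> :: "nat \<Rightarrow> 'a \<Rightarrow> real" where "\<xi> i \<omega> = frozen gz i \<omega> * v i \<omega>"

lemma \<xi>_simple: "simple_integrand M F T N s \<xi>"
proof (rule simple_integrandI[where B = "G * K"])
  fix i assume i: "i < N"
  show "\<xi> i \<in> borel_measurable (F (s i))"
    unfolding \<xi>_def[abs_def] by (intro borel_measurable_times frozen_adapted[OF ctrl(3)] v_adapted i)
  fix \<omega> assume "\<omega> \<in> space M"
  then show "\<bar>\<xi> i \<omega>\<bar> \<le> G * K"
    unfolding \<xi>_def abs_mult using frozen_bound[OF ctrl(3), of i \<omega>] v_bound[OF i] i G_nonneg
    by (intro mult_mono) auto
qed

definition taylor_error :: "real \<Rightarrow> 'a \<Rightarrow> real" where
  "taylor_error t \<omega> = (g (A t \<omega>) t - g (A 0 \<omega>) 0) - riemann_part t \<omega> - simple_integral W N s \<xi> t \<omega> - variation_part t \<omega>"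

lemma taylor_error_bound:
  assumes t: "t \<in> {0..T}" and w: "\<omega> \<in> space M"
  shows "\<bar>taylor_error t \<omega>\<bar> \<le> (\<Sum>i<N. remainder (d t i) (D t i \<omega>))"
proof -
  have "(\<Sum>i<N. g (A (min (s (Suc i)) t) \<omega>) (min (s (Suc i)) t) - g (A (min (s i) t) \<omega>) (min (s i) t))
      = g (A (min (s N) t) \<omega>) (min (s N) t) - g (A (min (s 0) t) \<omega>) (min (s 0) t)"
    by (rule sum_lessThan_telescope[of "\<lambda>i. g (A (min (s i) t) \<omega>) (min (s i) t)"])
  also have "\<dots> = g (A t \<omega>) t - g (A 0 \<omega>) 0" using t by (simp add: min_absorb1 min_absorb2)
  finally have eq: "taylor_error t \<omega> = (\<Sum>i<N. g (A (min (s (Suc i)) t) \<omega>) (min (s (Suc i)) t) - g (A (min (s i) t) \<omega>) (min (s i) t)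
     - (frozen gt i \<omega> * d t i + frozen gz i \<omega> * \<beta> t i \<omega> + frozen gzz i \<omega> / 2 * (v i \<omega>)\<^sup>2 * d t i)
     - frozen gz i \<omega> * v i \<omega> * D t i \<omega> - frozen gzz i \<omega> / 2 * (v i \<omega>)\<^sup>2 * ((D t i \<omega>)\<^sup>2 - d t i))"
    unfolding taylor_error_def riemann_part_def variation_part_def simple_integral_def \<xi>_def D_def[symmetric]
    by (simp only: sum_subtractf)
  show ?thesis
    unfolding eq using step_bound[OF _ t w] by (intro order_trans[OF sum_abs] sum_mono) auto
qed

lemma frozen_measurable: "controlled T \<epsilon> C G f \<Longrightarrow> i < N \<Longrightarrow> frozen f i \<in> borel_measurable M"
  by (rule simple_integrandD(5)[OF frozen_simple])

lemma v_measurable: "i < N \<Longrightarrow> v i \<in> borel_measurable M"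
  by (rule simple_integrandD(5)[OF v_simple])

lemma D_measurable: "i < N \<Longrightarrow> t \<in> {0..T} \<Longrightarrow> D t i \<in> borel_measurable M"
  unfolding D_def[abs_def] using s_in[of i] s_in[of "Suc i"] by (intro borel_measurable_diff W_measurable) auto

lemma \<beta>_measurable:
  assumes "i < N" "t \<in> {0..T}"
  shows "\<beta> t i \<in> borel_measurable M"
  unfolding \<beta>_def[abs_def] using s_in[of i] s_in[of "Suc i"] assms
  by (intro borel_measurable_diff time_integral_measurable[OF b_joint]) auto

lemma riemann_part_measurable: "t \<in> {0..T} \<Longrightarrow> riemann_part t \<in> borel_measurable M"
  unfolding riemann_part_def[abs_def]
  by (intro borel_measurable_sum borel_measurable_add borel_measurable_times borel_measurable_divide
      borel_measurable_power borel_measurable_const frozen_measurable ctrl v_measurable \<beta>_measurable) auto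

lemma variation_part_measurable: "t \<in> {0..T} \<Longrightarrow> variation_part t \<in> borel_measurable M"
  unfolding variation_part_def[abs_def]
  by (intro borel_measurable_sum borel_measurable_diff borel_measurable_times borel_measurable_divide
      borel_measurable_power borel_measurable_const frozen_measurable ctrl v_measurable D_measurable) auto

lemma comp_measurable:
  assumes "controlled T \<epsilon> C G f" "t \<in> {0..T}" "X \<in> borel_measurable M"
  shows "(\<lambda>\<omega>. f (X \<omega>) t) \<in> borel_measurable M"
  by (rule measurable_compose[OF assms(3) controlled_measurable[OF assms(1,2)]])

lemma taylor_error_measurable:
  assumes "t \<in> {0..T}"
  shows "taylor_error t \<in> borel_measurable M"
  unfolding taylor_error_def[abs_def]
  using assms T_pos by (intro borel_measurable_diff comp_measurable[OF ctrl(1)] A_measurable riemann_part_measurable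
     variation_part_measurable simple_integral_measurable[OF \<xi>_simple]) auto

lemma taylor_error_expectation:
  assumes t: "t \<in> {0..T}"
  shows "expectation (\<lambda>\<omega>. tsq (taylor_error t \<omega>)) \<le> taylor_bound * T"
proof -
  have "expectation (\<lambda>\<omega>. tsq (taylor_error t \<omega>)) \<le> expectation (\<lambda>\<omega>. \<Sum>i<N. remainder (d t i) (D t i \<omega>))"
  proof (intro integral_mono integrable_tsq taylor_error_measurable t Bochner_Integration.integrable_sum)
    fix \<omega> assume "\<omega> \<in> space M"
    then show "tsq (taylor_error t \<omega>) \<le> (\<Sum>i<N. remainder (d t i) (D t i \<omega>))"
      using taylor_error_bound[OF t] tsq_le_abs order_trans by blast
  qed (use remainder_expectation(1) t in auto)
  also have "\<dots> = (\<Sum>i<N. expectation (\<lambda>\<omega>. remainder (d t i) (D t i \<omega>)))"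
    using remainder_expectation(1)[OF _ t] by (intro Bochner_Integration.integral_sum) auto
  also have "\<dots> \<le> (\<Sum>i<N. taylor_bound * d t i)" using remainder_expectation(2)[OF _ t] by (intro sum_mono) auto
  also have "\<dots> = taylor_bound * t" using sum_d[OF t] by (simp flip: sum_distrib_left)
  also have "\<dots> \<le> taylor_bound * T"
    using t \<epsilon> C \<delta> G_nonneg by (intro mult_left_mono) (auto simp: taylor_bound_def intro!: add_nonneg_nonneg mult_nonneg_nonneg)
  finally show ?thesis .
qed

text \<open>The compensated squares are orthogonal, and the second moment \<open>2 * (d t i)\<^sup>2\<close> of each of them is of second
  order in the length of the interval; so the sum of these moments is of the order of the mesh.\<close>
lemma variation_part_expectation:
  assumes t: "t \<in> {0..T}"
  shows "expectation (\<lambda>\<omega>. tsq (variation_part t \<omega>)) \<le> G\<^sup>2 * K^4 * T * \<delta>"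
proof -
  let ?x = "\<lambda>i \<omega>. frozen gzz i \<omega> / 2 * (v i \<omega>)\<^sup>2"
  let ?D = "\<lambda>i \<omega>. (D t i \<omega>)\<^sup>2 - d t i"
  have xb: "\<bar>?x i \<omega>\<bar> \<le> G / 2 * K\<^sup>2" if "i < N" "\<omega> \<in> space M" for i \<omega>
  proof -
    have f: "\<bar>frozen gzz i \<omega> / 2\<bar> \<le> G / 2" using frozen_bound[OF ctrl(4), of i \<omega>] that by simp
    have "(v i \<omega>)\<^sup>2 \<le> K\<^sup>2" using power_mono[OF v_bound[OF that], of 2] by simp
    from mult_mono[OF f this] show ?thesis using G_nonneg by (simp add: abs_mult)
  qed
  have xm: "?x i \<in> borel_measurable (F (s i))" if "i < N" for i
    by (intro borel_measurable_times borel_measurable_divide borel_measurable_power frozen_adapted[OF ctrl(4)] v_adapted that) auto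
  have "(\<lambda>\<omega>. \<Sum>i<N. ?x i \<omega> * ?D i \<omega>) \<in> borel_measurable (F (s N)) \<and>
    has_bochner_integral M (\<lambda>\<omega>. (\<Sum>i<N. ?x i \<omega> * ?D i \<omega>)\<^sup>2) (\<Sum>i<N. expectation (\<lambda>\<omega>. (?x i \<omega>)\<^sup>2) * (2 * (d t i)\<^sup>2))"
  proof (rule orthogonal_sum[where s = s and n = N and v = ?x and D = ?D and d = "\<lambda>i. 2 * (d t i)\<^sup>2"])
    fix i assume i: "i < N"
    show "0 \<le> s i \<and> s i \<le> s (Suc i)" using s_in[of i] s_Suc[OF i] i by auto
    show "?x i \<in> borel_measurable (F (s i)) \<and> (\<exists>C. \<forall>\<omega>\<in>space M. \<bar>?x i \<omega>\<bar> \<le> C)"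
      using xm[OF i] xb[OF i] by blast
    have Dm: "(\<lambda>\<omega>. D t i \<omega>) \<in> borel_measurable (F (s (Suc i)))"
      unfolding D_def by (rule increment_adapted) (use s_in[of i] s_Suc[OF i] i t in auto)
    then show "?D i \<in> borel_measurable (F (s (Suc i)))"
      by (intro borel_measurable_diff borel_measurable_power) auto
    fix U :: "'a \<Rightarrow> real" assume U: "U \<in> borel_measurable (F (s i))" "integrable M U"
    have U': "U \<in> borel_measurable (F (min (s i) t))" if "min (s i) t < min (s (Suc i)) t"
    proof -
      have "min (s i) t = s i" using that by auto
      then show ?thesis using U by simp
    qed
    have ab: "0 \<le> min (s i) t" "min (s i) t \<le> min (s (Suc i)) t" using s_in[of i] s_Suc[OF i] i t by auto
    note m2 = increment_moments(2)[OF ab U' U(2), folded D_def d_def]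
      and m4 = increment_moments(3)[OF ab U' U(2), folded D_def d_def]
    have U0: "has_bochner_integral M U (expectation U)" using U(2) by (simp add: has_bochner_integral_iff)
    have "has_bochner_integral M (\<lambda>\<omega>. U \<omega> * (D t i \<omega>)\<^sup>2 - d t i * U \<omega>) (expectation U * d t i - d t i * expectation U)"
      by (intro has_bochner_integral_diff has_bochner_integral_mult_right m2 U0)
    then show "has_bochner_integral M (\<lambda>\<omega>. U \<omega> * ?D i \<omega>) 0" by (simp add: algebra_simps)
    have "has_bochner_integral M (\<lambda>\<omega>. U \<omega> * (D t i \<omega>)^4 - (2 * d t i) * (U \<omega> * (D t i \<omega>)\<^sup>2) + (d t i)\<^sup>2 * U \<omega>)
       (expectation U * (3 * (d t i)\<^sup>2) - (2 * d t i) * (expectation U * d t i) + (d t i)\<^sup>2 * expectation U)"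
      by (intro has_bochner_integral_add has_bochner_integral_diff has_bochner_integral_mult_right m2 m4 U0)
    moreover have "expectation U * (3 * (d t i)\<^sup>2) - (2 * d t i) * (expectation U * d t i) + (d t i)\<^sup>2 * expectation U
      = expectation U * (2 * (d t i)\<^sup>2)" by (simp add: power2_eq_square algebra_simps)
    moreover have "U \<omega> * (D t i \<omega>)^4 - (2 * d t i) * (U \<omega> * (D t i \<omega>)\<^sup>2) + (d t i)\<^sup>2 * U \<omega> = U \<omega> * (?D i \<omega>)\<^sup>2" for \<omega>
    proof -
      have "(D t i \<omega>)^4 = (D t i \<omega>)\<^sup>2 * (D t i \<omega>)\<^sup>2" by (simp flip: power_add)
      then show ?thesis by (simp add: power2_diff power2_eq_square[of "(D t i \<omega>)\<^sup>2"] algebra_simps)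
    qed
    ultimately show "has_bochner_integral M (\<lambda>\<omega>. U \<omega> * (?D i \<omega>)\<^sup>2) (expectation U * (2 * (d t i)\<^sup>2))" by simp
  qed
  then have i: "integrable M (\<lambda>\<omega>. (variation_part t \<omega>)\<^sup>2)"
    and e: "expectation (\<lambda>\<omega>. (variation_part t \<omega>)\<^sup>2) = (\<Sum>i<N. expectation (\<lambda>\<omega>. (?x i \<omega>)\<^sup>2) * (2 * (d t i)\<^sup>2))"
    by (simp_all add: variation_part_def has_bochner_integral_iff)
  have "expectation (\<lambda>\<omega>. tsq (variation_part t \<omega>)) \<le> expectation (\<lambda>\<omega>. (variation_part t \<omega>)\<^sup>2)"
    by (intro integral_mono integrable_tsq variation_part_measurable t i tsq_le_square)
  also have "\<dots> \<le> (\<Sum>i<N. (G / 2 * K\<^sup>2)\<^sup>2 * (2 * (\<delta> * d t i)))"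
    unfolding e
  proof (rule sum_mono)
    fix i assume "i \<in> {..<N}"
    then have i: "i < N" by simp
    have sq: "(?x i \<omega>)\<^sup>2 \<le> (G / 2 * K\<^sup>2)\<^sup>2" if "\<omega> \<in> space M" for \<omega>
      using power_mono[OF xb[OF i that] abs_ge_zero, of 2] unfolding power2_abs .
    have "integrable M (\<lambda>\<omega>. (?x i \<omega>)\<^sup>2)"
      using measurable_F_M[OF xm[OF i]] s_in[of i] i sq
      by (intro integrable_const_bound[where B = "(G / 2 * K\<^sup>2)\<^sup>2"] AE_I2) auto
    then have "expectation (\<lambda>\<omega>. (?x i \<omega>)\<^sup>2) \<le> expectation (\<lambda>\<omega>. (G / 2 * K\<^sup>2)\<^sup>2)"
      by (intro integral_mono sq) auto
    then have 1: "expectation (\<lambda>\<omega>. (?x i \<omega>)\<^sup>2) \<le> (G / 2 * K\<^sup>2)\<^sup>2" by (simp add: prob_space)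
    have 2: "2 * (d t i)\<^sup>2 \<le> 2 * (\<delta> * d t i)"
      using d_bounds[OF i, of t] mult_right_mono[of "d t i" \<delta> "d t i"] by (simp add: power2_eq_square)
    show "expectation (\<lambda>\<omega>. (?x i \<omega>)\<^sup>2) * (2 * (d t i)\<^sup>2) \<le> (G / 2 * K\<^sup>2)\<^sup>2 * (2 * (\<delta> * d t i))"
      by (rule mult_mono[OF 1 2]) auto
  qed
  also have "\<dots> = (G / 2 * K\<^sup>2)\<^sup>2 * (2 * (\<delta> * t))"
    using sum_d[OF t] by (simp flip: sum_distrib_left)
  also have "\<dots> \<le> (G / 2 * K\<^sup>2)\<^sup>2 * (2 * (\<delta> * T))"
    using t \<delta> by (intro mult_left_mono) auto
  also have "\<dots> = G\<^sup>2 * K^4 * T * \<delta> / 2"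
    by (simp add: power_mult_distrib power_divide)
  also have "\<dots> \<le> G\<^sup>2 * K^4 * T * \<delta>" using T_pos \<delta> by simp
  finally show ?thesis .
qed

end

context wiener_horizon
begin

abbreviation time_expectation :: "(real \<Rightarrow> 'a \<Rightarrow> real) \<Rightarrow> real" where
  "time_expectation H \<equiv> expectation (\<lambda>\<omega>. \<integral>u. H u \<omega> \<partial>L)"

lemma time_expectation_add:
  assumes "bounded_joint H" "bounded_joint G"
  shows "time_expectation (\<lambda>u \<omega>. H u \<omega> + G u \<omega>) = time_expectation H + time_expectation G"
proof -
  have "time_expectation (\<lambda>u \<omega>. H u \<omega> + G u \<omega>) = expectation (\<lambda>\<omega>. (\<integral>u. H u \<omega> \<partial>L) + (\<integral>u. G u \<omega> \<partial>L))"
    by (intro Bochner_Integration.integral_cong refl Bochner_Integration.integral_add bounded_joint_integrable_L assms)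
  then show ?thesis
    by (simp add: integrable_time_integral assms)
qed

lemma time_expectation_cmult: "time_expectation (\<lambda>u \<omega>. c * H u \<omega>) = c * time_expectation H"
  by simp

lemma time_expectation_const: "time_expectation (\<lambda>u \<omega>. c) = c * T"
  using measure_L by (simp add: prob_space)

lemma time_expectation_mono:
  assumes "bounded_joint H" "bounded_joint G" "\<And>u \<omega>. 0 < u \<Longrightarrow> u \<le> T \<Longrightarrow> \<omega> \<in> space M \<Longrightarrow> H u \<omega> \<le> G u \<omega>"
  shows "time_expectation H \<le> time_expectation G"
proof (rule integral_mono)
  fix \<omega> assume "\<omega> \<in> space M"
  then show "(\<integral>u. H u \<omega> \<partial>L) \<le> (\<integral>u. G u \<omega> \<partial>L)"
    by (intro time_integral_mono assms)
qed (intro integrable_time_integral assms)+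

end

context ito_step
begin

lemma simple_process_grid:
  assumes "i < N" "s i < u" "u \<le> s (Suc i)"
  shows "simple_process N s x u \<omega> = x i \<omega>"
  by (rule simple_process_at[OF _ assms]) (rule s_Suc)

section \<open>Convergence of the Riemann sums and the total error\<close>
definition drift :: "real \<Rightarrow> 'a \<Rightarrow> real" where
  "drift u \<omega> = gt (Z u \<omega>) u + b u \<omega> * gz (Z u \<omega>) u + (S u \<omega>)\<^sup>2 / 2 * gzz (Z u \<omega>) u"

definition simple_part :: "nat \<Rightarrow> 'a \<Rightarrow> real" where
  "simple_part i \<omega> = frozen gt i \<omega> + frozen gzz i \<omega> / 2 * (v i \<omega>)\<^sup>2"

definition frozen_drift :: "real \<Rightarrow> 'a \<Rightarrow> real" where
  "frozen_drift u \<omega> = simple_process N s simple_part u \<omega> + simple_process N s (frozen gz) u \<omega> * b u \<omega>"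

lemma simple_part_simple: "simple_integrand M F T N s simple_part"
proof (rule simple_integrandI[where B = "G + G / 2 * K\<^sup>2"])
  fix i assume i: "i < N"
  show "simple_part i \<in> borel_measurable (F (s i))"
    unfolding simple_part_def[abs_def]
    by (intro borel_measurable_add borel_measurable_times borel_measurable_divide borel_measurable_power
       borel_measurable_const frozen_adapted ctrl v_adapted i)
  fix \<omega> assume w: "\<omega> \<in> space M"
  have f: "\<bar>frozen gzz i \<omega> / 2\<bar> \<le> G / 2" using frozen_bound[OF ctrl(4), of i \<omega>] i by simp
  have "(v i \<omega>)\<^sup>2 \<le> K\<^sup>2" using power_mono[OF v_bound[OF i w] abs_ge_zero, of 2] unfolding power2_abs .
  from mult_mono[OF f this] have "\<bar>frozen gzz i \<omega> / 2 * (v i \<omega>)\<^sup>2\<bar> \<le> G / 2 * K\<^sup>2"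
    using G_nonneg by (simp add: abs_mult)
  then show "\<bar>simple_part i \<omega>\<bar> \<le> G + G / 2 * K\<^sup>2"
    unfolding simple_part_def using frozen_bound[OF ctrl(2), of i \<omega>] i by linarith
qed

lemma drift_joint: "bounded_joint drift"
  unfolding drift_def[abs_def]
  by (intro bounded_joint_add bounded_joint_mult comp_joint ctrl b_joint half_square_joint)

lemma frozen_drift_joint: "bounded_joint frozen_drift"
  unfolding frozen_drift_def[abs_def]
  by (intro bounded_joint_add bounded_joint_mult b_joint simple_bounded_joint simple_part_simple frozen_simple ctrl)

lemma simple_drift_integral:
  assumes t: "t \<in> {0..T}" and w: "\<omega> \<in> space M"
  shows "(\<integral>u. indicator {0..t} u * (simple_process N s x u \<omega> * b u \<omega>) \<partial>L) = (\<Sum>i<N. x i \<omega> * \<beta> t i \<omega>)"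
proof -
  let ?m = "\<lambda>i. min (s i) t"
  have i: "integrable L (\<lambda>u. indicator {0..a} u * b u \<omega>)" for a
    by (rule bounded_joint_integrable_L[OF bounded_joint_until[OF b_joint] w])
  have "(\<integral>u. indicator {0..t} u * (simple_process N s x u \<omega> * b u \<omega>) \<partial>L)
    = (\<integral>u. (\<Sum>i<N. x i \<omega> * (indicator {0..?m (Suc i)} u * b u \<omega> - indicator {0..?m i} u * b u \<omega>)) \<partial>L)"
  proof (intro Bochner_Integration.integral_cong refl)
    fix u assume "u \<in> space L"
    then have u: "0 \<le> u" by simp
    show "indicator {0..t} u * (simple_process N s x u \<omega> * b u \<omega>)
      = (\<Sum>i<N. x i \<omega> * (indicator {0..?m (Suc i)} u * b u \<omega> - indicator {0..?m i} u * b u \<omega>))"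
      unfolding simple_process_def sum_distrib_left sum_distrib_right
    proof (intro sum.cong refl)
      fix i assume "i \<in> {..<N}"
      then have "s i \<le> s (Suc i)" using s_Suc by simp
      then have "indicator {0..t} u * indicator {s i<..s (Suc i)} u
         = (indicator {0..?m (Suc i)} u - indicator {0..?m i} u :: real)"
        using u by (auto simp: indicator_def)
      then show "indicator {0..t} u * (x i \<omega> * indicator {s i<..s (Suc i)} u * b u \<omega>)
        = x i \<omega> * (indicator {0..?m (Suc i)} u * b u \<omega> - indicator {0..?m i} u * b u \<omega>)"
        by (metis (no_types, opaque_lifting) left_diff_distrib mult.assoc mult.left_commute)
    qed
  qed
  also have "\<dots> = (\<Sum>i<N. x i \<omega> * ((\<integral>u. indicator {0..?m (Suc i)} u * b u \<omega> \<partial>L) - (\<integral>u. indicator {0..?m i} u * b u \<omega> \<partial>L)))"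
    using i by (subst Bochner_Integration.integral_sum) auto
  also have "\<dots> = (\<Sum>i<N. x i \<omega> * \<beta> t i \<omega>)"
  proof (intro sum.cong refl)
    fix i assume "i \<in> {..<N}"
    then have "0 \<le> s i" "0 \<le> s (Suc i)" using s_in[of i] s_in[of "Suc i"] by auto
    then show "x i \<omega> * ((\<integral>u. indicator {0..?m (Suc i)} u * b u \<omega> \<partial>L) - (\<integral>u. indicator {0..?m i} u * b u \<omega> \<partial>L))
       = x i \<omega> * \<beta> t i \<omega>"
      using t time_integral_until[of "?m i" "\<lambda>u. b u \<omega>"] time_integral_until[of "?m (Suc i)" "\<lambda>u. b u \<omega>"]
      by (simp add: \<beta>_def min_le_iff_disj)
  qed
  finally show ?thesis .
qed

lemma riemann_part_integral:
  assumes t: "t \<in> {0..T}" and w: "\<omega> \<in> space M"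
  shows "riemann_part t \<omega> = (\<integral>u. indicator {0..t} u * frozen_drift u \<omega> \<partial>L)"
proof -
  have 1: "(\<integral>u. indicator {0..t} u * simple_process N s simple_part u \<omega> \<partial>L) = (\<Sum>i<N. simple_part i \<omega> * d t i)"
  proof -
    have "(\<integral>u. indicator {0..t} u * simple_process N s simple_part u \<omega> \<partial>L)
        = (LINT u:{0..t}|lborel. simple_process N s simple_part u \<omega>)"
      using t by (simp add: time_integral_until)
    also have "\<dots> = (\<Sum>i<N. simple_part i \<omega> * d t i)"
      using integral_simple_process[of N s t simple_part \<omega>] s_in s_Suc t
      by (simp add: has_bochner_integral_iff set_lebesgue_integral_def d_def)
    finally show ?thesis .
  qed
  have i: "integrable L (\<lambda>u. indicator {0..t} u * simple_process N s simple_part u \<omega>)"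
    "integrable L (\<lambda>u. indicator {0..t} u * (simple_process N s (frozen gz) u \<omega> * b u \<omega>))"
    by (intro bounded_joint_integrable_L bounded_joint_until bounded_joint_mult b_joint
        simple_bounded_joint simple_part_simple frozen_simple ctrl w)+
  have "(\<integral>u. indicator {0..t} u * frozen_drift u \<omega> \<partial>L)
    = (\<Sum>i<N. simple_part i \<omega> * d t i) + (\<Sum>i<N. frozen gz i \<omega> * \<beta> t i \<omega>)"
    unfolding frozen_drift_def distrib_left Bochner_Integration.integral_add[OF i] 1 simple_drift_integral[OF t w] ..
  also have "\<dots> = riemann_part t \<omega>"
    unfolding riemann_part_def simple_part_def sum.distrib[symmetric]
    by (intro sum.cong refl) (simp add: algebra_simps)
  finally show ?thesis by simp
qed

text \<open>The last two terms account for replacing \<open>v\<^sup>2\<close> by \<open>S\<^sup>2\<close>: the difference is at most \<open>2 * K * \<bar>v - S\<bar>\<close>, and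
  \<open>2 * \<bar>v - S\<bar> \<le> \<epsilon> + (v - S)\<^sup>2 / \<epsilon>\<close>.\<close>
definition pointwise_error :: "real \<Rightarrow> 'a \<Rightarrow> real" where
  "pointwise_error u \<omega> = \<bar>gt (Z u \<omega>) u - simple_process N s (frozen gt) u \<omega>\<bar>
     + (K * \<bar>gz (Z u \<omega>) u - simple_process N s (frozen gz) u \<omega>\<bar>
     + (K\<^sup>2 / 2 * \<bar>gzz (Z u \<omega>) u - simple_process N s (frozen gzz) u \<omega>\<bar>
     + (G * K / 2 * \<epsilon> + G * K / 2 / \<epsilon> * (simple_process N s v u \<omega> - S u \<omega>)\<^sup>2)))"

lemma diff_joint:
  "controlled T \<epsilon> C G f \<Longrightarrow> bounded_joint (\<lambda>u \<omega>. \<bar>f (Z u \<omega>) u - simple_process N s (frozen f) u \<omega>\<bar>)"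
  by (intro bounded_joint_intros comp_joint simple_bounded_joint frozen_simple)

lemma v_diff_joint: "bounded_joint (\<lambda>u \<omega>. (simple_process N s v u \<omega> - S u \<omega>)\<^sup>2)"
  by (intro bounded_joint_intros simple_bounded_joint v_simple S_joint)

lemma pointwise_error_joint: "bounded_joint pointwise_error"
  unfolding pointwise_error_def[abs_def]
  by (intro bounded_joint_add bounded_joint_mult bounded_joint_const diff_joint ctrl v_diff_joint)

definition drift_bound :: real where
  "drift_bound = (1 + K + K\<^sup>2 / 2) * (freezing_bound * T) + G * K / 2 * (\<epsilon> * T + \<delta> / \<epsilon>)"

lemma pointwise_error_EI: "time_expectation pointwise_error \<le> drift_bound"
proof -
  have "time_expectation pointwise_error = time_expectation (\<lambda>u \<omega>. \<bar>gt (Z u \<omega>) u - simple_process N s (frozen gt) u \<omega>\<bar>)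
    + (K * time_expectation (\<lambda>u \<omega>. \<bar>gz (Z u \<omega>) u - simple_process N s (frozen gz) u \<omega>\<bar>)
    + (K\<^sup>2 / 2 * time_expectation (\<lambda>u \<omega>. \<bar>gzz (Z u \<omega>) u - simple_process N s (frozen gzz) u \<omega>\<bar>)
    + (G * K / 2 * \<epsilon> * T + G * K / 2 / \<epsilon> * time_expectation (\<lambda>u \<omega>. (simple_process N s v u \<omega> - S u \<omega>)\<^sup>2))))"
    unfolding pointwise_error_def[abs_def] time_expectation_cmult[symmetric] time_expectation_const[symmetric]
    by (subst time_expectation_add, intro diff_joint ctrl,
        intro bounded_joint_add bounded_joint_mult bounded_joint_const diff_joint ctrl v_diff_joint,
        subst time_expectation_add, intro bounded_joint_mult bounded_joint_const diff_joint ctrl,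
        intro bounded_joint_add bounded_joint_mult bounded_joint_const diff_joint ctrl v_diff_joint,
        subst time_expectation_add, intro bounded_joint_mult bounded_joint_const diff_joint ctrl,
        intro bounded_joint_add bounded_joint_mult bounded_joint_const v_diff_joint,
        subst time_expectation_add, intro bounded_joint_const,
        intro bounded_joint_mult bounded_joint_const v_diff_joint, rule refl)
  also have "\<dots> \<le> freezing_bound * T + (K * (freezing_bound * T) + (K\<^sup>2 / 2 * (freezing_bound * T) + (G * K / 2 * \<epsilon> * T + G * K / 2 / \<epsilon> * \<delta>)))"
    using G_nonneg K_nonneg \<epsilon>
    by (intro add_mono mult_left_mono frozen_L1 ctrl v_close order_refl) auto
  also have "\<dots> = drift_bound" unfolding drift_bound_def by (simp add: algebra_simps)
  finally show ?thesis .
qed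

lemma drift_pointwise:
  assumes u: "0 < u" "u \<le> T" and w: "\<omega> \<in> space M"
  shows "\<bar>frozen_drift u \<omega> - drift u \<omega>\<bar> \<le> pointwise_error u \<omega>"
proof -
  obtain i where i: "i < N" "s i < u" "u \<le> s (Suc i)" using grid_interval_exists u by blast
  have uT: "u \<in> {0..T}" using u by simp
  note sp = simple_process_grid[OF i]
  define x y z where "x = frozen gt i \<omega>" and "y = frozen gz i \<omega>" and "z = frozen gzz i \<omega>"
  define x' y' z' where "x' = gt (Z u \<omega>) u" and "y' = gz (Z u \<omega>) u" and "z' = gzz (Z u \<omega>) u"
  define V S' b' where "V = v i \<omega>" and "S' = S u \<omega>" and "b' = b u \<omega>"
  have bnd: "\<bar>V\<bar> \<le> K" "\<bar>S'\<bar> \<le> K" "\<bar>b'\<bar> \<le> K" "\<bar>z\<bar> \<le> G"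
    using v_bound[OF i(1) w] S_bound[OF uT w] b_bound[OF uT w] frozen_bound[OF ctrl(4), of i \<omega>] i(1)
    by (auto simp: V_def S'_def b'_def z_def)
  have "frozen_drift u \<omega> - drift u \<omega> = (x - x') + ((y - y') * b' + ((z - z') / 2 * S'\<^sup>2 + z / 2 * ((V - S') * (V + S'))))"
    unfolding frozen_drift_def drift_def sp
    unfolding simple_part_def x_def[symmetric] y_def[symmetric] z_def[symmetric]
      x'_def[symmetric] y'_def[symmetric] z'_def[symmetric] V_def[symmetric] S'_def[symmetric] b'_def[symmetric]
    by (simp add: power2_eq_square algebra_simps) (simp add: field_simps)
  also have "\<bar>\<dots>\<bar> \<le> \<bar>x - x'\<bar> + (\<bar>(y - y') * b'\<bar> + (\<bar>(z - z') / 2 * S'\<^sup>2\<bar> + \<bar>z / 2 * ((V - S') * (V + S'))\<bar>))"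
    by (rule order_trans[OF abs_triangle_ineq add_left_mono], rule order_trans[OF abs_triangle_ineq add_left_mono],
        rule abs_triangle_ineq)
  also have "\<dots> \<le> \<bar>x' - x\<bar> + (K * \<bar>y' - y\<bar> + (K\<^sup>2 / 2 * \<bar>z' - z\<bar> + (G * K / 2 * \<epsilon> + G * K / 2 / \<epsilon> * (V - S')\<^sup>2)))"
  proof (intro add_mono)
    show "\<bar>x - x'\<bar> \<le> \<bar>x' - x\<bar>" by simp
    show "\<bar>(y - y') * b'\<bar> \<le> K * \<bar>y' - y\<bar>"
      using mult_left_mono[OF bnd(3), of "\<bar>y - y'\<bar>"] by (simp add: abs_mult abs_minus_commute mult.commute)
    have "S'\<^sup>2 \<le> K\<^sup>2" using power_mono[OF bnd(2) abs_ge_zero, of 2] unfolding power2_abs .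
    then show "\<bar>(z - z') / 2 * S'\<^sup>2\<bar> \<le> K\<^sup>2 / 2 * \<bar>z' - z\<bar>"
      using mult_left_mono[of "S'\<^sup>2" "K\<^sup>2" "\<bar>z - z'\<bar>"] by (simp add: abs_mult abs_minus_commute mult.commute)
    have "\<bar>V + S'\<bar> \<le> 2 * K" using bnd by linarith
    then have 1: "\<bar>V - S'\<bar> * \<bar>V + S'\<bar> \<le> \<bar>V - S'\<bar> * (2 * K)" by (intro mult_left_mono) auto
    have "0 \<le> (\<bar>V - S'\<bar> - \<epsilon>)\<^sup>2" by simp
    then have "2 * \<bar>V - S'\<bar> * \<epsilon> \<le> \<epsilon> * \<epsilon> + (V - S')\<^sup>2" by (simp add: power2_diff[of "\<bar>V - S'\<bar>"] power2_eq_square[of \<epsilon>])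
    then have "2 * \<bar>V - S'\<bar> \<le> (\<epsilon> * \<epsilon> + (V - S')\<^sup>2) / \<epsilon>" using \<epsilon> by (simp add: field_simps)
    then have "2 * \<bar>V - S'\<bar> \<le> \<epsilon> + (V - S')\<^sup>2 / \<epsilon>" using \<epsilon> by (simp add: add_divide_distrib)
    from mult_left_mono[OF this K_nonneg] 1
    have 2: "\<bar>V - S'\<bar> * \<bar>V + S'\<bar> \<le> K * (\<epsilon> + (V - S')\<^sup>2 / \<epsilon>)" by (simp add: mult_ac)
    have "\<bar>z / 2 * ((V - S') * (V + S'))\<bar> = \<bar>z\<bar> / 2 * (\<bar>V - S'\<bar> * \<bar>V + S'\<bar>)" by (simp add: abs_mult)
    also have "\<dots> \<le> G / 2 * (K * (\<epsilon> + (V - S')\<^sup>2 / \<epsilon>))"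
      by (rule mult_mono[OF _ 2]) (use bnd(4) G_nonneg in auto)
    also have "\<dots> = G * K / 2 * \<epsilon> + G * K / 2 / \<epsilon> * (V - S')\<^sup>2" by (simp add: algebra_simps)
    finally show "\<bar>z / 2 * ((V - S') * (V + S'))\<bar> \<le> G * K / 2 * \<epsilon> + G * K / 2 / \<epsilon> * (V - S')\<^sup>2" .
  qed
  finally show ?thesis
    unfolding pointwise_error_def sp unfolding x_def y_def z_def x'_def y'_def z'_def V_def S'_def .
qed

lemma drift_error:
  assumes t: "t \<in> {0..T}"
  shows "expectation (\<lambda>\<omega>. tsq ((LINT u:{0..t}|lborel. drift u \<omega>) - riemann_part t \<omega>)) \<le> drift_bound"
proof -
  have "expectation (\<lambda>\<omega>. tsq ((LINT u:{0..t}|lborel. drift u \<omega>) - riemann_part t \<omega>)) \<le> time_expectation pointwise_error"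
  proof (rule integral_mono)
    show "integrable M (\<lambda>\<omega>. tsq ((LINT u:{0..t}|lborel. drift u \<omega>) - riemann_part t \<omega>))"
      by (intro integrable_tsq borel_measurable_diff time_integral_measurable[OF drift_joint t] riemann_part_measurable t)
    show "integrable M (\<lambda>\<omega>. \<integral>u. pointwise_error u \<omega> \<partial>L)" by (rule integrable_time_integral[OF pointwise_error_joint])
    fix \<omega> assume w: "\<omega> \<in> space M"
    let ?f = "\<lambda>u. indicator {0..t} u * drift u \<omega> - indicator {0..t} u * frozen_drift u \<omega>"
    have i: "integrable L (\<lambda>u. indicator {0..t} u * drift u \<omega>)" "integrable L (\<lambda>u. indicator {0..t} u * frozen_drift u \<omega>)"
      by (intro bounded_joint_integrable_L bounded_joint_until drift_joint frozen_drift_joint w)+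
    have "(LINT u:{0..t}|lborel. drift u \<omega>) - riemann_part t \<omega> = (\<integral>u. ?f u \<partial>L)"
      using t by (simp add: time_integral_until riemann_part_integral[OF t w] i)
    then have "tsq ((LINT u:{0..t}|lborel. drift u \<omega>) - riemann_part t \<omega>) \<le> \<bar>\<integral>u. ?f u \<partial>L\<bar>"
      using tsq_le_abs by simp
    also have "\<dots> \<le> (\<integral>u. \<bar>?f u\<bar> \<partial>L)" by (rule integral_abs_bound)
    also have "\<dots> \<le> (\<integral>u. pointwise_error u \<omega> \<partial>L)"
    proof (rule time_integral_mono[where H = "\<lambda>u \<omega>. \<bar>indicator {0..t} u * drift u \<omega> - indicator {0..t} u * frozen_drift u \<omega>\<bar>"])
      show "bounded_joint (\<lambda>u \<omega>. \<bar>indicator {0..t} u * drift u \<omega> - indicator {0..t} u * frozen_drift u \<omega>\<bar>)"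
        by (intro bounded_joint_abs bounded_joint_diff bounded_joint_until drift_joint frozen_drift_joint)
      fix u assume u: "0 < u" "u \<le> T"
      have "\<bar>?f u\<bar> \<le> \<bar>frozen_drift u \<omega> - drift u \<omega>\<bar>" by (auto split: split_indicator)
      also note drift_pointwise[OF u w]
      finally show "\<bar>?f u\<bar> \<le> pointwise_error u \<omega>" .
    qed (use pointwise_error_joint w in auto)
    finally show "tsq ((LINT u:{0..t}|lborel. drift u \<omega>) - riemann_part t \<omega>) \<le> (\<integral>u. pointwise_error u \<omega> \<partial>L)" .
  qed
  also note pointwise_error_EI
  finally show ?thesis .
qed

lemma endpoint_error:
  assumes t: "t \<in> {0..T}"
  shows "expectation (\<lambda>\<omega>. tsq (g (A t \<omega>) t - g (Z t \<omega>) t)) \<le> \<epsilon> + C * \<delta>"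
proof -
  note [measurable] = A_measurable[OF t] Z_measurable[OF t]
  have m: "(\<lambda>\<omega>. A t \<omega> - Z t \<omega>) \<in> borel_measurable M" by measurable
  have "expectation (\<lambda>\<omega>. tsq (g (A t \<omega>) t - g (Z t \<omega>) t)) \<le> expectation (\<lambda>\<omega>. \<epsilon> + C * tsq (A t \<omega> - Z t \<omega>))"
  proof (rule integral_mono)
    show "integrable M (\<lambda>\<omega>. tsq (g (A t \<omega>) t - g (Z t \<omega>) t))"
      by (intro integrable_tsq borel_measurable_diff comp_measurable[OF ctrl(1) t] A_measurable Z_measurable t)
    show "integrable M (\<lambda>\<omega>. \<epsilon> + C * tsq (A t \<omega> - Z t \<omega>))" using integrable_tsq[OF m] by simp
    fix \<omega>
    show "tsq (g (A t \<omega>) t - g (Z t \<omega>) t) \<le> \<epsilon> + C * tsq (A t \<omega> - Z t \<omega>)"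
      using tsq_le_abs[of "g (A t \<omega>) t - g (Z t \<omega>) t"] controlledD(2)[OF ctrl(1) t t, of "A t \<omega>" "Z t \<omega>"] by simp
  qed
  also have "\<dots> = \<epsilon> + C * expectation (\<lambda>\<omega>. tsq (A t \<omega> - Z t \<omega>))"
    using integrable_tsq[OF m] by (simp add: prob_space)
  also have "\<dots> \<le> \<epsilon> + C * \<delta>" using A_close[OF t] C by (intro add_left_mono mult_left_mono)
  finally show ?thesis .
qed

text \<open>The four terms stem from the Taylor remainder, from the compensated squares, from replacing \<open>A\<close> by \<open>Z\<close> at
  the end point \<open>t\<close>, and from replacing the frozen drift by the drift.\<close>
lemma integral_error:
  assumes t: "t \<in> {0..T}"
  shows "expectation (\<lambda>\<omega>. tsq (simple_integral W N s \<xi> t \<omega>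
      - (g (Z t \<omega>) t - g (Z 0 \<omega>) 0 - (LINT u:{0..t}|lborel. drift u \<omega>))))
    \<le> 4 * (taylor_bound * T) + 4 * (G\<^sup>2 * K^4 * T * \<delta>) + 4 * (\<epsilon> + C * \<delta>) + 4 * drift_bound"
proof -
  let ?e1 = "\<lambda>\<omega>. - taylor_error t \<omega>" and ?e2 = "\<lambda>\<omega>. - variation_part t \<omega>"
  let ?e3 = "\<lambda>\<omega>. g (A t \<omega>) t - g (Z t \<omega>) t" and ?e4 = "\<lambda>\<omega>. (LINT u:{0..t}|lborel. drift u \<omega>) - riemann_part t \<omega>"
  have m: "?e1 \<in> borel_measurable M" "?e2 \<in> borel_measurable M" "?e3 \<in> borel_measurable M" "?e4 \<in> borel_measurable M"
    using taylor_error_measurable[OF t] variation_part_measurable[OF t]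
    by (auto intro!: borel_measurable_diff comp_measurable[OF ctrl(1) t] A_measurable Z_measurable t
        time_integral_measurable[OF drift_joint t] riemann_part_measurable)
  have m12: "(\<lambda>\<omega>. ?e1 \<omega> + ?e2 \<omega>) \<in> borel_measurable M" and m34: "(\<lambda>\<omega>. ?e3 \<omega> + ?e4 \<omega>) \<in> borel_measurable M"
    by (intro borel_measurable_add m)+
  have eq: "simple_integral W N s \<xi> t \<omega> - (g (Z t \<omega>) t - g (Z 0 \<omega>) 0 - (LINT u:{0..t}|lborel. drift u \<omega>))
     = (?e1 \<omega> + ?e2 \<omega>) + (?e3 \<omega> + ?e4 \<omega>)" for \<omega>
    by (simp add: taylor_error_def A_0)
  have "expectation (\<lambda>\<omega>. tsq (simple_integral W N s \<xi> t \<omega>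
      - (g (Z t \<omega>) t - g (Z 0 \<omega>) 0 - (LINT u:{0..t}|lborel. drift u \<omega>))))
    \<le> 2 * expectation (\<lambda>\<omega>. tsq (?e1 \<omega> + ?e2 \<omega>)) + 2 * expectation (\<lambda>\<omega>. tsq (?e3 \<omega> + ?e4 \<omega>))"
    unfolding eq by (rule expectation_tsq_add_le[OF m12 m34])
  also have "\<dots> \<le> 2 * (2 * expectation (\<lambda>\<omega>. tsq (?e1 \<omega>)) + 2 * expectation (\<lambda>\<omega>. tsq (?e2 \<omega>)))
     + 2 * (2 * expectation (\<lambda>\<omega>. tsq (?e3 \<omega>)) + 2 * expectation (\<lambda>\<omega>. tsq (?e4 \<omega>)))"
    by (intro add_mono mult_left_mono expectation_tsq_add_le m) auto
  also have "\<dots> \<le> 2 * (2 * (taylor_bound * T) + 2 * (G\<^sup>2 * K^4 * T * \<delta>)) + 2 * (2 * (\<epsilon> + C * \<delta>) + 2 * drift_bound)"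
    unfolding tsq_minus
    by (intro add_mono mult_left_mono taylor_error_expectation variation_part_expectation endpoint_error drift_error t) auto
  finally show ?thesis by simp
qed

lemma integrand_error:
  "time_expectation (\<lambda>u \<omega>. (simple_process N s \<xi> u \<omega> - S u \<omega> * gz (Z u \<omega>) u)\<^sup>2) \<le> 4 * K\<^sup>2 * G * (freezing_bound * T) + 2 * G\<^sup>2 * \<delta>"
proof -
  let ?a = "\<lambda>u \<omega>. \<bar>gz (Z u \<omega>) u - simple_process N s (frozen gz) u \<omega>\<bar>"
  let ?c = "\<lambda>u \<omega>. (simple_process N s v u \<omega> - S u \<omega>)\<^sup>2"
  have "time_expectation (\<lambda>u \<omega>. (simple_process N s \<xi> u \<omega> - S u \<omega> * gz (Z u \<omega>) u)\<^sup>2)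
     \<le> time_expectation (\<lambda>u \<omega>. 4 * K\<^sup>2 * G * ?a u \<omega> + 2 * G\<^sup>2 * ?c u \<omega>)"
  proof (rule time_expectation_mono)
    show "bounded_joint (\<lambda>u \<omega>. (simple_process N s \<xi> u \<omega> - S u \<omega> * gz (Z u \<omega>) u)\<^sup>2)"
      by (intro bounded_joint_power2 bounded_joint_diff bounded_joint_mult simple_bounded_joint \<xi>_simple S_joint comp_joint ctrl)
    show "bounded_joint (\<lambda>u \<omega>. 4 * K\<^sup>2 * G * ?a u \<omega> + 2 * G\<^sup>2 * ?c u \<omega>)"
      by (intro bounded_joint_add bounded_joint_mult bounded_joint_const diff_joint ctrl v_diff_joint)
    fix u \<omega> assume u: "0 < u" "u \<le> T" and w: "\<omega> \<in> space M"
    obtain i where i: "i < N" "s i < u" "u \<le> s (Suc i)" using grid_interval_exists u by blast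
    have uT: "u \<in> {0..T}" using u by simp
    note sp = simple_process_grid[OF i]
    define y y' V S' where "y = frozen gz i \<omega>" and "y' = gz (Z u \<omega>) u" and "V = v i \<omega>" and "S' = S u \<omega>"
    have bnd: "\<bar>S'\<bar> \<le> K" "\<bar>y\<bar> \<le> G" "\<bar>y'\<bar> \<le> G"
      using S_bound[OF uT w] frozen_bound[OF ctrl(3), of i \<omega>] controlledD(1)[OF ctrl(3) uT] i(1)
      by (auto simp: S'_def y_def y'_def)
    have "(y * V - S' * y')\<^sup>2 = (S' * (y - y') + y * (V - S'))\<^sup>2"
      by (rule arg_cong[where f = "\<lambda>x. x\<^sup>2"]) (simp add: algebra_simps)
    also have "\<dots> \<le> 2 * (S' * (y - y'))\<^sup>2 + 2 * (y * (V - S'))\<^sup>2"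
      using sum_squares_bound[of "S' * (y - y')" "y * (V - S')"] by (simp add: power2_sum)
    also have "\<dots> = 2 * (S'\<^sup>2 * (y - y')\<^sup>2) + 2 * (y\<^sup>2 * (V - S')\<^sup>2)" by (simp add: power_mult_distrib)
    also have "\<dots> \<le> 2 * (K\<^sup>2 * (2 * G * \<bar>y' - y\<bar>)) + 2 * (G\<^sup>2 * (V - S')\<^sup>2)"
    proof -
      have S2: "S'\<^sup>2 \<le> K\<^sup>2" using power_mono[OF bnd(1) abs_ge_zero, of 2] unfolding power2_abs .
      have y2: "y\<^sup>2 \<le> G\<^sup>2" using power_mono[OF bnd(2) abs_ge_zero, of 2] unfolding power2_abs .
      have "\<bar>y - y'\<bar> \<le> 2 * G" using bnd by linarith
      then have "\<bar>y - y'\<bar> * \<bar>y - y'\<bar> \<le> 2 * G * \<bar>y - y'\<bar>" by (intro mult_right_mono) auto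
      then have "(y - y')\<^sup>2 \<le> 2 * G * \<bar>y' - y\<bar>"
        unfolding abs_minus_commute[of y' y] by (simp add: power2_eq_square)
      then show ?thesis using S2 y2 by (intro add_mono mult_left_mono mult_mono) auto
    qed
    finally have "(y * V - S' * y')\<^sup>2 \<le> 4 * K\<^sup>2 * G * \<bar>y' - y\<bar> + 2 * G\<^sup>2 * (V - S')\<^sup>2" by simp
    then show "(simple_process N s \<xi> u \<omega> - S u \<omega> * gz (Z u \<omega>) u)\<^sup>2 \<le> 4 * K\<^sup>2 * G * ?a u \<omega> + 2 * G\<^sup>2 * ?c u \<omega>"
      unfolding sp unfolding \<xi>_def y_def y'_def V_def S'_def .
  qed
  also have "\<dots> = 4 * K\<^sup>2 * G * time_expectation ?a + 2 * G\<^sup>2 * time_expectation ?c"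
    using time_expectation_add[OF bounded_joint_mult[OF bounded_joint_const diff_joint[OF ctrl(3)]]
        bounded_joint_mult[OF bounded_joint_const v_diff_joint], of "4 * K\<^sup>2 * G" "2 * G\<^sup>2"]
    unfolding time_expectation_cmult .
  also have "\<dots> \<le> 4 * K\<^sup>2 * G * (freezing_bound * T) + 2 * G\<^sup>2 * \<delta>"
    using G_nonneg by (intro add_mono mult_left_mono frozen_L1 ctrl v_close) auto
  finally show ?thesis .
qed

end

lemma tame_controlled:
  assumes "tame T f"
  shows "\<exists>G. \<forall>\<epsilon>>0. \<exists>C\<ge>0. controlled T \<epsilon> C G f"
proof -
  obtain G where G: "\<And>z s. s \<in> {0..T} \<Longrightarrow> \<bar>f z s\<bar> \<le> G" using assms unfolding tame_def by metis
  show ?thesis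
  proof (rule exI[of _ G], intro allI impI)
    fix \<epsilon> :: real assume "0 < \<epsilon>"
    then obtain C where "0 \<le> C" "\<forall>z z'. \<forall>s\<in>{0..T}. \<forall>s'\<in>{0..T}.
        \<bar>f z s - f z' s'\<bar> \<le> \<epsilon> + C * (tsq (z - z') + \<bar>s - s'\<bar>)"
      using assms unfolding tame_def by metis
    then show "\<exists>C\<ge>0. controlled T \<epsilon> C G f"
      using assms G unfolding tame_def controlled_def by (intro exI[of _ C]) simp
  qed
qed

lemma controlled_mono:
  assumes "controlled T \<epsilon> C G f" "C \<le> C'" "G \<le> G'"
  shows "controlled T \<epsilon> C' G' f"
  unfolding controlled_def
proof (intro conjI allI ballI)
  show "continuous_on (UNIV \<times> {0..T}) (\<lambda>(z, t). f z t)" using assms(1) by (simp add: controlled_def)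
  fix z z' s s' assume s: "s \<in> {0..T}"
  show "\<bar>f z s\<bar> \<le> G'" using controlledD(1)[OF assms(1) s, of z] assms(3) by simp
  assume s': "s' \<in> {0..T}"
  have "C * (tsq (z - z') + \<bar>s - s'\<bar>) \<le> C' * (tsq (z - z') + \<bar>s - s'\<bar>)"
    using assms(2) by (intro mult_right_mono) auto
  then show "\<bar>f z s - f z' s'\<bar> \<le> \<epsilon> + C' * (tsq (z - z') + \<bar>s - s'\<bar>)"
    using controlledD(2)[OF assms(1) s s', of z z'] by linarith
qed

context bounded_ito_process
begin

text \<open>As \<open>\<delta>\<close> tends to 0 the two error bounds tend to limits whose sum is \<open>\<epsilon> * c\<close>.  So first \<open>\<epsilon>\<close> is chosen with
  \<open>\<epsilon> * c < \<eta>\<close>; it determines the constant \<open>C\<close> in the moduli of continuity, and then a small \<open>\<delta>\<close> is taken.\<close>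
lemma tame_ito_approximation:
  assumes I: "stoch_integral M F T W S martingale_part" and g: "class_C21 T g gt gz gzz"
    and tame: "tame T g" "tame T gt" "tame T gz" "tame T gzz" and \<eta>: "0 < \<eta>"
  shows "\<exists>N s \<xi>. simple_integrand M F T N s \<xi> \<and>
    time_expectation (\<lambda>u \<omega>. (simple_process N s \<xi> u \<omega> - S u \<omega> * gz (Z u \<omega>) u)\<^sup>2) \<le> \<eta> \<and>
    (\<forall>t\<in>{0..T}. expectation (\<lambda>\<omega>. tsq (simple_integral W N s \<xi> t \<omega> - (g (Z t \<omega>) t - g (Z 0 \<omega>) 0
      - (LINT u:{0..t}|lborel. gt (Z u \<omega>) u + b u \<omega> * gz (Z u \<omega>) u + (S u \<omega>)\<^sup>2 / 2 * gzz (Z u \<omega>) u)))) \<le> \<eta>)"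
proof -
  obtain G1 G2 G3 G4 where
    G1: "\<And>\<epsilon>. 0 < \<epsilon> \<Longrightarrow> \<exists>C\<ge>0. controlled T \<epsilon> C G1 g" and G2: "\<And>\<epsilon>. 0 < \<epsilon> \<Longrightarrow> \<exists>C\<ge>0. controlled T \<epsilon> C G2 gt" and
    G3: "\<And>\<epsilon>. 0 < \<epsilon> \<Longrightarrow> \<exists>C\<ge>0. controlled T \<epsilon> C G3 gz" and G4: "\<And>\<epsilon>. 0 < \<epsilon> \<Longrightarrow> \<exists>C\<ge>0. controlled T \<epsilon> C G4 gzz"
    using tame_controlled[OF tame(1)] tame_controlled[OF tame(2)] tame_controlled[OF tame(3)] tame_controlled[OF tame(4)]
    by auto
  define G where "G = max (max G1 G2) (max (max G3 G4) 0)"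
  define c where "c = 4 * (2 * (1 + 2 * K\<^sup>2) + G * K\<^sup>2 / 2) * T + 4 + 4 * ((1 + K + K\<^sup>2 / 2) * T + G * K / 2 * T)
     + 4 * K\<^sup>2 * G * T"
  have G0: "0 \<le> G" by (simp add: G_def)
  have "0 \<le> 4 * (2 * (1 + 2 * K\<^sup>2) + G * K\<^sup>2 / 2) * T" "0 \<le> 4 * ((1 + K + K\<^sup>2 / 2) * T + G * K / 2 * T)"
    "0 \<le> 4 * K\<^sup>2 * G * T"
    using T_pos K_nonneg G0 by (intro mult_nonneg_nonneg add_nonneg_nonneg divide_nonneg_nonneg; simp)+
  then have c: "0 < c" unfolding c_def by linarith
  define \<epsilon> where "\<epsilon> = \<eta> / (2 * c)"
  have \<epsilon>: "0 < \<epsilon>" "\<epsilon> * c < \<eta>" using \<eta> c by (auto simp: \<epsilon>_def)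
  obtain C1 C2 C3 C4 where C: "0 \<le> C1" "0 \<le> C2" "0 \<le> C3" "0 \<le> C4" "controlled T \<epsilon> C1 G1 g"
    "controlled T \<epsilon> C2 G2 gt" "controlled T \<epsilon> C3 G3 gz" "controlled T \<epsilon> C4 G4 gzz"
    using G1[OF \<epsilon>(1)] G2[OF \<epsilon>(1)] G3[OF \<epsilon>(1)] G4[OF \<epsilon>(1)] by blast
  define C where "C = max (max C1 C2) (max C3 C4)"
  have C0: "0 \<le> C" using \<open>0 \<le> C1\<close> by (simp add: C_def)
  have ctrl: "controlled T \<epsilon> C G g" "controlled T \<epsilon> C G gt" "controlled T \<epsilon> C G gz" "controlled T \<epsilon> C G gzz"
    by (rule controlled_mono[OF C(5)] controlled_mono[OF C(6)] controlled_mono[OF C(7)] controlled_mono[OF C(8)];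
        simp add: C_def G_def)+
  define r where "r = (\<lambda>\<delta>. \<epsilon> + C * ((3 + 8 * K\<^sup>2) * \<delta>))"
  define r2 where "r2 = (\<lambda>\<delta>. 2 * \<epsilon> * (1 + 2 * K\<^sup>2) + 8 * C * (1 + 2 * K\<^sup>2)\<^sup>2 * \<delta> + G * K\<^sup>2 / 2 * (\<delta> + \<epsilon> + \<delta> / \<epsilon>))"
  define r3 where "r3 = (\<lambda>\<delta>. (1 + K + K\<^sup>2 / 2) * (r \<delta> * T) + G * K / 2 * (\<epsilon> * T + \<delta> / \<epsilon>))"
  define B1 where "B1 = (\<lambda>\<delta>. 4 * (r2 \<delta> * T) + 4 * (G\<^sup>2 * K^4 * T * \<delta>) + 4 * (\<epsilon> + C * \<delta>) + 4 * r3 \<delta>)"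
  define B2 where "B2 = (\<lambda>\<delta>. 4 * K\<^sup>2 * G * (r \<delta> * T) + 2 * G\<^sup>2 * \<delta>)"
  have "B1 0 + B2 0 = \<epsilon> * c"
    unfolding B1_def B2_def r_def r2_def r3_def c_def by (simp add: algebra_simps)
  moreover have "0 \<le> B2 0" "0 \<le> B1 0"
    unfolding B1_def B2_def r_def r2_def r3_def using T_pos K_nonneg G0 \<epsilon>(1) by auto
  ultimately have B0: "B1 0 < \<eta>" "B2 0 < \<eta>" using \<epsilon>(2) by linarith+
  have "((\<lambda>\<delta>. B1 \<delta>) \<longlongrightarrow> B1 0) (at_right 0)" "((\<lambda>\<delta>. B2 \<delta>) \<longlongrightarrow> B2 0) (at_right 0)"
    unfolding B1_def B2_def r_def r2_def r3_def using \<epsilon>(1) by (auto intro!: tendsto_eq_intros)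
  then have "\<forall>\<^sub>F \<delta> in at_right 0. B1 \<delta> < \<eta>" "\<forall>\<^sub>F \<delta> in at_right 0. B2 \<delta> < \<eta>"
    using B0 by (auto dest: order_tendstoD(2))
  moreover have "\<forall>\<^sub>F \<delta> in at_right (0::real). 0 < \<delta> \<and> \<delta> < 1"
    using eventually_at_right_real[of 0 1] by (auto elim: eventually_mono)
  ultimately have "\<forall>\<^sub>F \<delta> in at_right 0. B1 \<delta> < \<eta> \<and> B2 \<delta> < \<eta> \<and> 0 < \<delta> \<and> \<delta> < 1"
    by eventually_elim auto
  then have "\<exists>\<delta>. B1 \<delta> < \<eta> \<and> B2 \<delta> < \<eta> \<and> 0 < \<delta> \<and> \<delta> < 1"
    by (rule eventually_happens'[rotated]) simp
  then obtain \<delta> where \<delta>: "B1 \<delta> < \<eta>" "B2 \<delta> < \<eta>" "0 < \<delta>" "\<delta> \<le> 1" by auto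
  have le: "B1 \<delta> \<le> \<eta>" "B2 \<delta> \<le> \<eta>" using \<delta> by simp_all
  obtain N s v P where ap: "grid T N s P" "P \<subseteq> {0..T}" "\<And>i. i < N \<Longrightarrow> s (Suc i) - s i \<le> \<delta>"
    "simple_integrand M F T N s v" "\<And>i \<omega>. i < N \<Longrightarrow> \<omega> \<in> space M \<Longrightarrow> \<bar>v i \<omega>\<bar> \<le> K"
    "expectation (\<lambda>\<omega>. \<integral>u. (simple_process N s v u \<omega> - S u \<omega>)\<^sup>2 \<partial>L) \<le> \<delta>"
    "\<And>t. t \<in> {0..T} \<Longrightarrow> expectation (\<lambda>\<omega>. tsq (simple_integral W N s v t \<omega> - martingale_part t \<omega>)) \<le> \<delta>"
    using bounded_integrand_approximation[OF I S_bound \<delta>(3)] by blast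
  interpret ito_step M F W T Z b S K N s P v \<delta> g gt gz gzz \<epsilon> C G
    by unfold_locales (fact ap \<delta> g \<epsilon>(1) C0 ctrl)+
  have "time_expectation (\<lambda>u \<omega>. (simple_process N s \<xi> u \<omega> - S u \<omega> * gz (Z u \<omega>) u)\<^sup>2) \<le> B2 \<delta>"
    using integrand_error unfolding B2_def r_def freezing_bound_def .
  moreover have "expectation (\<lambda>\<omega>. tsq (simple_integral W N s \<xi> t \<omega> - (g (Z t \<omega>) t - g (Z 0 \<omega>) 0
      - (LINT u:{0..t}|lborel. gt (Z u \<omega>) u + b u \<omega> * gz (Z u \<omega>) u + (S u \<omega>)\<^sup>2 / 2 * gzz (Z u \<omega>) u)))) \<le> B1 \<delta>"
    if "t \<in> {0..T}" for t
    using integral_error[OF that] unfolding B1_def r_def r2_def r3_def freezing_bound_def taylor_bound_def drift_bound_def drift_def .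
  ultimately show ?thesis using \<xi>_simple le
    by (intro exI[of _ N] exI[of _ s] exI[of _ \<xi>] conjI ballI) (blast intro: order_trans)+
qed

end

section \<open>Localisation and the Ito formula\<close>

context filtered_prob_space
begin

lemma progressive_add: "progressive F T H \<Longrightarrow> progressive F T G \<Longrightarrow> progressive F T (\<lambda>t \<omega>. H t \<omega> + G t \<omega>)"
  unfolding progressive_def case_prod_unfold by (auto intro!: borel_measurable_add)

lemma progressive_mult: "progressive F T H \<Longrightarrow> progressive F T G \<Longrightarrow> progressive F T (\<lambda>t \<omega>. H t \<omega> * G t \<omega>)"
  unfolding progressive_def case_prod_unfold by (auto intro!: borel_measurable_times)

lemma progressive_half_square: "progressive F T H \<Longrightarrow> progressive F T (\<lambda>t \<omega>. (H t \<omega>)\<^sup>2 / 2)"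
  unfolding progressive_def case_prod_unfold by (auto intro!: borel_measurable_divide borel_measurable_power)

lemma progressive_initial:
  assumes "B \<in> borel_measurable (F 0)"
  shows "progressive F T (\<lambda>t. B)"
  unfolding progressive_def case_prod_unfold
proof
  fix t assume "t \<in> {0..T}"
  then have "B \<in> borel_measurable (F t)" using measurable_F_mono[OF assms] by simp
  then show "(\<lambda>x. B (snd x)) \<in> borel_measurable (restrict_space borel {0..t} \<Otimes>\<^sub>M F t)"
    by (rule measurable_compose[OF measurable_snd])
qed

end

text \<open>The event that a continuous path stays in \<open>{- R..R}\<close> is described by countably many times, which makes it
  measurable.\<close>
lemma bounded_on_rationals_imp_bounded:
  fixes f :: "real \<Rightarrow> real"
  assumes f: "continuous_on {0..T} f" and T: "0 < T" and R: "\<And>q. q \<in> \<rat> \<inter> {0..T} \<Longrightarrow> \<bar>f q\<bar> \<le> R" and u: "u \<in> {0..T}"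
  shows "\<bar>f u\<bar> \<le> R"
proof -
  have "closure ({0<..<T} \<inter> \<rat>) = closure {0<..<T}"
    by (rule closure_open_Int_superset) (auto simp: Rats_closure_real)
  then have cl: "closure ({0<..<T} \<inter> \<rat>) = {0..T}" using T by simp
  have "continuous_on (closure ({0<..<T} \<inter> \<rat>)) (\<lambda>u. \<bar>f u\<bar>)"
    unfolding cl by (intro continuous_intros f)
  then show ?thesis
    by (rule continuous_le_on_closure[where f = "\<lambda>u. \<bar>f u\<bar>"]) (use u R in \<open>auto simp: cl\<close>)
qed

context wiener_horizon
begin

lemma stoch_integral_cong_AE:
  assumes I: "stoch_integral M F T W H I" and J: "\<And>t. t \<in> {0..T} \<Longrightarrow> J t \<in> borel_measurable M"
    and eq: "AE \<omega> in M. \<forall>t\<in>{0..T}. I t \<omega> = J t \<omega>"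
  shows "stoch_integral M F T W H J"
proof -
  from I obtain n \<tau> \<xi> where prog: "progressive F T H" and Im: "\<And>t. t \<in> {0..T} \<Longrightarrow> I t \<in> borel_measurable M"
    and Ic: "AE \<omega> in M. continuous_on {0..T} (\<lambda>t. I t \<omega>)"
    and \<xi>: "\<And>k. simple_integrand M F T (n k) (\<tau> k) (\<xi> k)"
    and null: "null_in_prob M (\<lambda>k \<omega>. \<integral>\<^sup>+s\<in>{0..T}.
          ennreal ((simple_process (n k) (\<tau> k) (\<xi> k) s \<omega> - H s \<omega>)\<^sup>2) \<partial>lborel)"
    and nullI: "\<And>t. t \<in> {0..T} \<Longrightarrow> null_in_prob M (\<lambda>k \<omega>.
          ennreal \<bar>simple_integral W (n k) (\<tau> k) (\<xi> k) t \<omega> - I t \<omega>\<bar>)"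
    unfolding stoch_integral_def by blast
  show ?thesis
    unfolding stoch_integral_def
  proof (intro conjI ballI exI[of _ n] exI[of _ \<tau>] exI[of _ \<xi>] allI prog \<xi> null J)
    show "AE \<omega> in M. continuous_on {0..T} (\<lambda>t. J t \<omega>)"
      using Ic eq
    proof eventually_elim
      case (elim \<omega>)
      show ?case by (rule continuous_on_eq[OF elim(1)]) (use elim(2) in auto)
    qed
    fix t assume t: "t \<in> {0..T}"
    have Sm: "simple_integral W (n k) (\<tau> k) (\<xi> k) t \<in> borel_measurable M" for k
      using simple_integral_measurable[OF \<xi>] t by simp
    have mI: "(\<lambda>\<omega>. simple_integral W (n k) (\<tau> k) (\<xi> k) t \<omega> - I t \<omega>) \<in> borel_measurable M" for k
      by (intro borel_measurable_diff Sm Im t)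
    have mJ: "(\<lambda>\<omega>. simple_integral W (n k) (\<tau> k) (\<xi> k) t \<omega> - J t \<omega>) \<in> borel_measurable M" for k
      by (intro borel_measurable_diff Sm J t)
    have "expectation (\<lambda>\<omega>. tsq (simple_integral W (n k) (\<tau> k) (\<xi> k) t \<omega> - J t \<omega>))
      = expectation (\<lambda>\<omega>. tsq (simple_integral W (n k) (\<tau> k) (\<xi> k) t \<omega> - I t \<omega>))" for k
    proof (rule integral_cong_AE)
      show "AE \<omega> in M. tsq (simple_integral W (n k) (\<tau> k) (\<xi> k) t \<omega> - J t \<omega>)
         = tsq (simple_integral W (n k) (\<tau> k) (\<xi> k) t \<omega> - I t \<omega>)"
        using eq by eventually_elim (use t in auto)
    qed (auto intro!: measurable_compose[OF _ borel_measurable_tsq] mI mJ)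
    then show "null_in_prob M (\<lambda>k \<omega>. ennreal \<bar>simple_integral W (n k) (\<tau> k) (\<xi> k) t \<omega> - J t \<omega>\<bar>)"
      using expectation_tsq_tendsto[OF mI nullI[OF t]] by (intro null_in_probI mJ) simp
  qed
qed

lemma sqdist_nn_measurable:
  assumes H: "progressive F T H" and \<xi>: "simple_integrand M F T n \<tau> \<xi>"
  shows "(\<lambda>\<omega>. \<integral>\<^sup>+s\<in>{0..T}. ennreal ((simple_process n \<tau> \<xi> s \<omega> - H s \<omega>)\<^sup>2) \<partial>lborel) \<in> borel_measurable M"
proof -
  have "(\<lambda>(s, \<omega>). simple_process n \<tau> \<xi> s \<omega>) \<in> borel_measurable (L \<Otimes>\<^sub>M M)"
    using simple_bounded_joint[OF \<xi>] by (simp add: bounded_joint_def)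
  then have "(\<lambda>(s, \<omega>). ennreal ((simple_process n \<tau> \<xi> s \<omega> - H s \<omega>)\<^sup>2)) \<in> borel_measurable (L \<Otimes>\<^sub>M M)"
    using progressive_joint[OF H] unfolding case_prod_unfold
    by (intro measurable_compose[OF _ measurable_ennreal] borel_measurable_power borel_measurable_diff)
  from measurable_pair_swap[OF this]
  have "(\<lambda>\<omega>. \<integral>\<^sup>+s. ennreal ((simple_process n \<tau> \<xi> s \<omega> - H s \<omega>)\<^sup>2) \<partial>L) \<in> borel_measurable M"
    by (intro L.borel_measurable_nn_integral) simp
  then show ?thesis by (simp add: nn_integral_restrict_space)
qed

end

text \<open>The process \<open>Y\<close> that the formula leaves for the stochastic integral is continuous and measurable by
  construction.  As the \<open>k\<close>-th simple integrand one takes a good approximation for \<open>g\<close> composed with the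
  cutoff at level \<open>k + 1\<close>.  On the event \<open>E k\<close> that the path of \<open>Z\<close> stays within that level, the cutoff changes
  neither the integrand nor \<open>Y\<close>, and the probability of \<open>E k\<close> tends to 1.\<close>
theorem (in bounded_ito_process) ito_formula:
  assumes I: "stoch_integral M F T W S martingale_part"
    and Zc: "AE \<omega> in M. continuous_on {0..T} (\<lambda>t. Z t \<omega>)"
    and g: "class_C21 T g gt gz gzz"
  shows "stoch_differential M F T W (\<lambda>t \<omega>. g (Z t \<omega>) t)
     (\<lambda>t \<omega>. gt (Z t \<omega>) t + b t \<omega> * gz (Z t \<omega>) t + (S t \<omega>)\<^sup>2 / 2 * gzz (Z t \<omega>) t)
     (\<lambda>t \<omega>. S t \<omega> * gz (Z t \<omega>) t)"
proof -
  define a where "a = (\<lambda>t \<omega>. gt (Z t \<omega>) t + b t \<omega> * gz (Z t \<omega>) t + (S t \<omega>)\<^sup>2 / 2 * gzz (Z t \<omega>) t)"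
  define H where "H = (\<lambda>t \<omega>. S t \<omega> * gz (Z t \<omega>) t)"
  define Y where "Y = (\<lambda>t \<omega>. g (Z t \<omega>) t - g (Z 0 \<omega>) 0 - (LINT s:{0..t}|lborel. a s \<omega>))"
  have cont: "continuous_on (UNIV \<times> {0..T}) (\<lambda>(z, t). g z t)" "continuous_on (UNIV \<times> {0..T}) (\<lambda>(z, t). gt z t)"
    "continuous_on (UNIV \<times> {0..T}) (\<lambda>(z, t). gz z t)" "continuous_on (UNIV \<times> {0..T}) (\<lambda>(z, t). gzz z t)"
    using g by (auto simp: class_C21_def)
  have prog: "progressive F T (\<lambda>t \<omega>. g (Z t \<omega>) t)" "progressive F T a" "progressive F T H"
    unfolding a_def H_def
    by (intro progressive_add progressive_mult progressive_half_square progressive_comp_continuous[OF Z_prog] cont b_prog S_prog)+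
  have gm: "(\<lambda>\<omega>. g (Z t \<omega>) t) \<in> borel_measurable M" if "t \<in> {0..T}" for t
    using progressive_adapted[OF prog(1) that] that by (auto intro: measurable_F_M)
  have Ym: "Y t \<in> borel_measurable M" if t: "t \<in> {0..T}" for t
  proof -
    have "(\<lambda>\<omega>. LINT s:{0..t}|lborel. a s \<omega>) \<in> borel_measurable M"
      using measurable_F_M[OF progressive_time_integral_adapted[OF prog(2) t]] t by simp
    then show ?thesis unfolding Y_def using gm[OF t] gm[of 0] T_pos by (intro borel_measurable_diff) auto
  qed
  have "\<forall>k. \<exists>g' gt' gz' gzz'. class_C21 T g' gt' gz' gzz' \<and>
     tame T g' \<and> tame T gt' \<and> tame T gz' \<and> tame T gzz' \<and>
     (\<forall>z s. \<bar>z\<bar> \<le> real (Suc k) \<longrightarrow> g' z s = g z s \<and> gt' z s = gt z s \<and> gz' z s = gz z s \<and> gzz' z s = gzz z s)"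
    by (intro allI class_C21_comp_cutoff[OF _ g]) simp
  then obtain g' gt' gz' gzz' where g': "\<And>k. class_C21 T (g' k) (gt' k) (gz' k) (gzz' k)"
    and tame: "\<And>k. tame T (g' k)" "\<And>k. tame T (gt' k)" "\<And>k. tame T (gz' k)" "\<And>k. tame T (gzz' k)"
    and agree: "\<And>k z s. \<bar>z\<bar> \<le> real (Suc k) \<Longrightarrow> g' k z s = g z s \<and> gt' k z s = gt z s \<and> gz' k z s = gz z s \<and> gzz' k z s = gzz z s"
    by metis
  define a' where "a' = (\<lambda>k t \<omega>. gt' k (Z t \<omega>) t + b t \<omega> * gz' k (Z t \<omega>) t + (S t \<omega>)\<^sup>2 / 2 * gzz' k (Z t \<omega>) t)"
  define H' where "H' = (\<lambda>k t \<omega>. S t \<omega> * gz' k (Z t \<omega>) t)"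
  define Y' where "Y' = (\<lambda>k t \<omega>. g' k (Z t \<omega>) t - g' k (Z 0 \<omega>) 0 - (LINT s:{0..t}|lborel. a' k s \<omega>))"
  have comp': "bounded_joint (\<lambda>u \<omega>. f (Z u \<omega>) u)" if f: "tame T f" for f
  proof -
    from f obtain G where "\<And>z s. s \<in> {0..T} \<Longrightarrow> \<bar>f z s\<bar> \<le> G" unfolding tame_def by metis
    with f show ?thesis
      by (intro bounded_jointI[where C = G] progressive_comp_continuous[OF Z_prog]) (auto simp: tame_def)
  qed
  have a'j: "bounded_joint (a' k)" and H'j: "bounded_joint (H' k)" for k
    unfolding a'_def H'_def
    by (intro bounded_joint_add bounded_joint_mult b_joint S_joint half_square_joint comp' tame)+
  have Y'm: "Y' k t \<in> borel_measurable M" if t: "t \<in> {0..T}" for k t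
    unfolding Y'_def
    using bounded_joint_integrable_M[OF comp'[OF tame(1)] t] bounded_joint_integrable_M[OF comp'[OF tame(1)], of 0] t T_pos
    by (intro borel_measurable_diff time_integral_measurable a'j) auto
  define approx where "approx = (\<lambda>k N s \<xi>. simple_integrand M F T N s \<xi> \<and>
    time_expectation (\<lambda>u \<omega>. (simple_process N s \<xi> u \<omega> - H' k u \<omega>)\<^sup>2) \<le> 1 / real (Suc k) \<and>
    (\<forall>t\<in>{0..T}. expectation (\<lambda>\<omega>. tsq (simple_integral W N s \<xi> t \<omega> - Y' k t \<omega>)) \<le> 1 / real (Suc k)))"
  have "\<forall>k. \<exists>N s \<xi>. approx k N s \<xi>"
    unfolding approx_def H'_def Y'_def a'_def
    by (intro allI tame_ito_approximation[OF I g' tame]) simp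
  then obtain N s \<xi> where "\<And>k. approx k (N k) (s k) (\<xi> k)" by metis
  then have \<xi>: "\<And>k. simple_integrand M F T (N k) (s k) (\<xi> k)"
    and d1: "\<And>k. time_expectation (\<lambda>u \<omega>. (simple_process (N k) (s k) (\<xi> k) u \<omega> - H' k u \<omega>)\<^sup>2) \<le> 1 / real (Suc k)"
    and d2: "\<And>k t. t \<in> {0..T} \<Longrightarrow> expectation (\<lambda>\<omega>. tsq (simple_integral W (N k) (s k) (\<xi> k) t \<omega> - Y' k t \<omega>)) \<le> 1 / real (Suc k)"
    unfolding approx_def by blast+
  define E where "E = (\<lambda>k. {\<omega> \<in> space M. \<forall>q\<in>\<rat> \<inter> {0..T}. \<bar>Z q \<omega>\<bar> \<le> real (Suc k)})"
  have Em: "E k \<in> events" for k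
    unfolding E_def
  proof (rule sets.sets_Collect_countable_All')
    show "countable (\<rat> \<inter> {0..T})" using countable_rat by (rule countable_Int1)
    fix q assume "q \<in> \<rat> \<inter> {0..T}"
    then have [measurable]: "Z q \<in> borel_measurable M" using Z_measurable by simp
    show "{\<omega> \<in> space M. \<bar>Z q \<omega>\<bar> \<le> real (Suc k)} \<in> events" by measurable
  qed
  define p where "p = (\<lambda>k. prob (space M - E k))"
  have bnd: "\<bar>Z u \<omega>\<bar> \<le> real (Suc k)" if "continuous_on {0..T} (\<lambda>t. Z t \<omega>)" "\<omega> \<in> E k" "u \<in> {0..T}" for u \<omega> k
    using bounded_on_rationals_imp_bounded[OF that(1) T_pos _ that(3), of "real (Suc k)"] that(2) by (auto simp: E_def)
  have in_E: "\<exists>k. \<omega> \<in> E k" if c: "continuous_on {0..T} (\<lambda>t. Z t \<omega>)" and w: "\<omega> \<in> space M" for \<omega>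
  proof -
    from compact_imp_bounded[OF compact_continuous_image[OF c compact_Icc]]
    obtain B where "\<forall>x\<in>(\<lambda>t. Z t \<omega>) ` {0..T}. norm x \<le> B" unfolding bounded_iff by blast
    then have "\<And>u. u \<in> {0..T} \<Longrightarrow> \<bar>Z u \<omega>\<bar> \<le> B" by simp
    moreover obtain k where "B \<le> real k" using real_arch_simple by blast
    ultimately have "\<bar>Z u \<omega>\<bar> \<le> real (Suc k)" if "u \<in> {0..T}" for u using that by fastforce
    with w have "\<omega> \<in> E k" by (auto simp: E_def)
    then show ?thesis by blast
  qed
  have p0: "p \<longlonglongrightarrow> 0"
  proof -
    have "incseq E" by (auto simp: incseq_def E_def intro: order_trans)
    then have "(\<lambda>k. prob (E k)) \<longlonglongrightarrow> prob (\<Union>k. E k)" using Em by (intro finite_Lim_measure_incseq) auto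
    moreover have "prob (\<Union>k. E k) = 1"
    proof (subst prob_eq_1)
      show "(\<Union>k. E k) \<in> events" using Em by auto
      show "AE \<omega> in M. \<omega> \<in> (\<Union>k. E k)" using Zc AE_space by eventually_elim (use in_E in auto)
    qed
    ultimately have "(\<lambda>k. 1 - prob (E k)) \<longlonglongrightarrow> 1 - 1" by (intro tendsto_diff) auto
    then show ?thesis using prob_compl[OF Em] by (simp add: p_def)
  qed
  have eqs: "a u \<omega> = a' k u \<omega>" "H u \<omega> = H' k u \<omega>" "g (Z u \<omega>) u = g' k (Z u \<omega>) u"
    if "continuous_on {0..T} (\<lambda>t. Z t \<omega>)" "\<omega> \<in> E k" "u \<in> {0..T}" for u \<omega> k
    using agree[OF bnd[OF that]] by (auto simp: a_def a'_def H_def H'_def)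
  have eqY: "Y t \<omega> = Y' k t \<omega>" if "continuous_on {0..T} (\<lambda>t. Z t \<omega>)" "\<omega> \<in> E k" "t \<in> {0..T}" for t \<omega> k
  proof -
    have "(LINT s:{0..t}|lborel. a s \<omega>) = (LINT s:{0..t}|lborel. a' k s \<omega>)"
      using eqs(1)[OF that(1,2)] that(3) by (intro set_lebesgue_integral_cong) auto
    moreover have "g (Z 0 \<omega>) 0 = g' k (Z 0 \<omega>) 0" using eqs(3)[OF that(1,2), of 0] T_pos by simp
    ultimately show ?thesis using eqs(3)[OF that] by (simp add: Y_def Y'_def)
  qed
  have aint: "set_integrable lborel {0..T} (\<lambda>s. a s \<omega>)"
    if c: "continuous_on {0..T} (\<lambda>t. Z t \<omega>)" and w: "\<omega> \<in> space M" for \<omega>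
  proof -
    obtain k where k: "\<omega> \<in> E k" using in_E[OF c w] by auto
    have "set_integrable lborel {0..T} (\<lambda>s. a' k s \<omega>) = set_integrable lborel {0..T} (\<lambda>s. a s \<omega>)"
      using eqs(1)[OF c k] by (intro set_integrable_cong) auto
    then show ?thesis using bounded_joint_set_integrable[OF a'j w] by simp
  qed
  have lim: "(\<lambda>k. c * (1 / real (Suc k)) + p k) \<longlonglongrightarrow> 0" for c
    using tendsto_add[OF tendsto_mult_right_zero[OF LIMSEQ_Suc[OF lim_1_over_n], of c] p0] by simp
  have pE: "space M - E k \<in> events" for k using Em by auto
  have "stoch_integral M F T W H Y"
    unfolding stoch_integral_def
  proof (intro conjI ballI exI[of _ N] exI[of _ s] exI[of _ \<xi>] allI prog(3) Ym \<xi>)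
    show "AE \<omega> in M. continuous_on {0..T} (\<lambda>t. Y t \<omega>)"
      using Zc AE_space
    proof eventually_elim
      case (elim \<omega>)
      have p: "continuous_on {0..T} (\<lambda>t. (Z t \<omega>, t))" by (intro continuous_intros elim)
      have "continuous_on {0..T} (\<lambda>t. (\<lambda>(z, t). g z t) (Z t \<omega>, t))"
        by (rule continuous_on_compose2[OF cont(1) p]) auto
      then show ?case unfolding Y_def using continuous_on_time_integral[OF aint[OF elim]]
        by (intro continuous_intros) auto
    qed
    show "null_in_prob M (\<lambda>k \<omega>. \<integral>\<^sup>+u\<in>{0..T}. ennreal ((simple_process (N k) (s k) (\<xi> k) u \<omega> - H u \<omega>)\<^sup>2) \<partial>lborel)"
      (is "null_in_prob M ?q")
      unfolding null_in_prob_def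
    proof (intro conjI allI impI)
      show qm: "?q k \<in> borel_measurable M" for k by (rule sqdist_nn_measurable[OF prog(3) \<xi>])
      fix e :: real assume e: "0 < e"
      let ?X = "\<lambda>k \<omega>. \<integral>u. (simple_process (N k) (s k) (\<xi> k) u \<omega> - H' k u \<omega>)\<^sup>2 \<partial>L"
      have le: "prob {\<omega> \<in> space M. ennreal e < ?q k \<omega>} \<le> (1 / e) * (1 / real (Suc k)) + p k" for k
      proof -
        have Xi: "integrable M (?X k)"
          by (intro integrable_time_integral bounded_joint_intros simple_bounded_joint[OF \<xi>] H'j)
        have Xm: "{\<omega> \<in> space M. e \<le> ?X k \<omega>} \<in> events"
          using borel_measurable_integrable[OF Xi] by measurable
        have "prob {\<omega> \<in> space M. ennreal e < ?q k \<omega>} \<le> prob ({\<omega> \<in> space M. e \<le> ?X k \<omega>} \<union> (space M - E k))"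
        proof (rule finite_measure_mono_AE)
          show "AE \<omega> in M. \<omega> \<in> {\<omega> \<in> space M. ennreal e < ?q k \<omega>} \<longrightarrow> \<omega> \<in> {\<omega> \<in> space M. e \<le> ?X k \<omega>} \<union> (space M - E k)"
            using Zc AE_space
          proof eventually_elim
            case (elim \<omega>)
            show ?case
            proof (cases "\<omega> \<in> E k")
              case True
              have "?q k \<omega> = (\<integral>\<^sup>+u\<in>{0..T}. ennreal ((simple_process (N k) (s k) (\<xi> k) u \<omega> - H' k u \<omega>)\<^sup>2) \<partial>lborel)"
                using eqs(2)[OF elim(1) True] by (intro nn_integral_cong) (auto split: split_indicator)
              also have "\<dots> = ennreal (?X k \<omega>)" by (rule nn_integral_sqdist[OF H'j \<xi> elim(2)])
              finally have q: "?q k \<omega> = ennreal (?X k \<omega>)" .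
              show ?thesis using e elim(2) by (auto simp: q ennreal_less_iff)
            qed (use elim in auto)
          qed
          show "{\<omega> \<in> space M. e \<le> ?X k \<omega>} \<union> (space M - E k) \<in> events" using Xm pE by auto
        qed
        also have "\<dots> \<le> prob {\<omega> \<in> space M. e \<le> ?X k \<omega>} + p k"
          unfolding p_def by (rule measure_Un_le[OF Xm pE])
        also have "prob {\<omega> \<in> space M. e \<le> ?X k \<omega>} \<le> expectation (?X k) / e"
          using e by (intro integral_Markov_inequality_measure[OF Xi, of "{}"]) auto
        also have "\<dots> \<le> (1 / real (Suc k)) / e" using d1[of k] e by (intro divide_right_mono) auto
        finally show ?thesis by (simp add: mult.commute)
      qed
      show "(\<lambda>k. prob {\<omega> \<in> space M. ennreal e < ?q k \<omega>}) \<longlonglongrightarrow> 0"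
        by (rule tendsto_sandwich[OF _ _ tendsto_const lim[of "1 / e"]]) (use le in \<open>auto intro!: always_eventually\<close>)
    qed
    fix t assume t: "t \<in> {0..T}"
    let ?D = "\<lambda>k \<omega>. simple_integral W (N k) (s k) (\<xi> k) t \<omega> - Y t \<omega>"
    let ?D' = "\<lambda>k \<omega>. simple_integral W (N k) (s k) (\<xi> k) t \<omega> - Y' k t \<omega>"
    have Dm: "?D k \<in> borel_measurable M" and D'm: "?D' k \<in> borel_measurable M" for k
      using t by (auto intro!: borel_measurable_diff simple_integral_measurable[OF \<xi>] Ym Y'm)
    show "null_in_prob M (\<lambda>k \<omega>. ennreal \<bar>?D k \<omega>\<bar>)"
    proof (rule null_in_probI[OF Dm])
      have le: "expectation (\<lambda>\<omega>. tsq (?D k \<omega>)) \<le> 1 * (1 / real (Suc k)) + p k" for k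
      proof -
        have iE: "integrable M (indicator (space M - E k) :: 'a \<Rightarrow> real)"
          using pE[of k] by (intro integrable_real_indicator) (auto simp: less_top[symmetric])
        have "expectation (\<lambda>\<omega>. tsq (?D k \<omega>)) \<le> expectation (\<lambda>\<omega>. tsq (?D' k \<omega>) + indicator (space M - E k) \<omega>)"
        proof (intro integral_mono_AE integrable_tsq Dm D'm Bochner_Integration.integrable_add iE)
          show "AE \<omega> in M. tsq (?D k \<omega>) \<le> tsq (?D' k \<omega>) + indicator (space M - E k) \<omega>"
            using Zc AE_space
          proof eventually_elim
            case (elim \<omega>)
            show ?case
            proof (cases "\<omega> \<in> E k")
              case True
              then show ?thesis using eqY[OF elim(1) True t] by simp
            next
              case False
              then have "indicator (space M - E k) \<omega> = (1 :: real)" using elim by simp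
              then show ?thesis using tsq_le_1[of "?D k \<omega>"] tsq_nonneg[of "?D' k \<omega>"] by linarith
            qed
          qed
        qed
        also have "\<dots> = expectation (\<lambda>\<omega>. tsq (?D' k \<omega>)) + p k"
          unfolding p_def using pE[of k]
          by (subst Bochner_Integration.integral_add[OF integrable_tsq[OF D'm] iE]) simp
        finally show ?thesis using d2[OF t, of k] by simp
      qed
      show "(\<lambda>k. expectation (\<lambda>\<omega>. tsq (?D k \<omega>))) \<longlonglongrightarrow> 0"
        by (rule tendsto_sandwich[OF _ _ tendsto_const lim[of 1]]) (use le in \<open>auto intro!: always_eventually\<close>)
    qed
  qed
  moreover have "AE \<omega> in M. set_integrable lborel {0..T} (\<lambda>s. a s \<omega>) \<and>
         (\<forall>t\<in>{0..T}. g (Z t \<omega>) t = g (Z 0 \<omega>) 0 + (LINT s:{0..t}|lborel. a s \<omega>) + Y t \<omega>)"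
    using Zc AE_space by eventually_elim (use aint in \<open>auto simp: Y_def\<close>)
  ultimately have "stoch_differential M F T W (\<lambda>t \<omega>. g (Z t \<omega>) t) a H"
    unfolding stoch_differential_def using prog(2) by blast
  then show ?thesis unfolding a_def H_def .
qed

lemma (in wiener_horizon) stoch_differential_cong_AE:
  assumes Y: "stoch_differential M F T W Y a H" and c: "progressive F T c"
    and eq: "AE \<omega> in M. \<forall>t. a t \<omega> = c t \<omega>"
  shows "stoch_differential M F T W Y c H"
proof -
  from Y obtain I where I: "stoch_integral M F T W H I"
    and ae: "AE \<omega> in M. set_integrable lborel {0..T} (\<lambda>s. a s \<omega>) \<and>
         (\<forall>t\<in>{0..T}. Y t \<omega> = Y 0 \<omega> + (LINT s:{0..t}|lborel. a s \<omega>) + I t \<omega>)"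
    unfolding stoch_differential_def by blast
  have "AE \<omega> in M. set_integrable lborel {0..T} (\<lambda>s. c s \<omega>) \<and>
         (\<forall>t\<in>{0..T}. Y t \<omega> = Y 0 \<omega> + (LINT s:{0..t}|lborel. c s \<omega>) + I t \<omega>)"
    using ae eq
  proof eventually_elim
    case (elim \<omega>)
    from elim(2) have eq: "a s \<omega> = c s \<omega>" for s by simp
    show ?case using elim(1) unfolding eq .
  qed
  then show ?thesis unfolding stoch_differential_def using c I by blast
qed

section \<open>The system with the random drift\<close>
theorem proposition4:
  fixes M :: "'a measure" and F :: "real \<Rightarrow> 'a measure"
    and W Z :: "real \<Rightarrow> 'a \<Rightarrow> real" and B :: "'a \<Rightarrow> real"
    and \<mu> \<sigma> g gt gz gzz :: "real \<Rightarrow> real \<Rightarrow> real"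
    and lam T z0 :: real
  assumes "filtered_prob_space M F"
    and "wiener_process M F W"
    and "lam > 0" and "T > 0"
    and "bernoulli_drift M F W lam B"
    and "standard_coefficients T \<mu> \<sigma>"
    and "solves_sde M F T (bernoulli_noise B W) \<mu> \<sigma> z0 Z"
    and "class_C21 T g gt gz gzz"
  shows "stoch_differential M F T W (\<lambda>t \<omega>. g (Z t \<omega>) t)
     (\<lambda>t \<omega>. gt (Z t \<omega>) t + (\<mu> (Z t \<omega>) t + \<sigma> (Z t \<omega>) t * B \<omega>) * gz (Z t \<omega>) t
             + (\<sigma> (Z t \<omega>) t)\<^sup>2 / 2 * gzz (Z t \<omega>) t)
     (\<lambda>t \<omega>. \<sigma> (Z t \<omega>) t * gz (Z t \<omega>) t)"
proof -
  interpret filtered_prob_space M F by fact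
  interpret wiener_horizon M F W T by unfold_locales fact+
  define \<beta> where "\<beta> = sqrt (2 * lam)"
  have \<beta>: "0 < \<beta>" using \<open>lam > 0\<close> by (simp add: \<beta>_def)
  have B0: "B \<in> borel_measurable (F 0)"
    and pB: "prob {\<omega> \<in> space M. B \<omega> = \<beta>} = 1 / 2" "prob {\<omega> \<in> space M. B \<omega> = - \<beta>} = 1 / 2"
    using \<open>bernoulli_drift M F W lam B\<close> by (auto simp: bernoulli_drift_def \<beta>_def)
  have [measurable]: "B \<in> borel_measurable M" by (rule measurable_F_M[OF B0]) simp
  have AEB: "AE \<omega> in M. \<bar>B \<omega>\<bar> \<le> \<beta>"
  proof -
    let ?P = "{\<omega> \<in> space M. B \<omega> = \<beta>}" and ?Q = "{\<omega> \<in> space M. B \<omega> = - \<beta>}"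
    have "prob (?P \<union> ?Q) = prob ?P + prob ?Q"
      using \<beta> by (intro finite_measure_Union) auto
    then have "prob (?P \<union> ?Q) = 1" using pB by simp
    then have "AE \<omega> in M. \<omega> \<in> ?P \<union> ?Q" by (rule AE_prob_1)
    then show ?thesis by eventually_elim (use \<beta> in auto)
  qed
  \<comment> \<open>\<open>B\<close> is bounded almost surely only; clipping it makes the drift \<open>b\<close> bounded everywhere.\<close>
  define B' where "B' = (\<lambda>\<omega>. clamp_to \<beta> (B \<omega>))"
  have B'0: "B' \<in> borel_measurable (F 0)"
    unfolding B'_def by (rule measurable_compose[OF B0 borel_measurable_clamp_to])
  have B'B: "AE \<omega> in M. B' \<omega> = B \<omega>" using AEB by eventually_elim (simp add: B'_def clamp_to_ident)
  have B'b: "\<bar>B' \<omega>\<bar> \<le> \<beta>" for \<omega> unfolding B'_def using \<beta> by (intro abs_clamp_to) simp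
  obtain K0 where K0: "\<And>z t. t \<in> {0..T} \<Longrightarrow> \<bar>\<mu> z t\<bar> \<le> K0 \<and> \<bar>\<sigma> z t\<bar> \<le> K0"
    using \<open>standard_coefficients T \<mu> \<sigma>\<close> unfolding standard_coefficients_def by metis
  have K00: "0 \<le> K0" using K0[of 0 0] T_pos by fastforce
  have meas: "(\<lambda>(z, t). \<mu> z t) \<in> borel_measurable (restrict_space borel (UNIV \<times> {0..T}))"
    "(\<lambda>(z, t). \<sigma> z t) \<in> borel_measurable (restrict_space borel (UNIV \<times> {0..T}))"
    using \<open>standard_coefficients T \<mu> \<sigma>\<close> by (auto simp: standard_coefficients_def)
  have Zp: "progressive F T Z" and Zc: "AE \<omega> in M. continuous_on {0..T} (\<lambda>t. Z t \<omega>)"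
    and Zd: "stoch_differential M F T (bernoulli_noise B W) Z (\<lambda>t \<omega>. \<mu> (Z t \<omega>) t) (\<lambda>t \<omega>. \<sigma> (Z t \<omega>) t)"
    using \<open>solves_sde M F T (bernoulli_noise B W) \<mu> \<sigma> z0 Z\<close> by (auto simp: solves_sde_def)
  define m where "m = (\<lambda>t \<omega>. \<mu> (Z t \<omega>) t)"
  define S where "S = (\<lambda>t \<omega>. \<sigma> (Z t \<omega>) t)"
  define b where "b = (\<lambda>t \<omega>. m t \<omega> + S t \<omega> * B' \<omega>)"
  have mp: "progressive F T m" and Sp: "progressive F T S"
    unfolding m_def S_def by (rule progressive_comp[OF Zp meas(1)], rule progressive_comp[OF Zp meas(2)])
  have bp: "progressive F T b"
    unfolding b_def by (intro progressive_add progressive_mult mp Sp progressive_initial B'0)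
  have mb: "\<bar>m t \<omega>\<bar> \<le> K0" and Sb: "\<bar>S t \<omega>\<bar> \<le> K0" if "t \<in> {0..T}" for t \<omega>
    using K0[OF that] by (auto simp: m_def S_def)
  define K where "K = K0 + K0 * \<beta>"
  have K0K: "K0 \<le> K" using K00 \<beta> by (simp add: K_def)
  have SK: "\<bar>S t \<omega>\<bar> \<le> K" if "t \<in> {0..T}" for t \<omega> using Sb[OF that, of \<omega>] K0K by linarith
  have bK: "\<bar>b t \<omega>\<bar> \<le> K" if "t \<in> {0..T}" for t \<omega>
  proof -
    have "\<bar>S t \<omega> * B' \<omega>\<bar> \<le> K0 * \<beta>"
      unfolding abs_mult using Sb[OF that] B'b K00 by (intro mult_mono) auto
    then show ?thesis unfolding b_def K_def using mb[OF that, of \<omega>] by linarith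
  qed
  interpret bounded_ito_process M F W T Z b S K
    by unfold_locales (use Zp bp Sp bK SK K00 K0K in auto)
  from Zd obtain I where I: "stoch_integral M F T (bernoulli_noise B W) S I"
    and Zeq: "AE \<omega> in M. set_integrable lborel {0..T} (\<lambda>s. m s \<omega>) \<and>
       (\<forall>t\<in>{0..T}. Z t \<omega> = Z 0 \<omega> + (LINT s:{0..t}|lborel. m s \<omega>) + I t \<omega>)"
    unfolding stoch_differential_def m_def S_def by blast
  have "stoch_integral M F T W S (\<lambda>t \<omega>. I t \<omega> - B \<omega> * (LINT s:{0..t}|lborel. S s \<omega>))"
    by (rule stoch_integral_drift_removal[OF I _ AEB SK]) measurable
  then have SI: "stoch_integral M F T W S martingale_part"
  proof (rule stoch_integral_cong_AE)
    fix t assume t: "t \<in> {0..T}"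
    then show "martingale_part t \<in> borel_measurable M"
      unfolding martingale_part_def[abs_def] using T_pos
      by (intro borel_measurable_diff Z_measurable time_integral_measurable[OF b_joint]) auto
  next
    show "AE \<omega> in M. \<forall>t\<in>{0..T}. I t \<omega> - B \<omega> * (LINT s:{0..t}|lborel. S s \<omega>) = martingale_part t \<omega>"
      using Zeq B'B AE_space
    proof eventually_elim
      case (elim \<omega>)
      show ?case
      proof
        fix t assume t: "t \<in> {0..T}"
        have im: "set_integrable lborel {0..t} (\<lambda>s. m s \<omega>)"
          by (rule set_integrable_subset[OF conjunct1[OF elim(1)]]) (use t in auto)
        have iS: "set_integrable lborel {0..t} (\<lambda>s. S s \<omega>)"
          by (rule set_integrable_subset[OF bounded_joint_set_integrable[OF S_joint elim(3)]]) (use t in auto)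
        have Zt: "Z t \<omega> = Z 0 \<omega> + (LINT s:{0..t}|lborel. m s \<omega>) + I t \<omega>" using elim(1) t by blast
        have "(LINT s:{0..t}|lborel. b s \<omega>) = (LINT s:{0..t}|lborel. m s \<omega>) + (LINT s:{0..t}|lborel. S s \<omega> * B' \<omega>)"
          unfolding b_def using iS by (intro set_integral_add(2) im) simp
        also have "(LINT s:{0..t}|lborel. S s \<omega> * B' \<omega>) = B \<omega> * (LINT s:{0..t}|lborel. S s \<omega>)"
          using elim(2) by simp
        finally show "I t \<omega> - B \<omega> * (LINT s:{0..t}|lborel. S s \<omega>) = martingale_part t \<omega>"
          unfolding martingale_part_def Zt by simp
      qed
    qed
  qed
  note ito = ito_formula[OF SI Zc \<open>class_C21 T g gt gz gzz\<close>]
  have cont: "continuous_on (UNIV \<times> {0..T}) (\<lambda>(z, t). gt z t)"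
    "continuous_on (UNIV \<times> {0..T}) (\<lambda>(z, t). gz z t)" "continuous_on (UNIV \<times> {0..T}) (\<lambda>(z, t). gzz z t)"
    using \<open>class_C21 T g gt gz gzz\<close> by (auto simp: class_C21_def)
  have "stoch_differential M F T W (\<lambda>t \<omega>. g (Z t \<omega>) t)
     (\<lambda>t \<omega>. gt (Z t \<omega>) t + (m t \<omega> + S t \<omega> * B \<omega>) * gz (Z t \<omega>) t + (S t \<omega>)\<^sup>2 / 2 * gzz (Z t \<omega>) t)
     (\<lambda>t \<omega>. S t \<omega> * gz (Z t \<omega>) t)"
  proof (rule stoch_differential_cong_AE[OF ito])
    show "progressive F T (\<lambda>t \<omega>. gt (Z t \<omega>) t + (m t \<omega> + S t \<omega> * B \<omega>) * gz (Z t \<omega>) t + (S t \<omega>)\<^sup>2 / 2 * gzz (Z t \<omega>) t)"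
      by (intro progressive_add progressive_mult progressive_half_square progressive_comp_continuous[OF Zp] cont
          mp Sp progressive_initial B0)
    show "AE \<omega> in M. \<forall>t. gt (Z t \<omega>) t + b t \<omega> * gz (Z t \<omega>) t + (S t \<omega>)\<^sup>2 / 2 * gzz (Z t \<omega>) t
       = gt (Z t \<omega>) t + (m t \<omega> + S t \<omega> * B \<omega>) * gz (Z t \<omega>) t + (S t \<omega>)\<^sup>2 / 2 * gzz (Z t \<omega>) t"
      using B'B by eventually_elim (simp add: b_def)
  qed
  then show ?thesis unfolding m_def S_def .
qed

end
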